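(* Let $n\ge 1$ be an integer and let $\mathbf{C}^n$ be the defining representation of $\mathrm{GL}_n(\mathbf{C})$. For all non-negative integers $k$ and $l$, as representations of $\mathrm{GL}_n(\mathbf{C})$, $$\mathrm{Sym}^k(\mathbf{C}^n)\otimes\mathrm{Sym}^l(\wedge^2\mathbf{C}^n)\cong\bigoplus_{\lambda}W^n_\lambda,$$ where the sum is over all partitions $\lambda$ of $k+2l$ with exactly $k$ odd columns.
   Context: A polynomial representation of $\mathrm{GL}_n(\mathbf{C})$ is a finite dimensional complex representation whose matrix entries are polynomials in the entries of the group element. For a polynomial representation $(\rho,W)$, its character is $\mathrm{ch}_W(x_1,\dots,x_n)=\mathrm{tr}(\rho(\mathrm{diag}(x_1,\dots,x_n)))$. A semistandard Young tableau of shape $\lambda$ in $n$ letters is a filling of the Young diagram of $\lambda$ (with $\lambda_i$ boxes in row $i$) by numbers in $\{1,\dots,n\}$, weakly increasing along rows and strictly increasing down columns; the Schur polynomial $s_\lambda(x_1,\dots,x_n)$ is the sum over all such tableaux of $x_1^{\mu_1}\cdots x_n^{\mu_n}$, where $\mu_i$ is the number of occurrences of $i$. For a partition $\lambda$ with at most $n$ nonzero parts, $W^n_\lambda$ denotes the irreducible polynomial representation of $\mathrm{GL}_n(\mathbf{C})$ (unique up to isomorphism) with character $s_\lambda(x_1,\dots,x_n)$. Convention: $W^n_\lambda=0$ if $\lambda$ has more than $n$ nonzero parts. The columns of $\lambda$ are the (nonzero) parts of the conjugate partition $\lambda'$, $\lambda'_i=\#\{j\mid\lambda_j\ge i\}$;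 "$\lambda$ has $k$ odd columns" means that exactly $k$ of the parts of $\lambda'$ are odd. *)

theory Defs
  imports
    "Jordan_Normal_Form.Matrix"
    "HOL-Combinatorics.Multiset_Permutations"
    "HOL-Library.FuncSet"
    "HOL-Library.Function_Algebras"
begin

section \<open>Finite-dimensional representations of the complex general linear group\<close>

text \<open>
  A representation is carried by the vector space with a chosen basis indexed by a finite set.
  Vectors are coordinate functions vanishing off that index set, and \<open>entry R g i j\<close> is the
  \<open>(i, j)\<close> entry of the matrix of \<open>g\<close> in that basis: \<open>g e\<^sub>j = (\<Sum>i. entry R g i j \<cdot> e\<^sub>i)\<close>.
  General index sets let the usual bases of tensor, symmetric and exterior powers be used directly.
\<close>

record 'i gl_rep =
  basis :: "'i set"
  entry :: "complex mat \<Rightarrow> 'i \<Rightarrow> 'i \<Rightarrow> complex"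

definition GL :: "nat \<Rightarrow> complex mat set" where
  "GL n = {g \<in> carrier_mat n n. invertible_mat g}"

definition is_rep :: "nat \<Rightarrow> 'i gl_rep \<Rightarrow> bool" where
  "is_rep n R \<longleftrightarrow>
     finite (basis R) \<and>
     (\<forall>i\<in>basis R. \<forall>j\<in>basis R. entry R (1\<^sub>m n) i j = (if i = j then 1 else 0)) \<and>
     (\<forall>g\<in>GL n. \<forall>h\<in>GL n. \<forall>i\<in>basis R. \<forall>j\<in>basis R.
        entry R (g * h) i j = (\<Sum>m\<in>basis R. entry R g i m * entry R h m j))"

inductive_set entry_polynomials :: "nat \<Rightarrow> (complex mat \<Rightarrow> complex) set" for n where
  const: "(\<lambda>g. c) \<in> entry_polynomials n"
| coord: "i < n \<Longrightarrow> j < n \<Longrightarrow> (\<lambda>g. g $$ (i, j)) \<in> entry_polynomials n"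
| add: "p \<in> entry_polynomials n \<Longrightarrow> q \<in> entry_polynomials n
    \<Longrightarrow> (\<lambda>g. p g + q g) \<in> entry_polynomials n"
| mult: "p \<in> entry_polynomials n \<Longrightarrow> q \<in> entry_polynomials n
    \<Longrightarrow> (\<lambda>g. p g * q g) \<in> entry_polynomials n"

definition polynomial_rep :: "nat \<Rightarrow> 'i gl_rep \<Rightarrow> bool" where
  "polynomial_rep n R \<longleftrightarrow> is_rep n R \<and>
     (\<forall>i\<in>basis R. \<forall>j\<in>basis R. \<exists>p\<in>entry_polynomials n. \<forall>g\<in>GL n. entry R g i j = p g)"

definition rep_space :: "'i gl_rep \<Rightarrow> ('i \<Rightarrow> complex) set" where
  "rep_space R = {v. \<forall>i. i \<notin> basis R \<longrightarrow> v i = 0}"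

definition rep_act :: "'i gl_rep \<Rightarrow> complex mat \<Rightarrow> ('i \<Rightarrow> complex) \<Rightarrow> 'i \<Rightarrow> complex" where
  "rep_act R g v = (\<lambda>i. if i \<in> basis R then \<Sum>j\<in>basis R. entry R g i j * v j else 0)"

definition fun_scale :: "complex \<Rightarrow> ('i \<Rightarrow> complex) \<Rightarrow> 'i \<Rightarrow> complex" where
  "fun_scale c v = (\<lambda>i. c * v i)"

definition irreducible_rep :: "nat \<Rightarrow> 'i gl_rep \<Rightarrow> bool" where
  "irreducible_rep n R \<longleftrightarrow> rep_space R \<noteq> {0} \<and>
     (\<forall>U. module.subspace fun_scale U \<and> U \<subseteq> rep_space R \<and> (\<forall>g\<in>GL n. rep_act R g ` U \<subseteq> U)
        \<longrightarrow> U = {0} \<or> U = rep_space R)"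

text \<open>
  The map \<open>f\<close> below is linear on all coordinate functions, but only its restriction to
  \<open>rep_space R\<close> matters; every linear map on that subspace extends.
\<close>

definition rep_iso :: "nat \<Rightarrow> 'i gl_rep \<Rightarrow> 'j gl_rep \<Rightarrow> bool" where
  "rep_iso n R S \<longleftrightarrow>
     (\<exists>f. Vector_Spaces.linear fun_scale fun_scale f \<and>
          bij_betw f (rep_space R) (rep_space S) \<and>
          (\<forall>g\<in>GL n. \<forall>v\<in>rep_space R. f (rep_act R g v) = rep_act S g (f v)))"

definition rep_character :: "nat \<Rightarrow> 'i gl_rep \<Rightarrow> (nat \<Rightarrow> complex) \<Rightarrow> complex" where
  "rep_character n R x = (\<Sum>i\<in>basis R. entry R (mat_diag n x) i i)"


section \<open>Constructions\<close>

definition std_rep :: "nat \<Rightarrow> nat gl_rep" where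
  "std_rep n = \<lparr>basis = {..<n}, entry = (\<lambda>g i j. g $$ (i, j))\<rparr>"

definition zero_rep :: "'i gl_rep" where
  "zero_rep = \<lparr>basis = {}, entry = (\<lambda>g i j. 0)\<rparr>"

definition direct_sum :: "'a set \<Rightarrow> ('a \<Rightarrow> 'i gl_rep) \<Rightarrow> ('a \<times> 'i) gl_rep" where
  "direct_sum A R =
     \<lparr>basis = (SIGMA a:A. basis (R a)),
      entry = (\<lambda>g (a, i) (b, j). if a = b then entry (R a) g i j else 0)\<rparr>"

definition tensor_rep :: "'i gl_rep \<Rightarrow> 'j gl_rep \<Rightarrow> ('i \<times> 'j) gl_rep" where
  "tensor_rep R S =
     \<lparr>basis = basis R \<times> basis S,
      entry = (\<lambda>g (i, i') (j, j'). entry R g i j * entry S g i' j')\<rparr>"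

definition tensor_power :: "nat \<Rightarrow> 'i gl_rep \<Rightarrow> 'i list gl_rep" where
  "tensor_power k R =
     \<lparr>basis = {I. set I \<subseteq> basis R \<and> length I = k},
      entry = (\<lambda>g I J. \<Prod>r<k. entry R g (I ! r) (J ! r))\<rparr>"

text \<open>
  The symmetric power is the quotient of the tensor power by permutation of the factors: the basis
  tensors indexed by the words \<open>I\<close> with \<open>mset I = M\<close> are identified to one basis element, the
  monomial \<open>M\<close>. To act on the monomial \<open>N\<close>, act on any word \<open>J\<close> with \<open>mset J = N\<close> and collect terms;
  the result does not depend on \<open>J\<close>, as permuting \<open>J\<close> only permutes the words \<open>I\<close> summed over.
\<close>

definition sym_power :: "nat \<Rightarrow> 'i gl_rep \<Rightarrow> 'i multiset gl_rep" where
  "sym_power k R =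
     \<lparr>basis = {M. set_mset M \<subseteq> basis R \<and> size M = k},
      entry = (\<lambda>g M N. \<Sum>I\<in>permutations_of_multiset M.
                 entry (tensor_power k R) g I (SOME J. mset J = N))\<rparr>"

text \<open>
  The exterior square is the quotient of the tensor square by the tensors \<open>v \<otimes> v\<close>, with basis
  \<open>e\<^sub>i \<and> e\<^sub>j\<close> for \<open>i < j\<close>; here \<open>e\<^sub>i \<otimes> e\<^sub>j\<close> and \<open>e\<^sub>j \<otimes> e\<^sub>i\<close> map to \<open>e\<^sub>i \<and> e\<^sub>j\<close> and its negative.
\<close>

definition ext_square :: "'i::linorder gl_rep \<Rightarrow> ('i \<times> 'i) gl_rep" where
  "ext_square R =
     \<lparr>basis = {(i, j). i \<in> basis R \<and> j \<in> basis R \<and> i < j},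
      entry = (\<lambda>g (i, j) p.
                 entry (tensor_rep R R) g (i, j) p - entry (tensor_rep R R) g (j, i) p)\<rparr>"


section \<open>Partitions, tableaux and Schur polynomials\<close>

definition partitions_of :: "nat \<Rightarrow> nat list set" where
  "partitions_of m = {la. sorted_wrt (\<ge>) la \<and> 0 \<notin> set la \<and> sum_list la = m}"

definition conj_part :: "nat list \<Rightarrow> nat \<Rightarrow> nat" where
  "conj_part la i = card {j. j < length la \<and> la ! j \<ge> i}"

definition odd_columns :: "nat list \<Rightarrow> nat" where
  "odd_columns la = card {i. i \<ge> 1 \<and> odd (conj_part la i)}"

text \<open>Rows, columns, letters and variables are all numbered from \<open>0\<close>.\<close>

definition diagram :: "nat list \<Rightarrow> (nat \<times> nat) set" where
  "diagram la = {(r, c). r < length la \<and> c < la ! r}"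

definition ssyt :: "nat \<Rightarrow> nat list \<Rightarrow> (nat \<times> nat \<Rightarrow> nat) set" where
  "ssyt n la = {T \<in> diagram la \<rightarrow>\<^sub>E {..<n}.
     (\<forall>r c c'. c < c' \<and> (r, c) \<in> diagram la \<and> (r, c') \<in> diagram la \<longrightarrow> T (r, c) \<le> T (r, c')) \<and>
     (\<forall>r r' c. r < r' \<and> (r, c) \<in> diagram la \<and> (r', c) \<in> diagram la \<longrightarrow> T (r, c) < T (r', c))}"

definition schur_poly :: "nat \<Rightarrow> nat list \<Rightarrow> (nat \<Rightarrow> complex) \<Rightarrow> complex" where
  "schur_poly n la x = (\<Sum>T\<in>ssyt n la. \<Prod>i<n. x i ^ card {b \<in> diagram la. T b = i})"

text \<open>
  The irreducible polynomial representation with character the Schur polynomial is unique up to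
  isomorphism; a representative on some \<open>\<complex>\<^sup>d\<close> is chosen. Characters are compared on the invertible
  diagonal matrices, where representations are specified; this determines them as polynomials.
\<close>

definition schur_rep :: "nat \<Rightarrow> nat list \<Rightarrow> nat gl_rep" where
  "schur_rep n la =
     (if length la \<le> n then
        (SOME R. polynomial_rep n R \<and> irreducible_rep n R \<and>
           (\<forall>x. (\<forall>i<n. x i \<noteq> 0) \<longrightarrow> rep_character n R x = schur_poly n la x))
      else zero_rep)"

end

theory Submission
  imports
    Defs
    "Jordan_Normal_Form.Char_Poly"
    "HOL-Computational_Algebra.Fundamental_Theorem_Algebra"
begin

text \<open>
  Both sides are compared through their weight multiplicities.

  For the character of the left-hand side, write Schur polynomials as sums over chains of interlacing
  partitions. A local bijection between the common upper and the common lower neighbours of two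
  partitions yields, by induction on the number of variables, the Pieri rule, the Cauchy identity and
  the identity expressing the product of the complete symmetric polynomial of degree \<open>k\<close> and that of
  degree \<open>l\<close> in the products \<open>x\<^sub>i x\<^sub>j\<close> as the sum of the Schur polynomials with \<open>k\<close> odd columns.

  For the representations, let \<open>A\<^sub>N\<close> be the space of polynomial functions on matrices which are
  homogeneous of degree \<open>N\<close> in the columns. Homomorphisms from \<open>A\<^sub>N\<close> to a polynomial representation
  correspond to its vectors of weight \<open>N\<close>, so by Schur's lemma an irreducible \<open>S\<close> occurs in the
  completely reducible \<open>A\<^sub>N\<close> as often as \<open>N\<close> occurs as a weight of \<open>S\<close>. Counting weights of \<open>A\<^sub>N\<close>,
  the matrix of weight multiplicities of the irreducibles has the same Gram matrix as the Kostka
  matrix. As the latter is unitriangular, the two matrices agree up to a permutation of rows: the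
  irreducibles are classified by partitions and have the Schur polynomials as characters.
\<close>

text \<open>Two obstacles keep this from being a mere comparison of characters.
  \<open>schur_rep\<close> is a choice, so existence and uniqueness of an irreducible representation
  whose character is a Schur polynomial have to be proved; and the conclusion asks for an
  isomorphism. Both are settled by the irreducibles found inside the spaces
  \<open>A\<^sub>N\<close>.

  The link to Kostka numbers is a count of nonnegative integer matrices. Those with column sums M
  and row sums N index the monomials of weight N in \<open>A\<^sub>M\<close>, and their number is
  also a coefficient in the Cauchy identity. Decomposing \<open>A\<^sub>M\<close>, where S occurs as
  often as M is a weight of S, writes this number as a sum over S of (multiplicity of M in S) times
  (multiplicity of N in S); the Cauchy identity writes it as the same kind of sum over partitions.
  These are the two Gram matrices.

  For the representation to be decomposed, linear independence of the Kostka rows turns the identity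
  of characters into multiplicities, each of which is 0 or 1.\<close>

section \<open>Monomials and complete symmetric polynomials\<close>

text \<open>
  Exponents and weights are encoded as multisets of variables throughout.
\<close>

definition mon :: "('p \<Rightarrow> complex) \<Rightarrow> 'p multiset \<Rightarrow> complex" where
  "mon y M = prod_mset (image_mset y M)"

lemma mon_simps [simp]: "mon y {#} = 1" "mon y (add_mset p M) = y p * mon y M"
  "mon y (M + N) = mon y M * mon y N" "mon y (replicate_mset j p) = y p ^ j"
  by (auto simp: mon_def)

lemma mon_image: "mon y (image_mset f M) = mon (\<lambda>p. y (f p)) M"
  by (simp add: mon_def multiset.map_comp comp_def)

lemma mon_cong: "(\<And>p. p \<in># M \<Longrightarrow> y p = z p) \<Longrightarrow> mon y M = mon z M"
  unfolding mon_def by (intro arg_cong[of _ _ prod_mset] image_mset_cong) auto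

lemma mon_one [simp]: "mon (\<lambda>p. 1) M = 1"
  by (induction M) auto

lemma mon_mult: "mon (\<lambda>p. y p * z p) M = mon y M * mon z M"
  by (induction M) auto

lemma mon_scale: "mon (\<lambda>p. c * y p) M = c ^ size M * mon y M"
  by (induction M) auto

text \<open>The complete homogeneous symmetric polynomial in the alphabet of the values
  \<open>y p\<close>. Keeping index set and values apart lets it serve for the \<open>x i\<close>,
  the \<open>x i * y a\<close> and the \<open>x i * x j\<close> alike.\<close>

definition complete_sym :: "'p set \<Rightarrow> ('p \<Rightarrow> complex) \<Rightarrow> nat \<Rightarrow> complex" where
  "complete_sym A y k = (\<Sum>M\<in>multisets_of_size A k. mon y M)"

lemma complete_sym_empty: "complete_sym {} y k = (if k = 0 then 1 else 0)"
  by (cases "k = 0") (auto simp: complete_sym_def)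

text \<open>A multiset over a disjoint union splits into its restrictions to the two sides, which
  multiplies generating functions. In the inductions on the number of variables this separates the
  letters that involve the last variable.\<close>

lemma complete_sym_Un:
  assumes "finite A" "finite B" "A \<inter> B = {}"
  shows "complete_sym (A \<union> B) y k = (\<Sum>j\<le>k. complete_sym A y j * complete_sym B y (k - j))"
proof -
  have "(\<Sum>j\<le>k. complete_sym A y j * complete_sym B y (k - j)) =
      (\<Sum>j\<le>k. \<Sum>(M,N)\<in>multisets_of_size A j \<times> multisets_of_size B (k-j). mon y M * mon y N)"
    by (simp add: complete_sym_def sum_product sum.cartesian_product)
  also have "\<dots> = (\<Sum>(j,M,N)\<in>(SIGMA j:{..k}. multisets_of_size A j \<times> multisets_of_size B (k-j)).
                     mon y M * mon y N)"
    using assms by (subst sum.Sigma) auto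
  also have "\<dots> = complete_sym (A \<union> B) y k" unfolding complete_sym_def
  proof (rule sum.reindex_bij_witness[of _
        "\<lambda>M. (size (filter_mset (\<lambda>p. p \<in> A) M), filter_mset (\<lambda>p. p \<in> A) M, filter_mset (\<lambda>p. p \<in> B) M)"
        "\<lambda>(j,M,N). M + N"], goal_cases)
    case (1 a)
    then obtain j M N where a: "a = (j,M,N)" "set_mset M \<subseteq> A" "size M = j" "set_mset N \<subseteq> B"
      by (auto simp: multisets_of_size_def)
    have "filter_mset (\<lambda>p. p \<in> A) M = M" "filter_mset (\<lambda>p. p \<in> B) N = N"
      "filter_mset (\<lambda>p. p \<in> A) N = {#}" "filter_mset (\<lambda>p. p \<in> B) M = {#}"
      using a assms by (auto simp: filter_mset_eq_conv multiset_eq_iff simp flip: not_in_iff)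
    then show ?case using a by simp
  next
    case (2 a)
    then show ?case by (auto simp: multisets_of_size_def)
  next
    case (3 M)
    then show ?case using assms 
      by (auto simp: multisets_of_size_def multiset_eq_iff) (metis UnE not_in_iff subsetD)+
  next
    case (4 M)
    then have "M = filter_mset (\<lambda>p. p \<in> A) M + filter_mset (\<lambda>p. p \<in> B) M" using assms
      by (auto simp: multisets_of_size_def multiset_eq_iff) (metis UnE not_in_iff subsetD)+
    then have "k = size (filter_mset (\<lambda>p. p \<in> A) M) + size (filter_mset (\<lambda>p. p \<in> B) M)"
      using 4 by (metis multisets_of_size_size size_union)
    then show ?case by (auto simp: multisets_of_size_def)
  qed auto
  finally show ?thesis ..
qed

lemma complete_sym_image:
  assumes "inj_on f A"
  shows "complete_sym (f ` A) y k = complete_sym A (\<lambda>p. y (f p)) k"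
  unfolding complete_sym_def
proof (rule sum.reindex_bij_witness[of _ "image_mset f" "image_mset (inv_into A f)"], goal_cases)
  case (1 M)
  then show ?case by (auto simp: multisets_of_size_def multiset.map_comp f_inv_into_f
        intro!: image_mset_cong[of M _ "\<lambda>x. x", simplified])
next
  case (2 M)
  then show ?case by (auto simp: multisets_of_size_def subset_iff intro: inv_into_into)
next
  case (3 M)
  then show ?case using assms by (auto simp: multisets_of_size_def multiset.map_comp 
        intro!: image_mset_cong[of M _ "\<lambda>x. x", simplified] inv_into_f_f)
next
  case (4 M)
  then show ?case by (auto simp: multisets_of_size_def)
next
  case (5 M)
  then show ?case unfolding mon_image by (intro mon_cong)
      (auto simp: multisets_of_size_def f_inv_into_f subset_iff)
qed

lemma complete_sym_scale: "complete_sym A (\<lambda>p. c * y p) k = c ^ k * complete_sym A y k"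
  by (auto simp: complete_sym_def mon_scale sum_distrib_left multisets_of_size_def intro!: sum.cong)

lemma complete_sym_single: "complete_sym {p} y k = y p ^ k"
proof -
  have "multisets_of_size {p} k = {replicate_mset k p}"
    by (auto simp: multisets_of_size_def dest: set_mset_subset_singletonD split: if_splits)
  then show ?thesis by (simp add: complete_sym_def)
qed

lemma complete_sym_Suc:
  "complete_sym {..<Suc n} y k = (\<Sum>j\<le>k. y n ^ j * complete_sym {..<n} y (k - j))"
  using complete_sym_Un[of "{n}" "{..<n}" y k] by (simp add: lessThan_Suc complete_sym_single)

section \<open>Interlacing sequences\<close>

text \<open>For partitions this says that the skew shape f/g is a horizontal strip: it has at most
  one cell in each column.\<close>

definition interlaces :: "(nat \<Rightarrow> nat) \<Rightarrow> (nat \<Rightarrow> nat) \<Rightarrow> bool" (infix "\<prec>\<prec>" 50) where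
  "g \<prec>\<prec> f \<longleftrightarrow> (\<forall>i. g i \<le> f i \<and> f (Suc i) \<le> g i)"

text \<open>
  Partitions with at most \<open>n\<close> parts are encoded as weakly decreasing functions vanishing from \<open>n\<close> on;
  \<open>weight\<close> is their size and \<open>alt_weight\<close> is their number of odd columns.
\<close>

definition parts :: "nat \<Rightarrow> (nat \<Rightarrow> nat) set" where
  "parts n = {f. (\<forall>i. f (Suc i) \<le> f i) \<and> (\<forall>i\<ge>n. f i = 0)}"

definition weight :: "(nat \<Rightarrow> nat) \<Rightarrow> nat" where
  "weight f = (\<Sum>i | f i \<noteq> 0. f i)"

definition alt_weight :: "(nat \<Rightarrow> nat) \<Rightarrow> int" where
  "alt_weight f = (\<Sum>i | f i \<noteq> 0. (-1) ^ i * int (f i))"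

text \<open>The Schur polynomial as a sum over Gelfand-Tsetlin patterns: \<open>g\<close> is the
  shape filled by the letters below \<open>n\<close>, and the strip f/g carries the letter
  \<open>n\<close>. The truncated subtraction is exact, as \<open>weight g \<le> weight f\<close>
  for interlacing partitions.\<close>

fun gt_poly :: "nat \<Rightarrow> (nat \<Rightarrow> nat) \<Rightarrow> (nat \<Rightarrow> complex) \<Rightarrow> complex" where
  "gt_poly 0 f x = (if f = (\<lambda>i. 0) then 1 else 0)"
| "gt_poly (Suc n) f x =
     (\<Sum>g | g \<in> parts n \<and> g \<prec>\<prec> f. x n ^ (weight f - weight g) * gt_poly n g x)"

lemma weight_eq: "(\<And>i. i \<ge> n \<Longrightarrow> f i = 0) \<Longrightarrow> weight f = (\<Sum>i<n. f i)"
  unfolding weight_def by (rule sum.mono_neutral_left) (auto, metis not_le not_less0)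

lemma alt_weight_eq: "(\<And>i. i \<ge> n \<Longrightarrow> f i = 0) \<Longrightarrow> alt_weight f = (\<Sum>i<n. (-1) ^ i * int (f i))"
  unfolding alt_weight_def by (rule sum.mono_neutral_left) (auto, metis not_le not_less0)

lemma parts_0 [simp]: "parts 0 = {\<lambda>i. 0}"
  by (auto simp: parts_def)

lemma weight_zero [simp]: "weight (\<lambda>i. 0) = 0"
  by (simp add: weight_def)

lemma alt_weight_zero [simp]: "alt_weight (\<lambda>i. 0) = 0"
  by (simp add: alt_weight_def)

lemma finite_parts: "finite {f \<in> parts n. weight f \<le> d}"
proof (rule finite_subset)
  show "{f \<in> parts n. weight f \<le> d} \<subseteq>
    {f. \<forall>i. (i \<in> {..<n} \<longrightarrow> f i \<in> {..d}) \<and> (i \<notin> {..<n} \<longrightarrow> f i = 0)}"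
  proof (intro subsetI CollectI allI conjI impI; (elim CollectE conjE)?)
    fix f i assume f: "f \<in> parts n" "weight f \<le> d" and i': "i \<in> {..<n}"
    then have i: "i < n" by simp
    have "f i \<le> (\<Sum>i<n. f i)" using i by (intro member_le_sum) auto
    also have "\<dots> = weight f" using f by (intro weight_eq[symmetric]) (auto simp: parts_def)
    finally show "f i \<in> {..d}" using f by simp
  next
    fix f i assume "f \<in> parts n" "i \<notin> {..<n}"
    then show "f i = 0" by (simp add: parts_def)
  qed
  show "finite {f. \<forall>i. (i \<in> {..<n} \<longrightarrow> f i \<in> {..d}) \<and> (i \<notin> {..<n} \<longrightarrow> f i = 0)}"
    by (rule finite_set_of_finite_funs) auto
qed

lemma parts_mono: "m \<le> n \<Longrightarrow> parts m \<subseteq> parts n"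
  by (auto simp: parts_def)

lemma interlaces_le: "g \<prec>\<prec> f \<Longrightarrow> g i \<le> f i" "g \<prec>\<prec> f \<Longrightarrow> f (Suc i) \<le> g i"
  by (auto simp: interlaces_def)

lemma parts_zero: "f \<in> parts n \<Longrightarrow> n \<le> i \<Longrightarrow> f i = 0"
  by (simp add: parts_def)

lemma interlaces_parts_lower:
  assumes "g \<prec>\<prec> f" "f \<in> parts n" shows "g \<in> parts n"
  unfolding parts_def
proof (intro CollectI conjI allI impI)
  fix i
  show "g (Suc i) \<le> g i"
    using interlaces_le[OF assms(1)] le_trans by blast
  show "g i = 0" if "n \<le> i"
    using interlaces_le(1)[OF assms(1), of i] parts_zero[OF assms(2) that] by simp
qed

lemma interlaces_weight: 
  assumes "g \<prec>\<prec> f" "f \<in> parts n" shows "weight g \<le> weight f"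
  using weight_eq[of n g] weight_eq[of n f] interlaces_parts_lower[OF assms] assms(2)
  by (simp add: parts_zero sum_mono interlaces_le(1)[OF assms(1)])

lemma interlaces_parts_upper:
  assumes "g \<prec>\<prec> f" "g \<in> parts n" shows "f \<in> parts (Suc n)"
  unfolding parts_def
proof (intro CollectI conjI allI impI)
  fix i
  show "f (Suc i) \<le> f i"
    using interlaces_le[OF assms(1)] le_trans by blast
  show "f i = 0" if "Suc n \<le> i"
    using interlaces_le(2)[OF assms(1), of "i - 1"] parts_zero[OF assms(2), of "i - 1"] that by simp
qed

lemma finite_interlaces_lower: "f \<in> parts n \<Longrightarrow> finite {g. g \<prec>\<prec> f}"
  by (rule finite_subset[OF _ finite_parts[of n "weight f"]])
    (auto simp: interlaces_parts_lower interlaces_weight)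

text \<open>Lets a sum over shapes with few rows be extended by zero to all shapes, as the Cauchy
  identity requires when the two numbers of variables differ.\<close>

lemma gt_poly_outside: "f \<notin> parts n \<Longrightarrow> gt_poly n f x = 0"
proof (cases n)
  case (Suc m)
  assume "f \<notin> parts n"
  then have "{g. g \<in> parts m \<and> g \<prec>\<prec> f} = {}" using interlaces_parts_upper Suc by blast
  then show ?thesis using Suc by (simp only: gt_poly.simps sum.empty)
qed auto

text \<open>
  The local growth rule: for fixed \<open>f\<close> and \<open>g\<close>, the entries of a common upper neighbour other than
  the first range over the same intervals as the entries of a common lower neighbour.
\<close>

definition reflect :: "(nat \<Rightarrow> nat) \<Rightarrow> (nat \<Rightarrow> nat) \<Rightarrow> nat \<Rightarrow> (nat \<Rightarrow> nat) \<Rightarrow> nat \<Rightarrow> nat" where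
  "reflect f g t h i = (case i of 0 \<Rightarrow> max (f 0) (g 0) + t
     | Suc j \<Rightarrow> max (f (Suc j)) (g (Suc j)) + min (f j) (g j) - h j)"

text \<open>Each entry is mirrored in the interval from \<open>max (f (Suc j)) (g (Suc j))\<close>
  to \<open>min (f j) (g j)\<close>. The entry \<open>l 0\<close> has no upper bound and is recorded
  apart, as the excess \<open>t\<close> of \<open>reflect\<close>.\<close>

definition unreflect :: "(nat \<Rightarrow> nat) \<Rightarrow> (nat \<Rightarrow> nat) \<Rightarrow> (nat \<Rightarrow> nat) \<Rightarrow> nat \<Rightarrow> nat" where
  "unreflect f g l j = max (f (Suc j)) (g (Suc j)) + min (f j) (g j) - l (Suc j)"

lemma common_lower_bounds:
  assumes "h \<prec>\<prec> f" "h \<prec>\<prec> g"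
  shows "h j \<le> min (f j) (g j)" "max (f (Suc j)) (g (Suc j)) \<le> h j"
  using assms by (auto simp: interlaces_def)

lemma common_upper_bounds:
  assumes "f \<prec>\<prec> l" "g \<prec>\<prec> l"
  shows "l (Suc j) \<le> min (f j) (g j)" "max (f j) (g j) \<le> l j"
  using assms by (auto simp: interlaces_def)

lemma reflect_interlaces:
  assumes "h \<prec>\<prec> f" "h \<prec>\<prec> g"
  shows "f \<prec>\<prec> reflect f g t h" "g \<prec>\<prec> reflect f g t h"
proof -
  note b = common_lower_bounds[OF assms]
  have "max (f i) (g i) \<le> reflect f g t h i \<and> reflect f g t h (Suc i) \<le> min (f i) (g i)" for i
  proof (cases i)
    case 0
    then show ?thesis using b[of 0] by (simp add: reflect_def) linarith?
  next
    case (Suc j)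
    then show ?thesis using b[of j] b[of "Suc j"] by (simp add: reflect_def) linarith?
  qed
  then show "f \<prec>\<prec> reflect f g t h" "g \<prec>\<prec> reflect f g t h"
    unfolding interlaces_def by auto
qed

lemma unreflect_interlaces:
  assumes "f \<prec>\<prec> l" "g \<prec>\<prec> l"
  shows "unreflect f g l \<prec>\<prec> f" "unreflect f g l \<prec>\<prec> g"
proof -
  note b = common_upper_bounds[OF assms]
  have "max (f (Suc i)) (g (Suc i)) \<le> unreflect f g l i \<and> unreflect f g l i \<le> min (f i) (g i)" for i
    using b(1)[of i] b(2)[of "Suc i"] unfolding unreflect_def by linarith
  then show "unreflect f g l \<prec>\<prec> f" "unreflect f g l \<prec>\<prec> g"
    unfolding interlaces_def by auto
qed

lemma unreflect_reflect:
  assumes "h \<prec>\<prec> f" "h \<prec>\<prec> g"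
  shows "unreflect f g (reflect f g t h) = h"
proof
  fix j
  show "unreflect f g (reflect f g t h) j = h j"
    using common_lower_bounds[OF assms, of j] by (simp add: reflect_def unreflect_def) linarith?
qed

lemma reflect_unreflect:
  assumes "f \<prec>\<prec> l" "g \<prec>\<prec> l"
  shows "reflect f g (l 0 - max (f 0) (g 0)) (unreflect f g l) = l"
proof
  fix i
  show "reflect f g (l 0 - max (f 0) (g 0)) (unreflect f g l) i = l i"
  proof (cases i)
    case 0
    then show ?thesis using common_upper_bounds[OF assms, of 0] by (simp add: reflect_def)
  next
    case (Suc j)
    then show ?thesis using common_upper_bounds[OF assms, of j] common_upper_bounds[OF assms, of i]
      by (simp add: reflect_def unreflect_def) linarith?
  qed
qed

text \<open>A mirrored pair adds up to the maximum at \<open>Suc j\<close> plus the minimum at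
  \<open>j\<close>. Summed over \<open>j\<close>, together with the first entry, these regroup into
  maximum plus minimum at each index, which is \<open>f i + g i\<close>.\<close>

lemma weight_reflect:
  assumes "h \<prec>\<prec> f" "h \<prec>\<prec> g" "f \<in> parts n" "g \<in> parts n"
  shows "weight (reflect f g t h) + weight h = weight f + weight g + t"
proof -
  let ?l = "reflect f g t h"
  have l: "?l \<in> parts (Suc n)" using assms reflect_interlaces interlaces_parts_upper by blast
  have h: "h \<in> parts n" using assms interlaces_parts_lower by blast
  \<comment> \<open>Makes the truncated subtraction in \<open>reflect\<close> a true one.\<close>
  have le: "h j \<le> max (f (Suc j)) (g (Suc j)) + min (f j) (g j)" for j
    using common_lower_bounds[OF assms(1,2), of j] by linarith
  have "weight ?l + weight h = (\<Sum>i<Suc n. ?l i) + (\<Sum>i<n. h i)"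
    using l h by (subst (1 2) weight_eq) (auto simp: parts_def)
  also have "\<dots> = max (f 0) (g 0) + t + (\<Sum>i<n. max (f (Suc i)) (g (Suc i)) + min (f i) (g i))"
    using le unfolding sum.lessThan_Suc_shift
    by (auto simp: reflect_def sum.distrib[symmetric] ac_simps intro!: sum.cong)
  also have "\<dots> = (\<Sum>i<Suc n. max (f i) (g i)) + (\<Sum>i<n. min (f i) (g i)) + t"
    unfolding sum.lessThan_Suc_shift by (simp add: sum.distrib)
  also have "\<dots> = (\<Sum>i<n. max (f i) (g i) + min (f i) (g i)) + t"
    using assms by (auto simp: sum.distrib parts_def)
  also have "(\<Sum>i<n. max (f i) (g i) + min (f i) (g i)) = (\<Sum>i<n. f i + g i)"
    by (intro sum.cong) auto
  also have "\<dots> = weight f + weight g"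
    using assms by (subst (1 2) weight_eq) (auto simp: parts_def sum.distrib)
  finally show ?thesis .
qed

text \<open>For \<open>g = f\<close> the mirrored entry is \<open>f (Suc j) + f j - h j\<close>.
  Under alternating signs the terms in \<open>f\<close> telescope, and the index shift turns the
  sign of \<open>h j\<close> back to the one it has in \<open>alt_weight h\<close>.\<close>

lemma alt_weight_reflect:
  assumes "h \<prec>\<prec> f" "f \<in> parts n"
  shows "alt_weight (reflect f f t h) = int t + alt_weight h"
proof -
  let ?l = "reflect f f t h"
  have l: "?l \<in> parts (Suc n)" using assms reflect_interlaces interlaces_parts_upper by blast
  have h: "h \<in> parts n" using assms interlaces_parts_lower by blast
  have le: "h j \<le> f (Suc j) + f j" for j
    using assms unfolding interlaces_def by (auto simp: trans_le_add2)
  have "alt_weight ?l = (\<Sum>i<Suc n. (-1) ^ i * int (?l i))"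
    using l by (intro alt_weight_eq) (auto simp: parts_def)
  also have "\<dots> = int (f 0) + int t - (\<Sum>i<n. (-1)^i * (int (f (Suc i)) + int (f i) - int (h i)))"
    using le unfolding sum.lessThan_Suc_shift
    by (auto simp: reflect_def sum_negf[symmetric] of_nat_diff intro!: sum.cong)
  also have "\<dots> = int (f 0) + int t + (\<Sum>i<n. (-1)^Suc i * int (f (Suc i)) - (-1)^i * int (f i))
      + (\<Sum>i<n. (-1)^i * int (h i))"
    by (simp add: sum.distrib[symmetric] sum_negf[symmetric] sum_subtractf[symmetric] algebra_simps)
  also have "(\<Sum>i<n. (-1)^Suc i * int (f (Suc i)) - (-1)^i * int (f i)) = (-1)^n * int (f n) - int (f 0)"
    by (subst sum_lessThan_telescope) auto
  also have "f n = 0" using assms by (auto simp: parts_def)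
  also have "(\<Sum>i<n. (-1)^i * int (h i)) = alt_weight h"
    using h by (intro alt_weight_eq[symmetric]) (auto simp: parts_def)
  finally show ?thesis by simp
qed

section \<open>The Pieri, Cauchy and Littlewood identities\<close>

text \<open>Branching on the last variable turns the right-hand side into a sum over common upper
  neighbours \<open>l\<close> of \<open>f\<close> and \<open>g\<close>. The local rule trades
  \<open>l\<close> for a common lower neighbour \<open>h\<close> and an excess \<open>t\<close>; the
  sum over \<open>g\<close> above \<open>h\<close> is then the identity for one variable less, and
  \<open>t\<close> is the exponent of \<open>x n\<close> taken from the complete symmetric
  polynomial.\<close>

lemma gt_poly_pieri:
  assumes "f \<in> parts n"
  shows "complete_sym {..<n} x c * gt_poly n f x =
    (\<Sum>l | l \<in> parts n \<and> f \<prec>\<prec> l \<and> weight l = weight f + c. gt_poly n l x)"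
  using assms
proof (induction n arbitrary: f c)
  case 0
  then have "{l. l \<in> parts 0 \<and> f \<prec>\<prec> l \<and> weight l = weight f + c} = (if c = 0 then {\<lambda>i. 0} else {})"
    by (auto simp: interlaces_def)
  then show ?case using 0 by (simp add: complete_sym_empty)
next
  case (Suc n)
  define L where "L = {l. l \<in> parts (Suc n) \<and> f \<prec>\<prec> l \<and> weight l = weight f + c}"
  define H where "H = {h. h \<in> parts n \<and> h \<prec>\<prec> f}"
  define G where "G = (\<lambda>h e. {g. g \<in> parts n \<and> h \<prec>\<prec> g \<and> weight g = weight h + e})"
  have finL: "finite L" unfolding L_def
    by (rule finite_subset[OF _ finite_parts[of "Suc n" "weight f + c"]]) auto
  have finH: "finite H" unfolding H_def
    using finite_interlaces_lower[OF Suc.prems] by (rule finite_subset[rotated]) auto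
  have finG: "finite (G h e)" for h e unfolding G_def
    by (rule finite_subset[OF _ finite_parts[of n "weight h + e"]]) auto
  have finLg: "finite {g. g \<in> parts n \<and> g \<prec>\<prec> l}" if "l \<in> L" for l
    using finite_interlaces_lower[of l "Suc n"] that by (auto simp: L_def)
  have "(\<Sum>l\<in>L. gt_poly (Suc n) l x) =
    (\<Sum>(l,g)\<in>(SIGMA l:L. {g. g \<in> parts n \<and> g \<prec>\<prec> l}). x n ^ (weight l - weight g) * gt_poly n g x)"
    using finL finLg by (subst sum.Sigma[symmetric]) auto
  also have "\<dots> = (\<Sum>(t,h,g)\<in>(SIGMA t:{..c}. SIGMA h:H. G h (c - t)).
      x n ^ t * (x n ^ (weight f - weight h) * gt_poly n g x))"
  proof (rule sum.reindex_bij_witness[of _ "\<lambda>(t,h,g). (reflect f g t h, g)"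
        "\<lambda>(l,g). (l 0 - max (f 0) (g 0), unreflect f g l, g)"], goal_cases)
    case (1 a)
    then show ?case by (auto simp: L_def reflect_unreflect)
  next
    case (2 a)
    then obtain l g where a: "a = (l, g)" "l \<in> parts (Suc n)" "f \<prec>\<prec> l" "weight l = weight f + c"
      "g \<in> parts n" "g \<prec>\<prec> l" by (auto simp: L_def)
    let ?h = "unreflect f g l" let ?t = "l 0 - max (f 0) (g 0)"
    have h: "?h \<prec>\<prec> f" "?h \<prec>\<prec> g" using unreflect_interlaces a by auto
    have hn: "?h \<in> parts n" using interlaces_parts_lower h a by blast
    have "weight l + weight ?h = weight f + weight g + ?t"
      using weight_reflect[OF h Suc.prems, of ?t] a parts_mono[of n "Suc n"]
      by (auto simp: reflect_unreflect)
    moreover have "weight ?h \<le> weight g" using interlaces_weight h a by blast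
    ultimately show ?case using a h hn by (auto simp: H_def G_def)
  next
    case (3 a)
    then show ?case by (auto simp: H_def G_def unreflect_reflect) (auto simp: reflect_def)
  next
    case (4 a)
    then obtain t h g where a: "a = (t, h, g)" "t \<le> c" "h \<in> parts n" "h \<prec>\<prec> f" "g \<in> parts n" 
      "h \<prec>\<prec> g" "weight g = weight h + (c - t)" by (auto simp: H_def G_def)
    let ?l = "reflect f g t h"
    have l: "f \<prec>\<prec> ?l" "g \<prec>\<prec> ?l" using reflect_interlaces a by auto
    moreover have "?l \<in> parts (Suc n)" using l a interlaces_parts_upper by blast
    moreover have "weight ?l + weight h = weight f + weight g + t"
      using weight_reflect[of h f g "Suc n" t] a Suc.prems parts_mono[of n "Suc n"] by auto
    ultimately show ?case using a by (auto simp: L_def)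
  next
    case (5 a)
    then obtain l g where a: "a = (l, g)" "l \<in> parts (Suc n)" "f \<prec>\<prec> l" "weight l = weight f + c"
      "g \<in> parts n" "g \<prec>\<prec> l" by (auto simp: L_def)
    let ?h = "unreflect f g l" let ?t = "l 0 - max (f 0) (g 0)"
    have h: "?h \<prec>\<prec> f" "?h \<prec>\<prec> g" using unreflect_interlaces a by auto
    have "weight l + weight ?h = weight f + weight g + ?t"
      using weight_reflect[OF h Suc.prems, of ?t] a parts_mono[of n "Suc n"]
      by (auto simp: reflect_unreflect)
    moreover have "weight ?h \<le> weight f" using interlaces_weight h Suc.prems by blast
    moreover have "weight g \<le> weight l" using interlaces_weight a by blast
    \<comment> \<open>The power of \<open>x n\<close> on the strip l/g splits into the part
      \<open>t\<close> and the power on the strip f/h, which belongs to the branching of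
      \<open>f\<close>.\<close>
    ultimately have "weight l - weight g = ?t + (weight f - weight ?h)" by linarith
    then show ?case using a by (simp add: power_add)
  qed
  also have "\<dots> = (\<Sum>t\<le>c. \<Sum>h\<in>H. x n ^ t * (x n ^ (weight f - weight h) * (\<Sum>g\<in>G h (c-t). gt_poly n g x)))"
    using finH finG by (simp add: sum.Sigma[symmetric] sum_distrib_left)
  also have "\<dots> = (\<Sum>t\<le>c. \<Sum>h\<in>H. x n ^ t * (x n ^ (weight f - weight h) *
      (complete_sym {..<n} x (c-t) * gt_poly n h x)))"
    unfolding G_def by (intro sum.cong refl) (subst Suc.IH, auto simp: H_def)
  also have "\<dots> = complete_sym {..<Suc n} x c * gt_poly (Suc n) f x"
    unfolding complete_sym_Suc gt_poly.simps sum_product H_def by (simp add: ac_simps)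
  finally show ?case by (simp add: L_def)
qed

text \<open>Induction on the \<open>y\<close> variables: branching on \<open>y m\<close> leaves a
  sum over the upper neighbours \<open>l\<close> of \<open>g\<close>, which the Pieri rule
  evaluates. The factor produced accounts for the pairs \<open>(i, m)\<close>.\<close>

lemma gt_poly_cauchy:
  "(\<Sum>l | l \<in> parts n \<and> weight l = d. gt_poly m l y * gt_poly n l x) =
    complete_sym ({..<n} \<times> {..<m}) (\<lambda>(i,a). x i * y a) d"
proof (induction m arbitrary: d)
  case 0
  have "(\<Sum>l | l \<in> parts n \<and> weight l = d. gt_poly 0 l y * gt_poly n l x) =
    (\<Sum>l | l \<in> parts n \<and> weight l = d. if l = (\<lambda>i. 0) then gt_poly n (\<lambda>i. 0) x else 0)"
    by (intro sum.cong) auto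
  also have "\<dots> = (if d = 0 then gt_poly n (\<lambda>i. 0) x else 0)"
    by (subst sum.delta) (auto simp: parts_def intro!: finite_subset[OF _ finite_parts[of n d]])
  also have "gt_poly n (\<lambda>i. 0) x = 1"
  proof (induction n)
    case (Suc n)
    have "{g. g \<in> parts n \<and> g \<prec>\<prec> (\<lambda>i. 0)} = {\<lambda>i. 0}"
      by (auto simp: parts_def interlaces_def)
    then show ?case using Suc by simp
  qed simp
  finally show ?case by (simp add: complete_sym_empty)
next
  case (Suc m)
  define L where "L = {l. l \<in> parts n \<and> weight l = d}"
  define B where "B = (\<lambda>l. {g. g \<in> parts m \<and> g \<prec>\<prec> l})"
  define G where "G = (\<lambda>j. {g. g \<in> parts n \<and> weight g = d - j})"
  define G' where "G' = (\<lambda>j. {g \<in> G j. g \<in> parts m})"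
  define U where "U = (\<lambda>g j. {l. l \<in> parts n \<and> g \<prec>\<prec> l \<and> weight l = weight g + j})"
  have finL: "finite L" unfolding L_def
    by (rule finite_subset[OF _ finite_parts[of n d]]) auto
  have finG: "finite (G j)" for j unfolding G_def
    by (rule finite_subset[OF _ finite_parts[of n "d - j"]]) auto
  then have finG': "finite (G' j)" for j by (simp add: G'_def)
  have finU: "finite (U g j)" for g j unfolding U_def
    by (rule finite_subset[OF _ finite_parts[of n "weight g + j"]]) auto
  have finB: "finite (B l)" if "l \<in> L" for l
    using finite_interlaces_lower[of l n] that by (auto simp: L_def B_def)
  have "(\<Sum>l\<in>L. gt_poly (Suc m) l y * gt_poly n l x) =
     (\<Sum>(l,g)\<in>(SIGMA l:L. B l). y m ^ (weight l - weight g) * gt_poly m g y * gt_poly n l x)"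
    using finL finB by (subst sum.Sigma[symmetric]) (auto simp: B_def sum_distrib_right)
  also have "\<dots> = (\<Sum>(j,g,l)\<in>(SIGMA j:{..d}. SIGMA g:G' j. U g j).
      y m ^ j * (gt_poly m g y * gt_poly n l x))"
  proof (rule sum.reindex_bij_witness[of _ "\<lambda>(j,g,l). (l, g)" "\<lambda>(l,g). (d - weight g, g, l)"], goal_cases)
    case (2 a)
    then obtain l g where a: "a = (l, g)" "l \<in> parts n" "weight l = d" "g \<in> parts m" "g \<prec>\<prec> l"
      by (auto simp: L_def B_def)
    moreover have "weight g \<le> weight l" "g \<in> parts n"
      using a interlaces_weight interlaces_parts_lower by blast+
    ultimately show ?case by (auto simp: G'_def G_def U_def)
  qed (auto simp: L_def B_def G'_def G_def U_def)
  also have "\<dots> = (\<Sum>j\<le>d. y m ^ j * (\<Sum>g\<in>G' j. gt_poly m g y * (\<Sum>l\<in>U g j. gt_poly n l x)))"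
    using finG' finU by (simp add: sum.Sigma[symmetric] sum_distrib_left)
  also have "\<dots> = (\<Sum>j\<le>d. y m ^ j * (\<Sum>g\<in>G' j. gt_poly m g y * (complete_sym {..<n} x j * gt_poly n g x)))"
    by (intro sum.cong refl arg_cong2[of _ _ _ _ "(*)"]) (auto simp: gt_poly_pieri U_def G'_def G_def)
  \<comment> \<open>Branching only yields shapes with at most \<open>m\<close> rows; for the others
    \<open>gt_poly m g y\<close> vanishes, and the full range is the one in the induction
    hypothesis.\<close>
  also have "\<dots> = (\<Sum>j\<le>d. y m ^ j * (\<Sum>g\<in>G j. gt_poly m g y * (complete_sym {..<n} x j * gt_poly n g x)))"
    using finG by (intro sum.cong refl arg_cong2[of _ _ _ _ "(*)"] sum.mono_neutral_left)
      (auto simp: G'_def gt_poly_outside)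
  also have "\<dots> = (\<Sum>j\<le>d. (y m ^ j * complete_sym {..<n} x j) * (\<Sum>g\<in>G j. gt_poly m g y * gt_poly n g x))"
    by (simp add: sum_distrib_left ac_simps)
  \<comment> \<open>By homogeneity, the power of \<open>y m\<close> turns the complete symmetric
    polynomial in the \<open>x i\<close> into the one in the products
    \<open>x i * y m\<close>.\<close>
  also have "\<dots> = (\<Sum>j\<le>d. complete_sym ((\<lambda>i. (i,m)) ` {..<n}) (\<lambda>(i,a). x i * y a) j *
      complete_sym ({..<n} \<times> {..<m}) (\<lambda>(i,a). x i * y a) (d - j))"
    unfolding Suc.IH[symmetric] G_def
    by (intro sum.cong refl arg_cong2[of _ _ _ _ "(*)"], subst complete_sym_image)
      (auto simp: inj_on_def complete_sym_scale[symmetric] mult.commute)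
  also have "\<dots> = complete_sym ((\<lambda>i. (i,m)) ` {..<n} \<union> {..<n} \<times> {..<m}) (\<lambda>(i,a). x i * y a) d"
    by (subst complete_sym_Un) auto
  also have "(\<lambda>i. (i,m)) ` {..<n} \<union> {..<n} \<times> {..<m} = {..<n} \<times> {..<Suc m}"
    by (auto simp: less_Suc_eq)
  finally show ?case by (simp add: L_def)
qed

text \<open>The sum is \<open>f 0\<close> minus the alternating sum of the shifted sequence, which
  by induction lies between 0 and \<open>f 1\<close>.\<close>

lemma alternating_sum_bounds:
  assumes "\<And>i. f (Suc i) \<le> f i"
  shows "0 \<le> (\<Sum>i<n. (-1) ^ i * int (f i)) \<and> (\<Sum>i<n. (-1) ^ i * int (f i)) \<le> int (f 0)"
  using assms
proof (induction n arbitrary: f)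
  case (Suc n)
  have "0 \<le> (\<Sum>i<n. (-1) ^ i * int (f (Suc i))) \<and> (\<Sum>i<n. (-1) ^ i * int (f (Suc i))) \<le> int (f (Suc 0))"
    by (rule Suc.IH[of "\<lambda>i. f (Suc i)"]) (use Suc.prems in auto)
  moreover have "int (f (Suc 0)) \<le> int (f 0)" using Suc.prems by simp
  ultimately show ?case
    by (simp add: sum.lessThan_Suc_shift sum_negf del: sum.lessThan_Suc)
qed simp

lemma alt_weight_bounds:
  assumes "f \<in> parts n" shows "0 \<le> alt_weight f" "alt_weight f \<le> int (weight f)"
proof -
  have eq: "alt_weight f = (\<Sum>i<n. (-1) ^ i * int (f i))"
    using assms by (intro alt_weight_eq) (auto simp: parts_def)
  show "0 \<le> alt_weight f" unfolding eq
    using alternating_sum_bounds[of f] assms by (auto simp: parts_def)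
  have "(\<Sum>i<n. (-1) ^ i * int (f i)) \<le> (\<Sum>i<n. int (f i))"
    by (intro sum_mono) (simp add: minus_one_power_iff)
  also have "\<dots> = int (weight f)"
    using assms by (subst weight_eq[of n]) (auto simp: parts_def)
  finally show "alt_weight f \<le> int (weight f)" using eq by simp
qed

text \<open>The local rule is applied with both neighbours equal to \<open>g\<close>, the shape left
  after branching \<open>f\<close> on the last variable. It trades \<open>f\<close> for some
  \<open>h\<close> below \<open>g\<close> and an excess \<open>t\<close>. With
  \<open>j = weight g - weight h\<close>, weight and alternating weight of \<open>h\<close>
  correspond to \<open>k - t\<close> and \<open>l - j\<close>, and the exponent of
  \<open>x n\<close> is \<open>t + j\<close>. The Pieri rule sums over \<open>g\<close>; the power
  of \<open>x n\<close> belonging to \<open>j\<close> completes its factor to the pairs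
  \<open>(i, n)\<close>.\<close>

lemma gt_poly_littlewood:
  "(\<Sum>f | f \<in> parts n \<and> weight f = k + 2 * l \<and> alt_weight f = int k. gt_poly n f x) =
    complete_sym {..<n} x k * complete_sym {(i,j). i < j \<and> j < n} (\<lambda>(i,j). x i * x j) l"
proof (induction n arbitrary: k l)
  case 0
  have "{f. f \<in> parts 0 \<and> weight f = k + 2 * l \<and> alt_weight f = int k} =
    (if k = 0 \<and> l = 0 then {\<lambda>i. 0} else {})"
    by auto
  then show ?case by (simp add: complete_sym_empty)
next
  case (Suc n)
  define E where "E = (\<lambda>n. complete_sym {(i,j). i < j \<and> j < n} (\<lambda>(i,j). x i * x j))"
  define L where "L = {f. f \<in> parts (Suc n) \<and> weight f = k + 2 * l \<and> alt_weight f = int k}"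
  define B where "B = (\<lambda>f. {g. g \<in> parts n \<and> g \<prec>\<prec> f})"
  define H where "H = (\<lambda>t j. {h. h \<in> parts n \<and> weight h = (k - t) + 2 * (l - j) \<and> alt_weight h = int (k - t)})"
  define U where "U = (\<lambda>h j. {g. g \<in> parts n \<and> h \<prec>\<prec> g \<and> weight g = weight h + j})"
  have finL: "finite L" unfolding L_def
    by (rule finite_subset[OF _ finite_parts[of "Suc n" "k + 2 * l"]]) auto
  have finH: "finite (H t j)" for t j unfolding H_def
    by (rule finite_subset[OF _ finite_parts[of n "(k - t) + 2 * (l - j)"]]) auto
  have finU: "finite (U h j)" for h j unfolding U_def
    by (rule finite_subset[OF _ finite_parts[of n "weight h + j"]]) auto
  have finB: "finite (B f)" if "f \<in> L" for f
    using finite_interlaces_lower[of f "Suc n"] that by (auto simp: L_def B_def)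
  have facts: "unreflect g g f \<prec>\<prec> g" "unreflect g g f \<in> parts n"
    "weight f + weight (unreflect g g f) = 2 * weight g + (f 0 - g 0)"
    "alt_weight f = int (f 0 - g 0) + alt_weight (unreflect g g f)"
    "weight (unreflect g g f) \<le> weight g"
    if "f \<in> parts (Suc n)" "g \<in> parts n" "g \<prec>\<prec> f" for f g
  proof -
    show h: "unreflect g g f \<prec>\<prec> g" using unreflect_interlaces that by auto
    then show "unreflect g g f \<in> parts n" using that interlaces_parts_lower by blast
    show "weight f + weight (unreflect g g f) = 2 * weight g + (f 0 - g 0)"
      using weight_reflect[OF h h that(2,2), of "f 0 - g 0"] reflect_unreflect[OF that(3,3)] by simp
    show "alt_weight f = int (f 0 - g 0) + alt_weight (unreflect g g f)"
      using alt_weight_reflect[OF h that(2), of "f 0 - g 0"] reflect_unreflect[OF that(3,3)] by simp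
    show "weight (unreflect g g f) \<le> weight g" using h that interlaces_weight by blast
  qed
  have "(\<Sum>f\<in>L. gt_poly (Suc n) f x) =
     (\<Sum>(f,g)\<in>(SIGMA f:L. B f). x n ^ (weight f - weight g) * gt_poly n g x)"
    using finL finB by (subst sum.Sigma[symmetric]) (auto simp: B_def)
  also have "\<dots> = (\<Sum>(t,j,h,g)\<in>(SIGMA t:{..k}. SIGMA j:{..l}. SIGMA h:H t j. U h j).
      x n ^ t * (x n ^ j * gt_poly n g x))"
  proof (rule sum.reindex_bij_witness[of _ "\<lambda>(t,j,h,g). (reflect g g t h, g)"
        "\<lambda>(f,g). (f 0 - g 0, weight g - weight (unreflect g g f), unreflect g g f, g)"], goal_cases)
    case (1 a)
    then show ?case by (auto simp: B_def) (metis max.idem reflect_unreflect)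
  next
    case (2 a)
    then obtain f g where a: "a = (f, g)" "f \<in> parts (Suc n)" "weight f = k + 2 * l" "alt_weight f = int k"
      "g \<in> parts n" "g \<prec>\<prec> f" by (auto simp: L_def B_def)
    note fa = facts[OF a(2,5,6)]
    note bd = alt_weight_bounds[OF fa(2)]
    \<comment> \<open>Nonnegativity of the alternating weight of the reflected shape bounds
      \<open>t\<close>.\<close>
    have t: "f 0 - g 0 \<le> k" using bd(1) fa(4) a(4) by linarith
    \<comment> \<open>The reflected shape has weight \<open>(k - t) + 2 * (l - j)\<close> over the
      integers; that its alternating weight \<open>k - t\<close> is at most its weight bounds
      \<open>j\<close>.\<close>
    have j: "weight g - weight (unreflect g g f) \<le> l"
      using fa(3,4,5) bd(2) a(3,4) by linarith
    show ?case using a fa t j by (auto simp: H_def U_def)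
  next
    case (3 a)
    then show ?case by (auto simp: H_def U_def unreflect_reflect) (auto simp: reflect_def)
  next
    case (4 a)
    then obtain t j h g where a: "a = (t, j, h, g)" "t \<le> k" "j \<le> l" "h \<in> parts n" 
      "weight h = (k - t) + 2 * (l - j)" "alt_weight h = int (k - t)"
      "g \<in> parts n" "h \<prec>\<prec> g" "weight g = weight h + j" by (auto simp: H_def U_def)
    have g: "g \<prec>\<prec> reflect g g t h" using reflect_interlaces a by auto
    then have "reflect g g t h \<in> parts (Suc n)" using a interlaces_parts_upper by blast
    moreover have "weight (reflect g g t h) + weight h = weight g + weight g + t"
      using weight_reflect[of h g g n t] a by auto
    moreover have "alt_weight (reflect g g t h) = int t + alt_weight h"
      using alt_weight_reflect[of h g n t] a by auto
    ultimately show ?case using a g by (auto simp: L_def B_def)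
  next
    case (5 a)
    then obtain f g where a: "a = (f, g)" "f \<in> parts (Suc n)" "g \<in> parts n" "g \<prec>\<prec> f"
      by (auto simp: L_def B_def)
    note fa = facts[OF a(2,3,4)]
    have "weight g \<le> weight f" using a interlaces_weight by blast
    then have "weight f - weight g = (f 0 - g 0) + (weight g - weight (unreflect g g f))"
      using fa(3,5) by linarith
    then show ?case using a by (simp add: power_add)
  qed
  also have "\<dots> = (\<Sum>t\<le>k. \<Sum>j\<le>l. x n ^ t * (x n ^ j * (\<Sum>h\<in>H t j. \<Sum>g\<in>U h j. gt_poly n g x)))"
    using finH finU by (simp add: sum.Sigma[symmetric] sum_distrib_left)
  also have "\<dots> = (\<Sum>t\<le>k. \<Sum>j\<le>l. x n ^ t * (x n ^ j * (\<Sum>h\<in>H t j. complete_sym {..<n} x j * gt_poly n h x)))"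
    by (intro sum.cong refl arg_cong2[of _ _ _ _ "(*)"]) (auto simp: gt_poly_pieri U_def H_def)
  also have "\<dots> = (\<Sum>t\<le>k. \<Sum>j\<le>l. x n ^ t * (x n ^ j * (complete_sym {..<n} x j * 
      (complete_sym {..<n} x (k - t) * E n (l - j)))))"
    unfolding E_def Suc.IH[symmetric] H_def by (simp add: sum_distrib_left)
  also have "\<dots> = complete_sym {..<Suc n} x k * (\<Sum>j\<le>l. (x n ^ j * complete_sym {..<n} x j) * E n (l - j))"
    unfolding complete_sym_Suc sum_product by (simp add: ac_simps)
  also have "(\<Sum>j\<le>l. (x n ^ j * complete_sym {..<n} x j) * E n (l - j)) =
    (\<Sum>j\<le>l. complete_sym ((\<lambda>i. (i,n)) ` {..<n}) (\<lambda>(i,j). x i * x j) j * E n (l - j))"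
    by (intro sum.cong refl arg_cong2[of _ _ _ _ "(*)"], subst complete_sym_image)
      (auto simp: inj_on_def complete_sym_scale[symmetric] mult.commute)
  also have "\<dots> = complete_sym ((\<lambda>i. (i,n)) ` {..<n} \<union> {(i,j). i < j \<and> j < n}) (\<lambda>(i,j). x i * x j) l"
    unfolding E_def
    by (subst complete_sym_Un) (auto intro!: finite_subset[of "{(i,j). i < j \<and> j < n}" "{..<n} \<times> {..<n}"])
  also have "(\<lambda>i. (i,n)) ` {..<n} \<union> {(i,j). i < j \<and> j < n} = {(i,j). i < j \<and> j < Suc n}"
    by (auto simp: less_Suc_eq)
  finally show ?case by (simp add: L_def)
qed

section \<open>Semistandard tableaux\<close>

definition cells :: "(nat \<Rightarrow> nat) \<Rightarrow> (nat \<times> nat) set" where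
  "cells f = {(r, c). c < f r}"

definition tableaux :: "nat \<Rightarrow> (nat \<Rightarrow> nat) \<Rightarrow> (nat \<times> nat \<Rightarrow> nat) set" where
  "tableaux n f = {T \<in> cells f \<rightarrow>\<^sub>E {..<n}.
     (\<forall>r c c'. c < c' \<and> (r, c) \<in> cells f \<and> (r, c') \<in> cells f \<longrightarrow> T (r, c) \<le> T (r, c')) \<and>
     (\<forall>r r' c. r < r' \<and> (r, c) \<in> cells f \<and> (r', c) \<in> cells f \<longrightarrow> T (r, c) < T (r', c))}"

lemma parts_antimono: "f \<in> parts n \<Longrightarrow> i \<le> j \<Longrightarrow> f j \<le> f i"
  by (rule lift_Suc_antimono_le[of f]) (auto simp: parts_def)

lemma cells_mono: "(\<And>i. g i \<le> f i) \<Longrightarrow> cells g \<subseteq> cells f"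
  by (auto simp: cells_def intro: less_le_trans)

lemma cells_eq_Sigma: "f \<in> parts n \<Longrightarrow> cells f = (SIGMA r:{..<n}. {..<f r})"
  by (auto simp: cells_def) (metis less_zeroE not_le parts_zero)

lemma finite_cells: "f \<in> parts n \<Longrightarrow> finite (cells f)"
  by (simp add: cells_eq_Sigma)

lemma card_cells: "f \<in> parts n \<Longrightarrow> card (cells f) = weight f"
  by (simp add: cells_eq_Sigma weight_eq[of n] parts_zero)

text \<open>A cell in row \<open>r\<close> has \<open>r\<close> cells above it with strictly
  increasing letters. With letters below \<open>n\<close>, this leaves no cell in row
  \<open>n\<close>.\<close>

lemma tableaux_ge_row:
  assumes "T \<in> tableaux n f" "f \<in> parts m" "(r, c) \<in> cells f"
  shows "r \<le> T (r, c)"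
  using assms(3)
proof (induction r)
  case (Suc r)
  have c: "(r, c) \<in> cells f" using Suc.prems parts_antimono[OF assms(2), of r "Suc r"] by (auto simp: cells_def)
  have "T (r, c) < T (Suc r, c)" using assms(1) c Suc.prems unfolding tableaux_def by blast
  then show ?case using Suc.IH[OF c] by simp
qed simp

lemma down_closed_eq_lessThan:
  assumes "\<And>a b. a < b \<Longrightarrow> b \<in> S \<Longrightarrow> a \<in> S" "finite S"
  shows "S = {..<card S}"
proof -
  have "\<exists>k. S = {..<k}"
  proof (cases "S = {}")
    case False
    then have "Max S \<in> S" using assms(2) by simp
    then have "S = {..<Suc (Max S)}"
      using assms(1)[of _ "Max S"] Max_ge[OF assms(2)] by (auto simp: less_Suc_eq_le le_less)
    then show ?thesis by blast
  qed (auto intro: exI[of _ 0])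
  then show ?thesis by auto
qed

definition subshape :: "nat \<Rightarrow> (nat \<Rightarrow> nat) \<Rightarrow> (nat \<times> nat \<Rightarrow> nat) \<Rightarrow> nat \<Rightarrow> nat" where
  "subshape n f T r = card {c. c < f r \<and> T (r, c) < n}"

text \<open>Rows increase weakly, so the cells with letters below \<open>n\<close> form an initial
  segment of each row and are determined by their number.\<close>

lemma less_subshape_iff:
  assumes "T \<in> tableaux m f"
  shows "c < subshape n f T r \<longleftrightarrow> c < f r \<and> T (r, c) < n"
proof -
  have "{c. c < f r \<and> T (r, c) < n} = {..<subshape n f T r}" unfolding subshape_def
  proof (rule down_closed_eq_lessThan)
    fix a b assume ab: "a < b" "b \<in> {c. c < f r \<and> T (r, c) < n}"
    then have "T (r, a) \<le> T (r, b)" using assms unfolding tableaux_def cells_def by auto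
    then show "a \<in> {c. c < f r \<and> T (r, c) < n}" using ab by auto
  qed auto
  then show ?thesis by auto
qed

text \<open>The cell above any cell holds a letter smaller than one that is at most
  \<open>n\<close>, so it survives the removal of the letter \<open>n\<close>.\<close>

lemma subshape_interlaces:
  assumes "T \<in> tableaux (Suc n) f" "f \<in> parts (Suc n)"
  shows "subshape n f T \<prec>\<prec> f" "subshape n f T \<in> parts n"
proof -
  note iff = less_subshape_iff[OF assms(1), of _ n]
  have "c < subshape n f T r" if "c < f (Suc r)" for r c
  proof -
    have c: "(Suc r, c) \<in> cells f" "(r, c) \<in> cells f"
      using that parts_antimono[OF assms(2), of r "Suc r"] by (auto simp: cells_def)
    then have "T (r, c) < T (Suc r, c)" using assms(1) unfolding tableaux_def by blast
    moreover have "T (Suc r, c) < Suc n" using assms(1) c unfolding tableaux_def by auto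
    ultimately show ?thesis using c by (auto simp: iff cells_def)
  qed
  moreover have "subshape n f T r \<le> f r" for r using iff by (metis less_irrefl not_le)
  ultimately show int: "subshape n f T \<prec>\<prec> f" unfolding interlaces_def by (meson leI less_irrefl)
  have "subshape n f T n = 0"
  proof (rule ccontr)
    assume "subshape n f T n \<noteq> 0"
    then have "0 < f n \<and> T (n, 0) < n" using iff by blast
    then show False using tableaux_ge_row[OF assms, of n 0] by (simp add: cells_def)
  qed
  moreover have "subshape n f T \<in> parts (Suc n)" using interlaces_parts_lower[OF int assms(2)] .
  ultimately show "subshape n f T \<in> parts n"
    by (auto simp: parts_def) (metis le_antisym not_less_eq_eq)
qed

text \<open>The value \<open>undefined\<close> outside \<open>cells f\<close> keeps the filling
  extensional, as membership in \<open>tableaux\<close> demands.\<close>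

definition extend_tableau :: "nat \<Rightarrow> (nat \<Rightarrow> nat) \<Rightarrow> (nat \<Rightarrow> nat) \<Rightarrow> (nat \<times> nat \<Rightarrow> nat) \<Rightarrow> nat \<times> nat \<Rightarrow> nat" where
  "extend_tableau n f g T b = (if b \<in> cells g then T b else if b \<in> cells f then n else undefined)"

lemma extend_tableau:
  assumes "T \<in> tableaux n g" "g \<in> parts n" "g \<prec>\<prec> f" "f \<in> parts m"
  shows "extend_tableau n f g T \<in> tableaux (Suc n) f"
proof -
  let ?E = "extend_tableau n f g T"
  have sub: "cells g \<subseteq> cells f" using interlaces_le(1)[OF assms(3)] by (rule cells_mono)
  have T: "T b < n" if "b \<in> cells g" for b using assms(1) that unfolding tableaux_def by auto
  have row: "?E (r, c) \<le> ?E (r, c')" if "c < c'" "(r, c) \<in> cells f" "(r, c') \<in> cells f" for r c c'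
  proof (cases "(r, c') \<in> cells g")
    case True
    then have "(r, c) \<in> cells g" using that by (auto simp: cells_def)
    then show ?thesis using True assms(1) that unfolding tableaux_def extend_tableau_def by auto
  next
    case False
    then show ?thesis using T that by (auto simp: extend_tableau_def intro: less_imp_le)
  qed
  have col: "?E (r, c) < ?E (r', c)" if "r < r'" "(r, c) \<in> cells f" "(r', c) \<in> cells f" for r r' c
  proof -
    \<comment> \<open>Interlacing places every cell that has a cell of \<open>f\<close> below it
      inside \<open>g\<close>; hence no column contains the new letter twice.\<close>
    have "c < f r'" using that by (simp add: cells_def)
    also have "f r' \<le> f (Suc r)" using parts_antimono[OF assms(4)] that by simp
    also have "\<dots> \<le> g r" using interlaces_le(2)[OF assms(3)] .
    finally have g: "(r, c) \<in> cells g" by (simp add: cells_def)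
    show ?thesis using g that T[OF g] assms(1) unfolding tableaux_def extend_tableau_def by auto
  qed
  have "?E \<in> cells f \<rightarrow>\<^sub>E {..<Suc n}"
    using T sub by (fastforce simp: extend_tableau_def intro: less_SucI)
  then show ?thesis unfolding tableaux_def using row col by blast
qed

lemma restrict_tableau:
  assumes "T \<in> tableaux (Suc n) f"
  shows "restrict T (cells (subshape n f T)) \<in> tableaux n (subshape n f T)"
proof -
  note iff = less_subshape_iff[OF assms, of _ n]
  have "(r, c) \<in> cells (subshape n f T) \<longleftrightarrow> (r, c) \<in> cells f \<and> T (r, c) < n" for r c
    by (auto simp: cells_def iff)
  then show ?thesis using assms unfolding tableaux_def by auto
qed

lemma finite_tableaux: "f \<in> parts m \<Longrightarrow> finite (tableaux n f)"
  unfolding tableaux_def by (rule finite_subset[of _ "cells f \<rightarrow>\<^sub>E {..<n}"]) (auto intro: finite_PiE finite_cells)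

lemma subshape_extend:
  assumes "T \<in> tableaux n g" "g \<prec>\<prec> f"
  shows "subshape n f (extend_tableau n f g T) = g"
proof
  fix r
  have T: "T b < n" if "b \<in> cells g" for b using assms(1) that unfolding tableaux_def by auto
  have "{c. c < f r \<and> extend_tableau n f g T (r, c) < n} = {..<g r}"
    using T interlaces_le(1)[OF assms(2), of r] by (auto simp: extend_tableau_def cells_def split: if_splits)
  then show "subshape n f (extend_tableau n f g T) r = g r" by (simp add: subshape_def)
qed

lemma restrict_extend:
  "T \<in> tableaux n g \<Longrightarrow> restrict (extend_tableau n f g T) (cells g) = T"
  by (auto simp: tableaux_def extend_tableau_def restrict_def fun_eq_iff PiE_def extensional_def)

lemma extend_restrict:
  assumes "T \<in> tableaux (Suc n) f"
  shows "extend_tableau n f (subshape n f T) (restrict T (cells (subshape n f T))) = T"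
proof
  fix b :: "nat \<times> nat"
  obtain r c where b: "b = (r, c)" by (cases b)
  have "T b \<in> {..<Suc n}" if "b \<in> cells f" using assms that unfolding tableaux_def by auto
  moreover have "T b = undefined" if "b \<notin> cells f"
    using assms that unfolding tableaux_def b by (auto simp: PiE_def extensional_def)
  ultimately show "extend_tableau n f (subshape n f T) (restrict T (cells (subshape n f T))) b = T b"
    using less_subshape_iff[OF assms, of c n r] unfolding b extend_tableau_def
    by (auto simp: cells_def restrict_def)
qed

text \<open>Deleting the cells with the largest letter is a bijection from tableaux of shape
  \<open>f\<close> to pairs of an interlacing shape and a tableau of that shape; the deleted strip
  contributes the power of \<open>x n\<close>.\<close>

lemma tableaux_sum_eq_gt_poly:
  assumes "f \<in> parts n"
  shows "(\<Sum>T\<in>tableaux n f. \<Prod>b\<in>cells f. x (T b)) = gt_poly n f x"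
  using assms
proof (induction n arbitrary: f)
  case 0
  then have f: "f = (\<lambda>i. 0)" by simp
  then have "cells f = {}" by (simp add: cells_def)
  moreover from this have "tableaux 0 f = {\<lambda>b. undefined}" by (simp add: tableaux_def)
  ultimately show ?case using f by simp
next
  case (Suc n)
  have fin: "finite {g. g \<in> parts n \<and> g \<prec>\<prec> f}"
    using finite_interlaces_lower[OF Suc.prems] by (rule finite_subset[rotated]) auto
  have "gt_poly (Suc n) f x = (\<Sum>g | g \<in> parts n \<and> g \<prec>\<prec> f. x n ^ (weight f - weight g) *
      (\<Sum>T\<in>tableaux n g. \<Prod>b\<in>cells g. x (T b)))"
    by (simp add: Suc.IH)
  also have "\<dots> = (\<Sum>(g,T)\<in>(SIGMA g:{g. g \<in> parts n \<and> g \<prec>\<prec> f}. tableaux n g).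
      x n ^ (weight f - weight g) * (\<Prod>b\<in>cells g. x (T b)))"
    using fin finite_tableaux by (subst sum.Sigma[symmetric]) (auto simp: sum_distrib_left)
  also have "\<dots> = (\<Sum>T\<in>tableaux (Suc n) f. \<Prod>b\<in>cells f. x (T b))"
  proof (rule sum.reindex_bij_witness[of _ "\<lambda>T. (subshape n f T, restrict T (cells (subshape n f T)))"
        "\<lambda>(g,T). extend_tableau n f g T"], goal_cases)
    case (1 a)
    then show ?case by (auto simp: subshape_extend restrict_extend)
  next
    case (2 a)
    then show ?case using extend_tableau Suc.prems by auto
  next
    case (3 T)
    then show ?case by (simp add: extend_restrict)
  next
    case (4 T)
    then show ?case using subshape_interlaces[OF 4 Suc.prems] restrict_tableau[OF 4] by auto
  next
    case (5 a)
    then obtain g T where a: "a = (g, T)" "g \<in> parts n" "g \<prec>\<prec> f" "T \<in> tableaux n g" by auto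
    have sub: "cells g \<subseteq> cells f" using interlaces_le(1)[OF a(3)] by (rule cells_mono)
    have "(\<Prod>b\<in>cells f. x (extend_tableau n f g T b)) =
      (\<Prod>b\<in>cells f - cells g. x (extend_tableau n f g T b)) * (\<Prod>b\<in>cells g. x (extend_tableau n f g T b))"
      using sub finite_cells[OF Suc.prems] by (rule prod.subset_diff)
    also have "(\<Prod>b\<in>cells f - cells g. x (extend_tableau n f g T b)) = x n ^ card (cells f - cells g)"
      by (simp add: extend_tableau_def)
    also have "card (cells f - cells g) = weight f - weight g"
      using sub finite_cells[OF a(2)] by (simp add: card_Diff_subset card_cells[OF a(2)] card_cells[OF Suc.prems])
    also have "(\<Prod>b\<in>cells g. x (extend_tableau n f g T b)) = (\<Prod>b\<in>cells g. x (T b))"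
      by (simp add: extend_tableau_def)
    finally show ?case using a by simp
  qed
  finally show ?case by simp
qed

section \<open>Partitions as lists and as row functions\<close>

definition rows :: "nat list \<Rightarrow> nat \<Rightarrow> nat" where
  "rows la i = (if i < length la then la ! i else 0)"

lemma rows_parts: "la \<in> partitions_of m \<Longrightarrow> rows la \<in> parts (length la)"
  by (auto simp: partitions_of_def parts_def rows_def sorted_wrt_iff_nth_less)

lemma weight_rows: "la \<in> partitions_of m \<Longrightarrow> weight (rows la) = m"
  by (subst weight_eq[of "length la"])
    (auto simp: rows_def partitions_of_def sum_list_sum_nth atLeast0LessThan)

lemma diagram_eq_cells: "diagram la = cells (rows la)"
  by (auto simp: diagram_def cells_def rows_def split: if_splits)

lemma ssyt_eq_tableaux: "ssyt n la = tableaux n (rows la)"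
  by (simp add: ssyt_def tableaux_def diagram_eq_cells)

lemma schur_poly_eq_gt_poly:
  assumes "la \<in> partitions_of m" "length la \<le> n"
  shows "schur_poly n la x = gt_poly n (rows la) x"
proof -
  have f: "rows la \<in> parts n" using rows_parts[OF assms(1)] parts_mono[OF assms(2)] by auto
  have "(\<Prod>i<n. x i ^ card {b \<in> cells (rows la). T b = i}) = (\<Prod>b\<in>cells (rows la). x (T b))"
    if "T \<in> tableaux n (rows la)" for T
  proof -
    have "T ` cells (rows la) \<subseteq> {..<n}" using that unfolding tableaux_def by auto
    then have "(\<Prod>b\<in>cells (rows la). x (T b)) =
      (\<Prod>i<n. \<Prod>b\<in>{b \<in> cells (rows la). T b = i}. x (T b))"
      using finite_cells[OF f] by (subst prod.group) auto
    then show ?thesis by simp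
  qed
  then show ?thesis unfolding schur_poly_def ssyt_eq_tableaux diagram_eq_cells
    using tableaux_sum_eq_gt_poly[OF f, of x] by simp
qed

lemma bij_betw_rows:
  "bij_betw rows {la \<in> partitions_of m. length la \<le> n} {f \<in> parts n. weight f = m}"
\<comment> \<open>The support of a weakly decreasing function is an initial segment, so its
  cardinality is the length of the list to be recovered.\<close>
proof (rule bij_betw_byWitness[where f' = "\<lambda>f. map f [0..<card {i. f i \<noteq> 0}]"])
  show "\<forall>la\<in>{la \<in> partitions_of m. length la \<le> n}. map (rows la) [0..<card {i. rows la i \<noteq> 0}] = la"
  proof safe
    fix la assume la: "la \<in> partitions_of m"
    then have *: "{i. rows la i \<noteq> 0} = {..<length la}"
      by (auto simp: rows_def partitions_of_def in_set_conv_nth split: if_splits)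
    show "map (rows la) [0..<card {i. rows la i \<noteq> 0}] = la"
      unfolding * card_lessThan by (rule nth_equalityI) (auto simp: rows_def)
  qed
  have supp: "{i. f i \<noteq> 0} = {..<card {i. f i \<noteq> 0}} \<and> card {i. f i \<noteq> 0} \<le> n" if "f \<in> parts n" for f
  proof -
    have sub: "{i. f i \<noteq> 0} \<subseteq> {..<n}" 
    proof
      fix i assume "i \<in> {i. f i \<noteq> 0}"
      then show "i \<in> {..<n}" using parts_zero[OF that, of i] by (cases "i < n") auto
    qed
    then have "finite {i. f i \<noteq> 0}" by (rule finite_subset) simp
    moreover have "a \<in> {i. f i \<noteq> 0}" if "a < b" "b \<in> {i. f i \<noteq> 0}" for a b
      using parts_antimono[OF \<open>f \<in> parts n\<close>, of a b] that by auto
    ultimately have "{i. f i \<noteq> 0} = {..<card {i. f i \<noteq> 0}}"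
      by (intro down_closed_eq_lessThan) auto
    moreover have "card {i. f i \<noteq> 0} \<le> n" using card_mono[OF _ sub] by simp
    ultimately show ?thesis by blast
  qed
  have inv: "rows (map f [0..<card {i. f i \<noteq> 0}]) = f" if "f \<in> parts n" for f
  proof
    fix i
    show "rows (map f [0..<card {i. f i \<noteq> 0}]) i = f i"
    proof (cases "i \<in> {i. f i \<noteq> 0}")
      case True
      then have "i < card {i. f i \<noteq> 0}" using supp[OF that] by blast
      then show ?thesis by (simp add: rows_def)
    next
      case False
      then have "\<not> i < card {i. f i \<noteq> 0}" using supp[OF that] by blast
      then show ?thesis using False by (simp add: rows_def)
    qed
  qed
  then show "\<forall>f\<in>{f \<in> parts n. weight f = m}. rows (map f [0..<card {i. f i \<noteq> 0}]) = f" by auto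
  show "rows ` {la \<in> partitions_of m. length la \<le> n} \<subseteq> {f \<in> parts n. weight f = m}"
    using rows_parts weight_rows parts_mono by blast
  show "(\<lambda>f. map f [0..<card {i. f i \<noteq> 0}]) ` {f \<in> parts n. weight f = m} \<subseteq> {la \<in> partitions_of m. length la \<le> n}"
  proof safe
    fix f assume f: "f \<in> parts n"
    let ?k = "card {i. f i \<noteq> 0}"
    have "sorted_wrt (\<ge>) (map f [0..<?k])"
      using parts_antimono[OF f] by (auto simp: sorted_wrt_iff_nth_less)
    moreover have "0 \<notin> set (map f [0..<?k])"
    proof
      assume "0 \<in> set (map f [0..<?k])"
      then obtain i where "i < ?k" "f i = 0" by auto
      moreover from this have "i \<in> {i. f i \<noteq> 0}" using supp[OF f] by blast
      ultimately show False by simp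
    qed
    moreover have "sum_list (map f [0..<?k]) = weight f"
    proof -
      have "weight f = sum f {..<?k}" unfolding weight_def using supp[OF f] by metis
      then show ?thesis by (simp add: interv_sum_list_conv_sum_set_nat atLeast0LessThan)
    qed
    ultimately show "map f [0..<?k] \<in> partitions_of (weight f)" by (simp add: partitions_of_def)
    show "length (map f [0..<?k]) \<le> n" using supp[OF f] by simp
  qed
qed

text \<open>Give every cell in row \<open>r\<close> the sign \<open>(-1) ^ r\<close> and sum by
  columns instead of rows: a column of length \<open>c\<close> contributes 1 for odd
  \<open>c\<close> and 0 for even \<open>c\<close>.\<close>

lemma alt_weight_rows:
  assumes "la \<in> partitions_of m"
  shows "alt_weight (rows la) = int (odd_columns la)"
proof -
  let ?L = "length la" and ?f = "rows la"
  \<comment> \<open>Any bound above all row lengths will do; it makes the sum over columns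
    finite.\<close>
  define K where "K = Suc (\<Sum>r<?L. ?f r)"
  have le: "?f r < K" if "r < ?L" for r
    unfolding K_def using that by (auto intro!: le_imp_less_Suc member_le_sum)
  have down: "{r. r < ?L \<and> i < ?f r} = {..<conj_part la (Suc i)}" for i
  proof -
    have "{r. r < ?L \<and> i < ?f r} = {j. j < length la \<and> Suc i \<le> la ! j}" by (auto simp: rows_def)
    moreover have "{r. r < ?L \<and> i < ?f r} = {..<card {r. r < ?L \<and> i < ?f r}}"
      using parts_antimono[OF rows_parts[OF assms]]
      by (intro down_closed_eq_lessThan) (auto intro: less_le_trans less_imp_le)
    ultimately show ?thesis by (simp add: conj_part_def)
  qed
  have alt: "(\<Sum>r<k. (-1::int) ^ r) = (if odd k then 1 else 0)" for k :: nat
    by (induction k) auto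
  have "alt_weight ?f = (\<Sum>r<?L. (-1) ^ r * int (?f r))"
    by (rule alt_weight_eq) (simp add: rows_def)
  also have "\<dots> = (\<Sum>r<?L. \<Sum>i<K. if i < ?f r then (-1) ^ r else 0)"
  proof (intro sum.cong refl)
    fix r assume "r \<in> {..<?L}"
    then have "{i. i < K \<and> i < ?f r} = {..<?f r}" using le by force
    then show "(-1) ^ r * int (?f r) = (\<Sum>i<K. if i < ?f r then (-1::int) ^ r else 0)"
      by (subst sum.inter_filter[symmetric]) auto
  qed
  also have "\<dots> = (\<Sum>i<K. \<Sum>r<?L. if i < ?f r then (-1) ^ r else 0)" by (rule sum.swap)
  also have "\<dots> = (\<Sum>i<K. if odd (conj_part la (Suc i)) then 1 else 0)"
  proof (intro sum.cong refl)
    fix i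
    have "(\<Sum>r<?L. if i < ?f r then (-1::int) ^ r else 0) = (\<Sum>r | r < ?L \<and> i < ?f r. (-1) ^ r)"
      by (subst sum.inter_filter[symmetric]) auto
    then show "(\<Sum>r<?L. if i < ?f r then (-1::int) ^ r else 0) = (if odd (conj_part la (Suc i)) then 1 else 0)"
      unfolding down alt .
  qed
  also have "\<dots> = int (card {i. i < K \<and> odd (conj_part la (Suc i))})"
    by (subst sum.inter_filter[symmetric]) auto
  \<comment> \<open>Cells number their columns from 0, \<open>conj_part\<close> numbers them from
    1.\<close>
  also have "card {i. i < K \<and> odd (conj_part la (Suc i))} = card (Suc ` {i. i < K \<and> odd (conj_part la (Suc i))})"
    by (simp add: card_image)
  also have "Suc ` {i. i < K \<and> odd (conj_part la (Suc i))} = {i. i \<ge> 1 \<and> odd (conj_part la i)}"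
  proof safe
    fix i assume i: "1 \<le> i" "odd (conj_part la i)"
    then obtain j where j: "i = Suc j" by (cases i) auto
    have "j < K"
    proof (rule ccontr)
      assume "\<not> j < K"
      then have "{r. r < ?L \<and> j < ?f r} = {}" using le by (force dest: less_trans)
      then have "card {..<conj_part la (Suc j)} = 0" using down[of j] by simp
      then have "conj_part la i = 0" using j by simp
      then show False using i by simp
    qed
    then show "i \<in> Suc ` {i. i < K \<and> odd (conj_part la (Suc i))}" using i j by auto
  qed auto
  finally show ?thesis by (simp add: odd_columns_def)
qed

section \<open>Linear independence of monomials and Kostka numbers\<close>

text \<open>Independence of characters of a torus, which is why only nonvanishing arguments are
  assumed. To eliminate \<open>N\<close>, double a coordinate in which \<open>M\<close> and
  \<open>N\<close> have different multiplicities: the two monomials are scaled by different powers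
  of 2, and subtracting a multiple of the original relation removes \<open>N\<close> but not
  \<open>M\<close>.\<close>

lemma mon_independent:
  assumes "finite F" "\<And>y. (\<forall>p. y p \<noteq> 0) \<Longrightarrow> (\<Sum>M\<in>F. c M * mon y M) = 0" "M \<in> F"
  shows "c M = 0"
  using assms
proof (induction F arbitrary: c M rule: finite_induct)
  case (insert N F)
  have c0: "c M = 0" if M: "M \<in> F" for M
  proof -
    obtain p where p: "count M p \<noteq> count N p" using M insert.hyps by (metis multiset_eqI)
    define z where "z = (\<lambda>q. if q = p then 2 else 1 :: complex)"
    have zmon: "mon z L = 2 ^ count L p" for L
      by (simp add: mon_def z_def prod_mset_delta)
    have "(\<Sum>M\<in>F. c M * (mon z M - mon z N) * mon y M) = 0" if y: "\<forall>p. y p \<noteq> 0" for y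
    proof -
      have "(\<Sum>M\<in>insert N F. c M * mon (\<lambda>p. z p * y p) M) - mon z N * (\<Sum>M\<in>insert N F. c M * mon y M) = 0"
        using insert.prems(1)[of y] insert.prems(1)[of "\<lambda>p. z p * y p"] y by (simp add: z_def)
      then show ?thesis using insert.hyps
        by (simp add: mon_mult algebra_simps sum_distrib_left sum_subtractf)
    qed
    then have "c M * (mon z M - mon z N) = 0" using M by (rule insert.IH)
    moreover have "mon z M \<noteq> mon z N"
    proof
      assume "mon z M = mon z N"
      then have "(of_nat (2 ^ count M p) :: complex) = of_nat (2 ^ count N p)" by (simp add: zmon)
      then have "(2::nat) ^ count M p = 2 ^ count N p" by (simp only: of_nat_eq_iff)
      then show False using p by simp
    qed
    ultimately show ?thesis by simp
  qed
  have "(\<Sum>M\<in>insert N F. c M * mon (\<lambda>_. 1) M) = 0" by (rule insert.prems(1)) simp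
  then have "c N = 0" using insert.hyps c0 by simp
  then show ?case using c0 insert.prems(2) by auto
qed simp

lemma mon_coeff_unique:
  assumes "finite F" "\<And>y. (\<forall>p. y p \<noteq> 0) \<Longrightarrow> (\<Sum>M\<in>F. c M * mon y M) = (\<Sum>M\<in>F. d M * mon y M)" "M \<in> F"
  shows "c M = d M"
  using mon_independent[of F "\<lambda>M. c M - d M" M] assms by (simp add: algebra_simps sum_subtractf)

section \<open>Kostka numbers\<close>

text \<open>The number of Gelfand-Tsetlin patterns of shape \<open>f\<close> and content
  \<open>N\<close>: the branching of \<open>gt_poly\<close> with the exponent of each variable
  prescribed.\<close>

fun kostka :: "nat \<Rightarrow> (nat \<Rightarrow> nat) \<Rightarrow> nat multiset \<Rightarrow> nat" where
  "kostka 0 f N = (if f = (\<lambda>i. 0) then 1 else 0)"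
| "kostka (Suc n) f N =
     (\<Sum>g | g \<in> parts n \<and> g \<prec>\<prec> f \<and> weight f = weight g + count N n. kostka n g N)"

lemma kostka_cong: "(\<And>i. i < n \<Longrightarrow> count M i = count N i) \<Longrightarrow> kostka n f M = kostka n f N"
  by (induction n arbitrary: f) auto

lemma gt_poly_eq_kostka:
  assumes "f \<in> parts n"
  shows "gt_poly n f x = (\<Sum>N\<in>multisets_of_size {..<n} (weight f). of_nat (kostka n f N) * mon x N)"
  using assms
proof (induction n arbitrary: f)
  case (Suc n)
  let ?w = "weight f"
  define B where "B = {g. g \<in> parts n \<and> g \<prec>\<prec> f}"
  have finB: "finite B" unfolding B_def
    using finite_interlaces_lower[OF Suc.prems] by (rule finite_subset[rotated]) auto
  have wB: "weight g \<le> ?w" if "g \<in> B" for g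
    using that interlaces_weight Suc.prems unfolding B_def by blast
  have "(\<Sum>N\<in>multisets_of_size {..<Suc n} ?w. of_nat (kostka (Suc n) f N) * mon x N) =
    (\<Sum>(m,M)\<in>(SIGMA m:{0..?w}. multisets_of_size {..<n} (?w - m)).
       of_nat (kostka (Suc n) f (M + replicate_mset m n)) * mon x (M + replicate_mset m n))"
    using sum.reindex_bij_betw[OF bij_betw_multisets_of_size_insert[of n "{..<n}" ?w],
        of "\<lambda>N. of_nat (kostka (Suc n) f N) * mon x N", symmetric]
    by (simp only: lessThan_Suc case_prod_unfold lessThan_iff less_irrefl simp_thms)
  also have "\<dots> = (\<Sum>m\<in>{0..?w}. \<Sum>M\<in>multisets_of_size {..<n} (?w - m).
       of_nat (kostka (Suc n) f (M + replicate_mset m n)) * mon x (M + replicate_mset m n))"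
    by (subst sum.Sigma) auto
  also have "\<dots> = (\<Sum>m\<in>{0..?w}. \<Sum>M\<in>multisets_of_size {..<n} (?w - m). \<Sum>g\<in>B.
       (if ?w - weight g = m then of_nat (kostka n g M) * mon x M * x n ^ m else 0))"
  proof (intro sum.cong refl)
    fix m M assume m: "m \<in> {0..?w}" and M: "M \<in> multisets_of_size {..<n} (?w - m)"
    have cM: "count M n = 0" using M by (auto simp: multisets_of_size_def count_eq_zero_iff)
    have kM: "kostka n g (M + replicate_mset m n) = kostka n g M" for g
      by (rule kostka_cong) simp
    have set: "{g. g \<in> parts n \<and> g \<prec>\<prec> f \<and> ?w = weight g + m} = {g \<in> B. ?w - weight g = m}"
      using m wB unfolding B_def by fastforce
    have "(of_nat (kostka (Suc n) f (M + replicate_mset m n)) :: complex) =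
      (\<Sum>g\<in>{g \<in> B. ?w - weight g = m}. of_nat (kostka n g M))"
      by (simp add: cM kM set)
    then show "of_nat (kostka (Suc n) f (M + replicate_mset m n)) * mon x (M + replicate_mset m n) =
      (\<Sum>g\<in>B. if ?w - weight g = m then of_nat (kostka n g M) * mon x M * x n ^ m else 0)"
      unfolding sum.inter_filter[OF finB, symmetric] by (simp add: sum_distrib_right mult.assoc)
  qed
  also have "\<dots> = (\<Sum>g\<in>B. \<Sum>m\<in>{0..?w}. \<Sum>M\<in>multisets_of_size {..<n} (?w - m).
       (if ?w - weight g = m then of_nat (kostka n g M) * mon x M * x n ^ m else 0))"
    by (subst sum.swap[of _ B], intro sum.cong refl sum.swap)
  also have "\<dots> = (\<Sum>g\<in>B. \<Sum>m\<in>{0..?w}. if ?w - weight g = m then \<Sum>M\<in>multisets_of_size {..<n} (?w - m).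
       of_nat (kostka n g M) * mon x M * x n ^ m else 0)"
    by (intro sum.cong refl) auto
  also have "\<dots> = (\<Sum>g\<in>B. \<Sum>M\<in>multisets_of_size {..<n} (weight g). of_nat (kostka n g M) * mon x M * x n ^ (?w - weight g))"
    using wB by (intro sum.cong refl) (subst sum.delta', auto)
  also have "\<dots> = (\<Sum>g\<in>B. x n ^ (?w - weight g) * gt_poly n g x)"
    by (intro sum.cong refl) (simp add: B_def Suc.IH sum_distrib_left ac_simps)
  finally show ?case by (simp add: B_def)
qed simp

text \<open>With the factors \<open>n - i\<close>, the sums add up all partial sums, so this is
  dominance of the shape over the content compressed into one number; equality is attained only if
  the content is the shape itself. Passing from \<open>f\<close> to the interlacing \<open>g\<close>
  can only decrease the entries.\<close>

lemma kostka_dominance: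
  assumes "f \<in> parts n" "kostka n f N \<noteq> 0"
  shows "(\<Sum>i<n. (n - i) * count N i) \<le> (\<Sum>i<n. (n - i) * f i) \<and> weight f = (\<Sum>i<n. count N i) \<and>
    ((\<Sum>i<n. (n - i) * count N i) = (\<Sum>i<n. (n - i) * f i) \<longrightarrow> (\<forall>i<n. count N i = f i))"
  using assms
proof (induction n arbitrary: f)
  case (Suc n)
  have "\<exists>g\<in>{g. g \<in> parts n \<and> g \<prec>\<prec> f \<and> weight f = weight g + count N n}. kostka n g N \<noteq> 0"
    using Suc.prems(2) sum.not_neutral_contains_not_neutral unfolding kostka.simps by blast
  then obtain g where g: "g \<in> parts n" "g \<prec>\<prec> f" "weight f = weight g + count N n" "kostka n g N \<noteq> 0"
    by blast
  note IH = Suc.IH[OF g(1,4)]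
  \<comment> \<open>One more letter raises every factor by one, which adds the total weight; the
    weights of content and shape agree, so the comparison is unaffected.\<close>
  have shift: "(\<Sum>i<Suc n. (Suc n - i) * h i) = (\<Sum>i<n. (n - i) * h i) + (\<Sum>i<Suc n. h i)" for h :: "nat \<Rightarrow> nat"
    by (simp add: sum.distrib[symmetric] Suc_diff_le algebra_simps)
  have le: "(\<Sum>i<n. (n - i) * g i) \<le> (\<Sum>i<n. (n - i) * f i)"
    using interlaces_le(1)[OF g(2)] by (intro sum_mono) simp
  have w: "weight f = (\<Sum>i<Suc n. f i)" using Suc.prems by (intro weight_eq) (auto simp: parts_zero)
  have w': "weight f = (\<Sum>i<Suc n. count N i)" using IH g(3) by simp
  have "\<forall>i<Suc n. count N i = f i"
    if eq: "(\<Sum>i<Suc n. (Suc n - i) * count N i) = (\<Sum>i<Suc n. (Suc n - i) * f i)"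
  proof -
    have e: "(\<Sum>i<n. (n - i) * count N i) = (\<Sum>i<n. (n - i) * f i)" using eq w w' unfolding shift by simp
    then have e2: "(\<Sum>i<n. (n - i) * g i) = (\<Sum>i<n. (n - i) * f i)" using IH le by simp
    have "\<forall>i<n. count N i = g i" using IH e e2 by simp
    moreover have "g i = f i" if "i < n" for i
    proof (rule ccontr)
      assume "g i \<noteq> f i"
      then have "(n - i) * g i < (n - i) * f i" using interlaces_le(1)[OF g(2), of i] that by simp
      then have "(\<Sum>i<n. (n - i) * g i) < (\<Sum>i<n. (n - i) * f i)"
        using that interlaces_le(1)[OF g(2)] by (intro sum_strict_mono_ex1) auto
      then show False using e2 by simp
    qed
    ultimately have c: "\<forall>i<n. count N i = f i" by simp
    then have "(\<Sum>i<n. count N i) = (\<Sum>i<n. f i)" by simp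
    then have "count N n = f n" using w w' by simp
    then show ?thesis using c by (auto simp: less_Suc_eq)
  qed
  moreover have "(\<Sum>i<Suc n. (Suc n - i) * count N i) \<le> (\<Sum>i<Suc n. (Suc n - i) * f i)"
    unfolding shift using IH le w w' by simp
  ultimately show ?case using w' by blast
qed simp

text \<open>The last content entry fixes the weight of \<open>g\<close>. Since \<open>g\<close> lies
  below \<open>f\<close> in every coordinate, only the truncation of \<open>f\<close> has that
  weight, so the pattern is unique at each stage.\<close>

lemma kostka_diag:
  assumes "f \<in> parts n" "\<And>i. i < n \<Longrightarrow> count N i = f i"
  shows "kostka n f N = 1"
  using assms
proof (induction n arbitrary: f)
  case (Suc n)
  define h where "h = (\<lambda>i. if i < n then f i else 0)"
  have h: "h \<in> parts n" "h \<prec>\<prec> f" 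
    using Suc.prems(1) unfolding parts_def interlaces_def h_def by (auto simp: not_less)
  have wf: "weight f = (\<Sum>i<Suc n. f i)" using Suc.prems by (intro weight_eq) (auto simp: parts_zero)
  have wh: "weight h = (\<Sum>i<n. f i)" using h by (subst weight_eq[of n]) (auto simp: parts_zero h_def)
  have "g = h" if g: "g \<in> parts n" "g \<prec>\<prec> f" "weight f = weight g + count N n" for g
  proof -
    have le: "g i \<le> f i" for i using interlaces_le(1)[OF g(2)] .
    have "weight g = (\<Sum>i<n. g i)" using g by (intro weight_eq) (auto simp: parts_zero)
    then have eq: "(\<Sum>i<n. g i) = (\<Sum>i<n. f i)" using g(3) wf Suc.prems(2)[of n] by simp
    have "g i = f i" if "i < n" for i
    proof (rule ccontr)
      assume "g i \<noteq> f i"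
      then have "g i < f i" using le[of i] by simp
      then have "(\<Sum>i<n. g i) < (\<Sum>i<n. f i)"
        using le that by (intro sum_strict_mono_ex1) auto
      then show False using eq by simp
    qed
    then show ?thesis using g by (auto simp: h_def fun_eq_iff parts_zero)
  qed
  moreover have "weight f = weight h + count N n" using wf wh Suc.prems(2)[of n] by simp
  ultimately have "{g. g \<in> parts n \<and> g \<prec>\<prec> f \<and> weight f = weight g + count N n} = {h}"
    using h by blast
  then have "kostka (Suc n) f N = kostka n h N" by simp
  then show ?case using Suc.IH[OF h(1)] Suc.prems(2) by (simp add: h_def)
qed simp

text \<open>Comparison of coefficients in the Cauchy identity; this is the count behind the
  Robinson-Schensted-Knuth correspondence. A multiset of pairs is a nonnegative integer matrix, and
  its two images are the vectors of row and column sums.\<close>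

lemma kostka_cauchy:
  assumes "M \<in> multisets_of_size {..<n} d" "N \<in> multisets_of_size {..<n} d"
  shows "(\<Sum>f | f \<in> parts n \<and> weight f = d. kostka n f M * kostka n f N) =
    card {A \<in> multisets_of_size ({..<n} \<times> {..<n}) d. image_mset snd A = M \<and> image_mset fst A = N}"
    (is "?l M N = card (?S M N)")
proof -
  let ?W = "multisets_of_size {..<n} d" and ?A = "multisets_of_size ({..<n} \<times> {..<n}) d"
  have fin: "finite ?W" "finite ?A" "finite {f. f \<in> parts n \<and> weight f = d}"
    by (auto intro: finite_subset[OF _ finite_parts[of n d]])
  have main: "(\<Sum>M\<in>?W. (\<Sum>N\<in>?W. of_nat (?l M N) * mon x N) * mon y M) =
        (\<Sum>M\<in>?W. (\<Sum>N\<in>?W. of_nat (card (?S M N)) * mon x N) * mon y M)" for x y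
  proof -
    have "(\<Sum>M\<in>?W. (\<Sum>N\<in>?W. of_nat (?l M N) * mon x N) * mon y M) = 
      (\<Sum>M\<in>?W. \<Sum>N\<in>?W. \<Sum>f | f \<in> parts n \<and> weight f = d.
          (of_nat (kostka n f M) * mon y M) * (of_nat (kostka n f N) * mon x N))"
      by (simp add: sum_distrib_right sum_distrib_left ac_simps)
    also have "\<dots> = (\<Sum>f | f \<in> parts n \<and> weight f = d. \<Sum>M\<in>?W. \<Sum>N\<in>?W.
          (of_nat (kostka n f M) * mon y M) * (of_nat (kostka n f N) * mon x N))"
      by (subst sum.swap[of _ _ ?W], subst sum.swap[of _ _ ?W]) (rule refl)
    also have "\<dots> = (\<Sum>f | f \<in> parts n \<and> weight f = d. gt_poly n f y * gt_poly n f x)"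
      by (intro sum.cong refl) (simp add: gt_poly_eq_kostka sum_product)
    also have "\<dots> = complete_sym ({..<n} \<times> {..<n}) (\<lambda>(i,a). x i * y a) d"
      by (rule gt_poly_cauchy)
    also have "\<dots> = (\<Sum>A\<in>?A. mon x (image_mset fst A) * mon y (image_mset snd A))"
      unfolding complete_sym_def by (intro sum.cong refl) (simp add: mon_image mon_mult[symmetric] case_prod_unfold)
    also have "\<dots> = (\<Sum>P\<in>?W \<times> ?W. \<Sum>A\<in>{A \<in> ?A. (image_mset snd A, image_mset fst A) = P}.
          mon x (image_mset fst A) * mon y (image_mset snd A))"
      by (intro sum.group[symmetric] fin finite_cartesian_product) (force simp: multisets_of_size_def)
    also have "\<dots> = (\<Sum>P\<in>?W \<times> ?W. of_nat (card (?S (fst P) (snd P))) * (mon x (snd P) * mon y (fst P)))"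
    proof (intro sum.cong refl)
      fix P
      have "(\<Sum>A\<in>{A \<in> ?A. (image_mset snd A, image_mset fst A) = P}. mon x (image_mset fst A) * mon y (image_mset snd A))
        = (\<Sum>A\<in>?S (fst P) (snd P). mon x (snd P) * mon y (fst P))"
        by (intro sum.cong) auto
      then show "(\<Sum>A\<in>{A \<in> ?A. (image_mset snd A, image_mset fst A) = P}. mon x (image_mset fst A) * mon y (image_mset snd A))
        = of_nat (card (?S (fst P) (snd P))) * (mon x (snd P) * mon y (fst P))" by simp
    qed
    also have "\<dots> = (\<Sum>M\<in>?W. (\<Sum>N\<in>?W. of_nat (card (?S M N)) * mon x N) * mon y M)"
      by (simp add: sum.cartesian_product' sum_distrib_right mult.assoc)
    finally show ?thesis .
  qed
  \<comment> \<open>Coefficients are compared first in \<open>y\<close>, with polynomials in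
    \<open>x\<close> as coefficients, and then in \<open>x\<close>.\<close>
  have "(\<Sum>N\<in>?W. of_nat (?l M N) * mon x N) = (\<Sum>N\<in>?W. of_nat (card (?S M N)) * mon x N)" for x
    using mon_coeff_unique[OF fin(1), of "\<lambda>M. \<Sum>N\<in>?W. of_nat (?l M N) * mon x N" 
        "\<lambda>M. \<Sum>N\<in>?W. of_nat (card (?S M N)) * mon x N" M] main assms(1) by blast
  then have "of_nat (?l M N) = (of_nat (card (?S M N)) :: complex)"
    using mon_coeff_unique[OF fin(1), of "\<lambda>N. of_nat (?l M N)" "\<lambda>N. of_nat (card (?S M N))" N] assms(2) by blast
  then show ?thesis using of_nat_eq_iff by blast
qed

text \<open>
  Two nonnegative integer matrices with the same Gram matrix agree up to permuting rows as soon as one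
  of them is unitriangular: its extremal row is recovered from the corresponding Gram row and removed.
\<close>

lemma unitriangular_gram_unique:
  fixes J :: "'p \<Rightarrow> 'w \<Rightarrow> nat" and K :: "'i \<Rightarrow> 'w \<Rightarrow> nat" and height :: "'p \<Rightarrow> nat"
  assumes "finite P" "finite I"
    and "\<And>M N. M \<in> W \<Longrightarrow> N \<in> W \<Longrightarrow> (\<Sum>i\<in>I. K i M * K i N) = (\<Sum>p\<in>P. J p M * J p N)"
    and "\<And>p. p \<in> P \<Longrightarrow> w p \<in> W \<and> J p (w p) = 1"
    and "\<And>p q. p \<in> P \<Longrightarrow> q \<in> P \<Longrightarrow> J q (w p) \<noteq> 0 \<Longrightarrow> q = p \<or> height p < height q"
    and "\<And>i. i \<in> I \<Longrightarrow> \<exists>M\<in>W. K i M \<noteq> 0"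
  shows "\<exists>\<pi>. bij_betw \<pi> I P \<and> (\<forall>i\<in>I. \<forall>M\<in>W. K i M = J (\<pi> i) M)"
  using assms
proof (induction "card P" arbitrary: P I)
  case 0
  then have P: "P = {}" by simp
  have "I = {}"
  proof (rule ccontr)
    assume "I \<noteq> {}"
    then obtain i where i: "i \<in> I" by blast
    then obtain M where M: "M \<in> W" "K i M \<noteq> 0" using 0 by blast
    have "(\<Sum>i\<in>I. K i M * K i M) = 0" using 0(4)[OF M(1) M(1)] P by simp
    then show False using i M 0(3) by simp
  qed
  then show ?case using P by (simp add: bij_betw_def)
next
  case (Suc k)
  then have "P \<noteq> {}" by auto
  \<comment> \<open>A row of maximal height is the only one with a nonzero entry in its own column
    \<open>w p\<close>, so the Gram row at \<open>w p\<close> is the row of \<open>p\<close>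
    itself.\<close>
  then obtain p where p: "p \<in> P" "\<And>q. q \<in> P \<Longrightarrow> height q \<le> height p"
    using Max_in[of "height ` P"] Max_ge[of "height ` P"] Suc.prems(1)
    by (metis (no_types, lifting) finite_imageI image_iff image_is_empty)
  have J0: "J q (w p) = 0" if "q \<in> P" "q \<noteq> p" for q
    using Suc.prems(5)[OF p(1) that(1)] p(2)[OF that(1)] that(2) by fastforce
  have wp: "w p \<in> W" "J p (w p) = 1" using Suc.prems(4) p(1) by auto
  have gram: "(\<Sum>i\<in>I. K i (w p) * K i N) = J p N" if "N \<in> W" for N
  proof -
    have "(\<Sum>i\<in>I. K i (w p) * K i N) = (\<Sum>q\<in>P. J q (w p) * J q N)"
      using Suc.prems(3) wp that by blast
    also have "\<dots> = (\<Sum>q\<in>P. if q = p then J p N else 0)"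
      using J0 wp by (intro sum.cong) auto
    finally show ?thesis using Suc.prems(1) p(1) by simp
  qed
  \<comment> \<open>A sum of squares of natural numbers that equals 1 has exactly one nonzero
    summand. Integrality of \<open>K\<close> enters here.\<close>
  have sq: "(\<Sum>i\<in>I. K i (w p) * K i (w p)) = 1" using gram wp by simp
  then obtain i where i: "i \<in> I" "K i (w p) * K i (w p) = 1"
      "\<And>j. j \<in> I \<Longrightarrow> j \<noteq> i \<Longrightarrow> K j (w p) * K j (w p) = 0"
    using sum_eq_1_iff[OF Suc.prems(2), of "\<lambda>i. K i (w p) * K i (w p)"] by metis
  have Ki: "K i N = J p N" if "N \<in> W" for N
  proof -
    have "J p N = (\<Sum>j\<in>I. K j (w p) * K j N)" using gram that by simp
    also have "\<dots> = (\<Sum>j\<in>I. if j = i then K i N else 0)"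
      using i by (intro sum.cong) auto
    finally show ?thesis using Suc.prems(2) i(1) by simp
  qed
  have "\<exists>\<pi>. bij_betw \<pi> (I - {i}) (P - {p}) \<and> (\<forall>i\<in>I - {i}. \<forall>M\<in>W. K i M = J (\<pi> i) M)"
  proof (rule Suc.hyps(1))
    show "k = card (P - {p})" using Suc.hyps(2) p(1) Suc.prems(1) by simp
    fix M N assume MN: "M \<in> W" "N \<in> W"
    show "(\<Sum>i\<in>I - {i}. K i M * K i N) = (\<Sum>p\<in>P - {p}. J p M * J p N)"
      using Suc.prems(3)[OF MN] sum.remove[OF Suc.prems(2) i(1), of "\<lambda>i. K i M * K i N"]
        sum.remove[OF Suc.prems(1) p(1), of "\<lambda>p. J p M * J p N"] Ki[OF MN(1)] Ki[OF MN(2)] by simp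
  qed (use Suc.prems in auto)
  then obtain \<pi> where \<pi>: "bij_betw \<pi> (I - {i}) (P - {p})" "\<forall>i\<in>I - {i}. \<forall>M\<in>W. K i M = J (\<pi> i) M"
    by blast
  have "bij_betw (\<pi>(i := p)) ((I - {i}) \<union> {i}) ((P - {p}) \<union> {p})"
  proof (rule bij_betw_combine)
    show "bij_betw (\<pi>(i := p)) (I - {i}) (P - {p})"
      using \<pi>(1) by (subst bij_betw_cong[of _ _ \<pi>]) auto
  qed auto
  then have "bij_betw (\<pi>(i := p)) I P" using i(1) p(1) by (simp add: insert_absorb)
  moreover have "\<forall>j\<in>I. \<forall>M\<in>W. K j M = J ((\<pi>(i := p)) j) M" using \<pi>(2) Ki by auto
  ultimately show ?case by blast
qed

section \<open>Linear algebra on coordinate functions\<close>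

interpretation fs: vector_space fun_scale
  by unfold_locales (auto simp: fun_scale_def fun_eq_iff algebra_simps)

interpretation fsp: vector_space_pair fun_scale fun_scale ..

abbreviation lin :: "(('i \<Rightarrow> complex) \<Rightarrow> ('j \<Rightarrow> complex)) \<Rightarrow> bool" where
  "lin f \<equiv> Vector_Spaces.linear fun_scale fun_scale f"

lemma fun_scale_apply: "fun_scale c v i = c * v i"
  by (simp add: fun_scale_def)

lemma sum_fun_apply [simp]: "(\<Sum>j\<in>A. f j) i = (\<Sum>j\<in>A. f j i :: complex)"
  by (induction A rule: infinite_finite_induct) auto

lemma linI:
  "(\<And>v w. f (v + w) = f v + f w) \<Longrightarrow> (\<And>c v. f (fun_scale c v) = fun_scale c (f v)) \<Longrightarrow> lin f"
  by (intro Vector_Spaces.linear.intro module_hom.intro module_hom_axioms.intro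
      fs.module_axioms fs.vector_space_axioms)

lemma lin_add: "lin f \<Longrightarrow> f (v + w) = f v + f w"
  and lin_scale: "lin f \<Longrightarrow> f (fun_scale c v) = fun_scale c (f v)"
  and lin_0: "lin f \<Longrightarrow> f 0 = 0"
  and lin_diff: "lin f \<Longrightarrow> f (v - w) = f v - f w"
  and lin_sum: "lin f \<Longrightarrow> f (sum g A) = (\<Sum>a\<in>A. f (g a))"
  by (auto simp: fsp.linear_add fsp.linear_scale fsp.linear_0 fsp.linear_diff fsp.linear_sum)

definition unit_fun :: "'i \<Rightarrow> 'i \<Rightarrow> complex" where
  "unit_fun i = (\<lambda>j. if j = i then 1 else 0)"

lemma subspace_rep_space: "fs.subspace (rep_space R)"
  by (rule fs.subspaceI) (auto simp: rep_space_def fun_scale_apply)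

lemma unit_fun_in: "i \<in> basis R \<Longrightarrow> unit_fun i \<in> rep_space R"
  by (auto simp: rep_space_def unit_fun_def)

lemma rep_space_expand:
  assumes "finite (basis R)" "v \<in> rep_space R"
  shows "v = (\<Sum>i\<in>basis R. fun_scale (v i) (unit_fun i))"
proof
  fix j
  show "v j = (\<Sum>i\<in>basis R. fun_scale (v i) (unit_fun i)) j"
    using assms by (cases "j \<in> basis R") (auto simp: unit_fun_def rep_space_def fun_scale_apply if_distrib cong: if_cong)
qed

lemma rep_space_subset_span:
  assumes "finite (basis R)"
  shows "rep_space R \<subseteq> fs.span (unit_fun ` basis R)"
proof
  fix v assume "v \<in> rep_space R"
  then have "v = (\<Sum>i\<in>basis R. fun_scale (v i) (unit_fun i))" using assms by (intro rep_space_expand)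
  also have "\<dots> \<in> fs.span (unit_fun ` basis R)"
    by (intro fs.span_sum fs.span_scale fs.span_base) auto
  finally show "v \<in> fs.span (unit_fun ` basis R)" .
qed

lemma finite_independent_rep_space:
  assumes "finite (basis R)" "S \<subseteq> rep_space R" "fs.independent S"
  shows "finite S \<and> card S \<le> card (basis R)"
proof -
  have "finite S \<and> card S \<le> card (unit_fun ` basis R)"
    using assms rep_space_subset_span[OF assms(1)] by (intro fs.independent_span_bound) auto
  then show ?thesis using card_image_le[OF assms(1), of unit_fun] by auto
qed

text \<open>Independence arises below as a statement on the coefficients of an indexed family. A
  repeated vector would give the relation with coefficients 1 and -1, so the family is injective as
  well.\<close>

lemma independent_familyD:
  assumes "finite J" "\<And>c. (\<Sum>j\<in>J. fun_scale (c j) (b j)) = 0 \<Longrightarrow> \<forall>j\<in>J. c j = 0"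
  shows "inj_on b J" "fs.independent (b ` J)"
proof -
  show inj: "inj_on b J"
  proof (rule inj_onI, rule ccontr)
    fix i j assume ij: "i \<in> J" "j \<in> J" "b i = b j" "i \<noteq> j"
    let ?c = "\<lambda>k. if k = i then 1 else if k = j then -1 else 0 :: complex"
    have "(\<Sum>k\<in>J. fun_scale (?c k) (b k)) =
      (\<Sum>k\<in>J. (if k = i then b i else 0) + (if k = j then - b i else 0))"
      using ij by (intro sum.cong) (auto simp: fun_eq_iff fun_scale_apply)
    also have "\<dots> = 0" using assms(1) ij(1,2) by (simp add: sum.distrib sum.delta)
    finally have "?c i = 0" using assms(2)[of ?c] ij(1) by blast
    then show False by simp
  qed
  show "fs.independent (b ` J)"
  proof (rule fs.independent_if_scalars_zero)
    fix f x assume f: "(\<Sum>x\<in>b ` J. fun_scale (f x) x) = 0" "x \<in> b ` J"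
    then have "(\<Sum>j\<in>J. fun_scale (f (b j)) (b j)) = 0" using inj by (simp add: sum.reindex)
    then show "f x = 0" using assms(2)[of "\<lambda>j. f (b j)"] f(2) by auto
  qed (use assms in auto)
qed

lemma dim_eq_card_family:
  assumes "finite J" "\<And>j. j \<in> J \<Longrightarrow> b j \<in> U"
    and "\<And>v. v \<in> U \<Longrightarrow> \<exists>c. v = (\<Sum>j\<in>J. fun_scale (c j) (b j))"
    and "\<And>c. (\<Sum>j\<in>J. fun_scale (c j) (b j)) = 0 \<Longrightarrow> \<forall>j\<in>J. c j = 0"
  shows "fs.dim U = card J"
proof -
  note ind = independent_familyD[OF assms(1,4)]
  have "fs.dim U = card (b ` J)"
  proof (rule fs.dim_unique)
    show "U \<subseteq> fs.span (b ` J)"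
    proof
      fix v assume "v \<in> U"
      then obtain c where "v = (\<Sum>j\<in>J. fun_scale (c j) (b j))" using assms(3) by blast
      then show "v \<in> fs.span (b ` J)" by (simp add: fs.span_sum fs.span_scale fs.span_base)
    qed
  qed (use assms(2) ind in auto)
  then show ?thesis using card_image[OF ind(1)] by simp
qed

definition basis_family :: "('i \<Rightarrow> complex) set \<Rightarrow> (nat \<Rightarrow> 'i \<Rightarrow> complex) \<Rightarrow> bool" where
  "basis_family U b \<longleftrightarrow> (\<forall>j<fs.dim U. b j \<in> U) \<and>
     (\<forall>v\<in>U. \<exists>c. v = (\<Sum>j<fs.dim U. fun_scale (c j) (b j))) \<and>
     (\<forall>c. (\<Sum>j<fs.dim U. fun_scale (c j) (b j)) = 0 \<longrightarrow> (\<forall>j<fs.dim U. c j = 0))"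

lemma basis_familyD:
  assumes "basis_family U b"
  shows "j < fs.dim U \<Longrightarrow> b j \<in> U" "v \<in> U \<Longrightarrow> \<exists>c. v = (\<Sum>j<fs.dim U. fun_scale (c j) (b j))"
    "(\<Sum>j<fs.dim U. fun_scale (c j) (b j)) = 0 \<Longrightarrow> \<forall>j<fs.dim U. c j = 0"
  using assms unfolding basis_family_def by simp_all

lemma basis_family_exists:
  assumes "finite (basis R)" "fs.subspace U" "U \<subseteq> rep_space R"
  shows "\<exists>b. basis_family U b"
proof -
  obtain B where B: "B \<subseteq> U" "fs.independent B" "U \<subseteq> fs.span B" "card B = fs.dim U"
    using fs.basis_exists[of U] by metis
  have fin: "finite B" using finite_independent_rep_space[OF assms(1) _ B(2)] B(1) assms(3) by blast
  obtain b where b: "bij_betw b {..<fs.dim U} B"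
    using ex_bij_betw_nat_finite[OF fin] B(4) by (auto simp: atLeast0LessThan)
  have "basis_family U b" unfolding basis_family_def
  proof (intro conjI allI ballI impI)
    show "b j \<in> U" if "j < fs.dim U" for j using b B(1) that by (auto simp: bij_betw_def)
    show "\<exists>c. v = (\<Sum>j<fs.dim U. fun_scale (c j) (b j))" if "v \<in> U" for v
    proof -
      have "v \<in> fs.span B" using that B(3) by blast
      then obtain u where "v = (\<Sum>w\<in>B. fun_scale (u w) w)" using fs.span_finite[OF fin] by auto
      also have "\<dots> = (\<Sum>j<fs.dim U. fun_scale (u (b j)) (b j))"
        by (rule sum.reindex_bij_betw[OF b, symmetric])
      finally show ?thesis by (rule exI[of _ "\<lambda>j. u (b j)"])
    qed
    show "c j = 0" if c: "(\<Sum>j<fs.dim U. fun_scale (c j) (b j)) = 0" and j: "j < fs.dim U" for c j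
    proof -
      let ?u = "\<lambda>w. c (the_inv_into {..<fs.dim U} b w)"
      have inv: "the_inv_into {..<fs.dim U} b (b j) = j" if "j < fs.dim U" for j
        using b that by (auto simp: bij_betw_def intro: the_inv_into_f_f)
      have "(\<Sum>w\<in>B. fun_scale (?u w) w) = (\<Sum>j<fs.dim U. fun_scale (?u (b j)) (b j))"
        by (rule sum.reindex_bij_betw[OF b, symmetric])
      also have "\<dots> = 0" using c inv by simp
      finally have "\<forall>w\<in>B. ?u w = 0"
        by (intro ballI) (rule fs.independentD[OF B(2) fin subset_refl, of ?u])
      then show ?thesis using b inv[OF j] j unfolding bij_betw_def by (metis imageI lessThan_iff)
    qed
  qed
  then show ?thesis by blast
qed

section \<open>Weighted Hermitian forms and orthogonal projections\<close>

text \<open>The weights are there for symmetric powers: their monomial bases are orthogonal, but not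
  orthonormal, for the form that suits the group action.\<close>

definition herm :: "('i \<Rightarrow> real) \<Rightarrow> 'i set \<Rightarrow> ('i \<Rightarrow> complex) \<Rightarrow> ('i \<Rightarrow> complex) \<Rightarrow> complex" where
  "herm q B v w = (\<Sum>i\<in>B. of_real (q i) * v i * cnj (w i))"

lemma herm_simps:
  "herm q B (u + v) w = herm q B u w + herm q B v w"
  "herm q B (u - v) w = herm q B u w - herm q B v w"
  "herm q B (fun_scale c v) w = c * herm q B v w"
  "herm q B w (u + v) = herm q B w u + herm q B w v"
  "herm q B w (fun_scale c v) = cnj c * herm q B w v"
  "herm q B 0 w = 0" "herm q B w 0 = 0"
  by (auto simp: herm_def fun_scale_apply sum.distrib sum_subtractf sum_distrib_left algebra_simps)

lemma herm_commute: "herm q B w v = cnj (herm q B v w)"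
  by (simp add: herm_def ac_simps)

lemma herm_eq_0_iff:
  assumes "finite B" "\<And>i. i \<in> B \<Longrightarrow> q i > 0" "\<And>i. i \<notin> B \<Longrightarrow> v i = 0"
  shows "herm q B v v = 0 \<longleftrightarrow> v = 0"
proof
  assume "herm q B v v = 0"
  moreover have "herm q B v v = of_real (\<Sum>i\<in>B. q i * (cmod (v i))\<^sup>2)"
    by (simp add: herm_def mult.assoc complex_norm_square[symmetric])
  ultimately have "(\<Sum>i\<in>B. q i * (cmod (v i))\<^sup>2) = 0" by (simp only: of_real_eq_0_iff)
  then have "\<forall>i\<in>B. q i * (cmod (v i))\<^sup>2 = 0"
    using assms by (subst (asm) sum_nonneg_eq_0_iff) (auto intro!: mult_nonneg_nonneg simp: less_imp_le)
  then have "v i = 0" for i using assms(2,3)[of i] by (cases "i \<in> B") auto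
  then show "v = 0" by (auto simp: fun_eq_iff)
qed (simp add: herm_simps)

text \<open>Gram-Schmidt, one spanning vector at a time: \<open>b'\<close> is the part of
  \<open>b\<close> orthogonal to the old span. The vector \<open>v\<close> is arbitrary, as the form
  only sees its coordinates in the basis.\<close>

lemma orthogonal_component_span:
  assumes "finite S" "finite (basis R)" "\<And>i. i \<in> basis R \<Longrightarrow> q i > 0" "S \<subseteq> rep_space R"
  shows "\<exists>u\<in>fs.span S. \<forall>w\<in>fs.span S. herm q (basis R) (v - u) w = 0"
  using assms(1,4)
proof (induction S arbitrary: v rule: finite_induct)
  case empty
  show ?case unfolding fs.span_empty by (intro bexI[of _ 0] ballI) (auto simp: herm_def)
next
  case (insert b S)
  let ?h = "herm q (basis R)"
  have IH: "\<exists>u\<in>fs.span S. \<forall>w\<in>fs.span S. ?h (v - u) w = 0" for v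
    using insert.IH[of v] insert.prems by blast
  obtain b0 where b0: "b0 \<in> fs.span S" "\<And>w. w \<in> fs.span S \<Longrightarrow> ?h (b - b0) w = 0" using IH[of b] by blast
  obtain u0 where u0: "u0 \<in> fs.span S" "\<And>w. w \<in> fs.span S \<Longrightarrow> ?h (v - u0) w = 0" using IH[of v] by blast
  define b' where "b' = b - b0"
  \<comment> \<open>If \<open>b'\<close> is zero the quotient is 0 by convention, and there is
    nothing to correct.\<close>
  define c where "c = ?h (v - u0) b' / ?h b' b'"
  have S: "fs.span S \<subseteq> fs.span (insert b S)" by (intro fs.span_mono) auto
  have b'sp: "b' \<in> fs.span (insert b S)" unfolding b'_def
    using b0(1) S by (intro fs.span_diff) (auto simp: fs.span_base)
  have b'R: "b' \<in> rep_space R" unfolding b'_def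
    using insert.prems fs.span_minimal[OF _ subspace_rep_space, of S R] b0(1)
    by (intro fs.subspace_diff[OF subspace_rep_space]) auto
  define u where "u = u0 + fun_scale c b'"
  have c: "?h (v - u) b' = 0"
  proof (cases "b' = 0")
    case False
    then have "?h b' b' \<noteq> 0" using herm_eq_0_iff[of "basis R" q b'] assms(2,3) b'R
      by (auto simp: rep_space_def)
    then show ?thesis unfolding u_def diff_add_eq_diff_diff_swap[symmetric]
      by (simp add: herm_simps c_def diff_diff_eq[symmetric])
  qed (simp add: herm_simps)
  have "?h (v - u) w = 0" if w: "w \<in> fs.span (insert b S)" for w
  proof -
    obtain k where k: "w - fun_scale k b \<in> fs.span S" using w fs.span_breakdown_eq by blast
    define s where "s = w - fun_scale k b + fun_scale k b0"
    have s: "s \<in> fs.span S" unfolding s_def using k b0 by (intro fs.span_add fs.span_scale)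
    have ws: "w = fun_scale k b' + s" by (simp add: s_def b'_def fun_eq_iff fun_scale_apply algebra_simps)
    have "?h (v - u) s = 0" using u0(2)[OF s] b0(2)[OF s]
      by (simp add: u_def herm_simps b'_def diff_diff_eq[symmetric])
    then show ?thesis using c by (simp add: ws herm_simps)
  qed
  moreover have "u \<in> fs.span (insert b S)" unfolding u_def
    using u0(1) S b'sp by (intro fs.span_add fs.span_scale) auto
  ultimately show ?case by blast
qed

text \<open>Defined on all coordinate functions, since linear maps are total here; vectors outside
  \<open>rep_space R\<close> are projected too.\<close>

definition orth_proj :: "('i \<Rightarrow> real) \<Rightarrow> 'i gl_rep \<Rightarrow> ('i \<Rightarrow> complex) set \<Rightarrow> ('i \<Rightarrow> complex) \<Rightarrow> 'i \<Rightarrow> complex" where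
  "orth_proj q R U v = (SOME u. u \<in> U \<and> (\<forall>w\<in>U. herm q (basis R) (v - u) w = 0))"

context
  fixes R :: "'i gl_rep" and q :: "'i \<Rightarrow> real" and U :: "('i \<Rightarrow> complex) set"
  assumes fin: "finite (basis R)" and q: "\<forall>i\<in>basis R. q i > 0"
    and sub: "fs.subspace U" "U \<subseteq> rep_space R"
begin

lemma orth_proj:
  shows "orth_proj q R U v \<in> U" "w \<in> U \<Longrightarrow> herm q (basis R) (v - orth_proj q R U v) w = 0"
proof -
  obtain B where B: "B \<subseteq> U" "fs.independent B" "U \<subseteq> fs.span B"
    using fs.basis_exists[of U] by metis
  have B': "finite B" using finite_independent_rep_space[OF fin _ B(2)] B(1) sub by blast
  have sp: "fs.span B = U" using B sub(1) fs.span_minimal by blast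
  have "\<exists>u. u \<in> U \<and> (\<forall>w\<in>U. herm q (basis R) (v - u) w = 0)"
    using orthogonal_component_span[OF B' fin, of q v] q B(1) sub(2) unfolding sp by blast
  from someI_ex[OF this] show "orth_proj q R U v \<in> U"
    "w \<in> U \<Longrightarrow> herm q (basis R) (v - orth_proj q R U v) w = 0"
    unfolding orth_proj_def by auto
qed

lemma orth_proj_unique:
  assumes "u \<in> U" "\<And>w. w \<in> U \<Longrightarrow> herm q (basis R) (v - u) w = 0"
  shows "orth_proj q R U v = u"
proof -
  let ?d = "orth_proj q R U v - u"
  have d: "?d \<in> U" using assms(1) orth_proj(1) sub(1) by (intro fs.subspace_diff)
  have "herm q (basis R) ?d ?d = herm q (basis R) (v - u) ?d - herm q (basis R) (v - orth_proj q R U v) ?d"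
    by (simp add: herm_simps)
  also have "\<dots> = 0" using assms(2)[OF d] orth_proj(2)[OF d] by simp
  finally have "?d = 0" using herm_eq_0_iff[of "basis R" q ?d] fin q d sub(2) by (auto simp: rep_space_def)
  then show ?thesis by simp
qed

lemma lin_orth_proj: "lin (orth_proj q R U)"
proof (rule linI)
  fix v w c
  show "orth_proj q R U (v + w) = orth_proj q R U v + orth_proj q R U w"
  proof (rule orth_proj_unique)
    fix x assume "x \<in> U"
    from orth_proj(2)[OF this, of v] orth_proj(2)[OF this, of w]
    show "herm q (basis R) (v + w - (orth_proj q R U v + orth_proj q R U w)) x = 0"
      by (simp add: herm_simps)
  qed (intro fs.subspace_add sub orth_proj)
  show "orth_proj q R U (fun_scale c v) = fun_scale c (orth_proj q R U v)"
  proof (rule orth_proj_unique)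
    fix x assume "x \<in> U"
    from orth_proj(2)[OF this, of v]
    show "herm q (basis R) (fun_scale c v - fun_scale c (orth_proj q R U v)) x = 0"
      by (simp add: herm_simps)
  qed (intro fs.subspace_scale sub orth_proj)
qed

lemma orth_proj_id: "v \<in> U \<Longrightarrow> orth_proj q R U v = v"
  by (rule orth_proj_unique) (auto simp: herm_simps)

lemma orth_proj_orthogonal:
  "(\<And>w. w \<in> U \<Longrightarrow> herm q (basis R) v w = 0) \<Longrightarrow> orth_proj q R U v = 0"
  by (rule orth_proj_unique) (auto simp: fs.subspace_0[OF sub(1)])

end

section \<open>Polynomials in an operator and eigenvectors\<close>

definition poly_map :: "complex poly \<Rightarrow> (('i \<Rightarrow> complex) \<Rightarrow> ('i \<Rightarrow> complex)) \<Rightarrow> ('i \<Rightarrow> complex) \<Rightarrow> 'i \<Rightarrow> complex" where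
  "poly_map p T v = (\<Sum>i\<le>degree p. fun_scale (coeff p i) ((T ^^ i) v))"

lemma poly_map_eq: "degree p \<le> m \<Longrightarrow> poly_map p T v = (\<Sum>i\<le>m. fun_scale (coeff p i) ((T ^^ i) v))"
  unfolding poly_map_def by (rule sum.mono_neutral_left) (auto simp: coeff_eq_0)

lemma poly_map_linear_factor:
  assumes "lin T"
  shows "poly_map ([:- z, 1:] * p) T v = T (poly_map p T v) - fun_scale z (poly_map p T v)"
proof -
  let ?m = "degree p"
  have eq: "[:- z, 1:] * p = pCons 0 p - smult z p" by simp
  have deg: "degree (pCons 0 p - smult z p) \<le> Suc ?m"
    by (intro degree_diff_le degree_pCons_le order_trans[OF degree_smult_le]) auto
  have "poly_map ([:- z, 1:] * p) T v =
    (\<Sum>i\<le>Suc ?m. fun_scale (coeff (pCons 0 p) i) ((T ^^ i) v) - fun_scale z (fun_scale (coeff p i) ((T ^^ i) v)))"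
    unfolding eq poly_map_eq[OF deg] by (intro sum.cong) (auto simp: fun_eq_iff fun_scale_apply algebra_simps)
  also have "\<dots> = (\<Sum>i\<le>Suc ?m. fun_scale (coeff (pCons 0 p) i) ((T ^^ i) v)) -
      fun_scale z (\<Sum>i\<le>Suc ?m. fun_scale (coeff p i) ((T ^^ i) v))"
    by (simp only: sum_subtractf fs.scale_sum_right)
  also have "(\<Sum>i\<le>Suc ?m. fun_scale (coeff (pCons 0 p) i) ((T ^^ i) v)) =
      (\<Sum>i\<le>?m. fun_scale (coeff p i) (T ((T ^^ i) v)))"
    unfolding sum.atMost_Suc_shift by (simp add: fun_scale_def zero_fun_def)
  also have "\<dots> = T (poly_map p T v)"
    by (simp add: poly_map_def lin_sum[OF assms] lin_scale[OF assms])
  also have "(\<Sum>i\<le>Suc ?m. fun_scale (coeff p i) ((T ^^ i) v)) = poly_map p T v"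
    by (rule poly_map_eq[symmetric]) simp
  finally show ?thesis .
qed

text \<open>Among one more iterates of \<open>T\<close> on a nonzero \<open>v\<close> than there are
  basis elements, some relation holds. Take a nonzero polynomial of least degree annihilating
  \<open>v\<close> and split off a root \<open>z\<close>: by minimality the cofactor does not
  annihilate \<open>v\<close>, and its value at \<open>v\<close> is an eigenvector for
  \<open>z\<close>.\<close>

lemma eigenvector_exists:
  assumes "finite (basis R)" "fs.subspace U" "U \<subseteq> rep_space R" "U \<noteq> {0}" "lin T" "T ` U \<subseteq> U"
  shows "\<exists>z. \<exists>v\<in>U. v \<noteq> 0 \<and> T v = fun_scale z v"
proof -
  obtain v where v: "v \<in> U" "v \<noteq> 0" using assms(2,4) fs.subspace_0 by blast
  have TU: "(T ^^ i) v \<in> U" for i using v assms(6) by (induction i) auto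
  let ?N = "Suc (card (basis R))"
  have "\<exists>c. (\<Sum>i<?N. fun_scale (c i) ((T ^^ i) v)) = 0 \<and> (\<exists>i<?N. c i \<noteq> 0)"
  proof (rule ccontr)
    assume "\<not> ?thesis"
    then have *: "\<And>c. (\<Sum>i\<in>{..<?N}. fun_scale (c i) ((T ^^ i) v)) = 0 \<Longrightarrow> \<forall>i\<in>{..<?N}. c i = 0" by blast
    note ind = independent_familyD[where b = "\<lambda>i. (T ^^ i) v", OF finite_lessThan *]
    have "card ((\<lambda>i. (T ^^ i) v) ` {..<?N}) \<le> card (basis R)"
      using TU assms(3) by (intro conjunct2[OF finite_independent_rep_space[OF assms(1) _ ind(2)]] image_subsetI) auto
    then show False using card_image[OF ind(1)] by simp
  qed
  then obtain c where c: "(\<Sum>i<?N. fun_scale (c i) ((T ^^ i) v)) = 0" "\<exists>i<?N. c i \<noteq> 0" by blast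
  define p0 where "p0 = (\<Sum>i<?N. monom (c i) i)"
  have cp0: "coeff p0 i = (if i < ?N then c i else 0)" for i
    by (simp add: p0_def coeff_sum if_distrib cong: if_cong)
  have "p0 \<noteq> 0" using c(2) cp0 by (metis coeff_0)
  moreover have "degree p0 \<le> card (basis R)" using cp0 by (intro degree_le) auto
  then have "poly_map p0 T v = (\<Sum>i\<le>card (basis R). fun_scale (coeff p0 i) ((T ^^ i) v))" by (rule poly_map_eq)
  then have "poly_map p0 T v = 0" using c(1) cp0 by (simp add: lessThan_Suc_atMost)
  ultimately have ex: "\<exists>p. p \<noteq> 0 \<and> poly_map p T v = 0" by blast
  obtain p where p: "p \<noteq> 0" "poly_map p T v = 0"
    "\<And>p'. p' \<noteq> 0 \<and> poly_map p' T v = 0 \<Longrightarrow> degree p \<le> degree p'"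
    using ex_has_least_nat[of "\<lambda>p. p \<noteq> 0 \<and> poly_map p T v = 0" _ degree] ex by blast
  have "degree p \<noteq> 0"
  proof
    assume "degree p = 0"
    then obtain a where a: "p = [:a:]" by (rule degree_eq_zeroE)
    then have "fun_scale a v = 0" using p(2) by (simp add: poly_map_def)
    then show False using v(2) p(1) a by (simp add: fs.scale_eq_0_iff)
  qed
  then obtain z where "poly p z = 0"
    using fundamental_theorem_of_algebra[of p] by (auto simp: constant_degree)
  then obtain r where r: "p = [:- z, 1:] * r" by (auto simp: poly_eq_0_iff_dvd)
  have r0: "r \<noteq> 0" using p(1) r by auto
  have "degree p = Suc (degree r)" unfolding r using r0 by (subst degree_mult_eq) auto
  then have "poly_map r T v \<noteq> 0" using p(3)[of r] r0 by fastforce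
  moreover have "poly_map r T v \<in> U" unfolding poly_map_def
    using TU assms(2) by (intro fs.subspace_sum fs.subspace_scale) auto
  moreover have "T (poly_map r T v) = fun_scale z (poly_map r T v)"
    using p(2) unfolding r poly_map_linear_factor[OF assms(5)] by simp
  ultimately show ?thesis by blast
qed

section \<open>Subrepresentations\<close>

lemma GL_carrier: "g \<in> GL n \<Longrightarrow> g \<in> carrier_mat n n"
  by (simp add: GL_def)

lemma GL_I:
  assumes "g \<in> carrier_mat n n" "h \<in> carrier_mat n n" "g * h = 1\<^sub>m n" "h * g = 1\<^sub>m n"
  shows "g \<in> GL n"
  using assms unfolding GL_def invertible_mat_def inverts_mat_def by (auto intro!: exI[of _ h])

lemma GL_inverse:
  assumes "g \<in> GL n"
  obtains h where "h \<in> GL n" "g * h = 1\<^sub>m n" "h * g = 1\<^sub>m n"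
proof -
  have g: "g \<in> carrier_mat n n" using assms by (simp add: GL_def)
  obtain h where h: "g * h = 1\<^sub>m n" "h * g = 1\<^sub>m (dim_row h)"
    using assms unfolding GL_def invertible_mat_def inverts_mat_def by auto
  have "dim_col h = n" using arg_cong[OF h(1), of dim_col] by simp
  moreover have "dim_row h = n" using arg_cong[OF h(2), of dim_col] g by simp
  ultimately have hc: "h \<in> carrier_mat n n" by auto
  then show ?thesis using that[of h] GL_I[of h n g] g h by auto
qed

lemma GL_one: "1\<^sub>m n \<in> GL n"
  by (rule GL_I[of _ _ "1\<^sub>m n"]) auto

lemma GL_mult:
  assumes "g \<in> GL n" "h \<in> GL n"
  shows "g * h \<in> GL n"
proof -
  obtain g' where g': "g' \<in> GL n" "g * g' = 1\<^sub>m n" "g' * g = 1\<^sub>m n" using GL_inverse[OF assms(1)] .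
  obtain h' where h': "h' \<in> GL n" "h * h' = 1\<^sub>m n" "h' * h = 1\<^sub>m n" using GL_inverse[OF assms(2)] .
  note c = GL_carrier[OF assms(1)] GL_carrier[OF assms(2)] GL_carrier[OF g'(1)] GL_carrier[OF h'(1)]
  show ?thesis
  proof (rule GL_I[of _ _ "h' * g'"])
    have "g * h * (h' * g') = g * (h * h') * g'" using c by (simp add: assoc_mult_mat[of _ n n _ n _ n])
    then show "g * h * (h' * g') = 1\<^sub>m n" using g' h' c by simp
    have "h' * g' * (g * h) = h' * (g' * g) * h" using c by (simp add: assoc_mult_mat[of _ n n _ n _ n])
    then show "h' * g' * (g * h) = 1\<^sub>m n" using g' h' c by simp
  qed (use c in auto)
qed

lemma GL_diag:
  assumes "\<And>i. x i \<noteq> 0"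
  shows "mat_diag n x \<in> GL n"
  by (rule GL_I[of _ _ "mat_diag n (\<lambda>i. 1 / x i)"]) (use assms in auto)

definition adj :: "nat \<Rightarrow> complex mat \<Rightarrow> complex mat" where
  "adj n g = mat n n (\<lambda>(i,j). cnj (g $$ (j,i)))"

lemma adj_mult:
  assumes "g \<in> carrier_mat n n" "h \<in> carrier_mat n n"
  shows "adj n (g * h) = adj n h * adj n g"
  using assms by (intro eq_matI) (auto simp: adj_def scalar_prod_def mult.commute)

lemma adj_one: "adj n (1\<^sub>m n) = 1\<^sub>m n"
  by (intro eq_matI) (auto simp: adj_def)

lemma GL_adj:
  assumes "g \<in> GL n" shows "adj n g \<in> GL n"
proof -
  obtain h where h: "h \<in> GL n" "g * h = 1\<^sub>m n" "h * g = 1\<^sub>m n" using GL_inverse[OF assms] .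
  note c = GL_carrier[OF assms] GL_carrier[OF h(1)]
  show ?thesis
    by (rule GL_I[of _ _ "adj n h"])
      (auto simp: adj_mult[OF c, symmetric] adj_mult[OF c(2,1), symmetric] h adj_one, auto simp: adj_def)
qed

lemma rep_act_in: "rep_act R g v \<in> rep_space R"
  by (auto simp: rep_act_def rep_space_def)

lemma lin_rep_act: "lin (rep_act R g)"
  by (rule linI) (auto simp: rep_act_def fun_eq_iff fun_scale_apply sum.distrib sum_distrib_left algebra_simps)

lemma rep_act_one:
  assumes "is_rep n R" "v \<in> rep_space R" shows "rep_act R (1\<^sub>m n) v = v"
proof
  fix i
  have "(\<Sum>j\<in>basis R. entry R (1\<^sub>m n) i j * v j) = (\<Sum>j\<in>basis R. if i = j then v j else 0)"
    if "i \<in> basis R" using assms(1) that unfolding is_rep_def by (intro sum.cong) auto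
  then show "rep_act R (1\<^sub>m n) v i = v i"
    using assms by (auto simp: rep_act_def is_rep_def rep_space_def)
qed

lemma rep_act_mult:
  assumes "is_rep n R" "g \<in> GL n" "h \<in> GL n"
  shows "rep_act R (g * h) v = rep_act R g (rep_act R h v)"
proof
  fix i
  show "rep_act R (g * h) v i = rep_act R g (rep_act R h v) i"
  proof (cases "i \<in> basis R")
    case True
    have "rep_act R (g * h) v i = (\<Sum>j\<in>basis R. \<Sum>m\<in>basis R. entry R g i m * entry R h m j * v j)"
      using assms True unfolding is_rep_def rep_act_def by (simp add: sum_distrib_right)
    also have "\<dots> = (\<Sum>m\<in>basis R. \<Sum>j\<in>basis R. entry R g i m * entry R h m j * v j)"
      by (rule sum.swap)
    finally show ?thesis using True by (simp add: rep_act_def sum_distrib_left mult.assoc)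
  qed (simp add: rep_act_def)
qed

section \<open>Equivariant maps and Schur's lemma\<close>

text \<open>A \<open>gl_rep\<close> carries a fixed basis, so parts of a representation are kept as
  invariant subspaces of it; \<open>subrep_to_nat\<close> supplies coordinates when they are
  needed.\<close>

definition subrep :: "nat \<Rightarrow> 'i gl_rep \<Rightarrow> ('i \<Rightarrow> complex) set \<Rightarrow> bool" where
  "subrep n R U \<longleftrightarrow> fs.subspace U \<and> U \<subseteq> rep_space R \<and> (\<forall>g\<in>GL n. \<forall>v\<in>U. rep_act R g v \<in> U)"

definition irreducible_subrep :: "nat \<Rightarrow> 'i gl_rep \<Rightarrow> ('i \<Rightarrow> complex) set \<Rightarrow> bool" where
  "irreducible_subrep n R U \<longleftrightarrow> subrep n R U \<and> U \<noteq> {0} \<and>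
     (\<forall>W. subrep n R W \<and> W \<subseteq> U \<longrightarrow> W = {0} \<or> W = U)"

text \<open>Linearity concerns all coordinate functions, equivariance only \<open>U\<close>; hence
  the same map serves for every subrepresentation of \<open>U\<close>. The target subspace is left
  to side conditions.\<close>

definition rep_hom :: "nat \<Rightarrow> 'i gl_rep \<Rightarrow> ('i \<Rightarrow> complex) set \<Rightarrow> 'j gl_rep \<Rightarrow>
    (('i \<Rightarrow> complex) \<Rightarrow> ('j \<Rightarrow> complex)) \<Rightarrow> bool" where
  "rep_hom n R U S f \<longleftrightarrow> lin f \<and> (\<forall>g\<in>GL n. \<forall>v\<in>U. f (rep_act R g v) = rep_act S g (f v))"

definition rep_equiv :: "nat \<Rightarrow> 'i gl_rep \<Rightarrow> ('i \<Rightarrow> complex) set \<Rightarrow> 'j gl_rep \<Rightarrow> ('j \<Rightarrow> complex) set \<Rightarrow> bool" where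
  "rep_equiv n R U S W \<longleftrightarrow> (\<exists>f. rep_hom n R U S f \<and> bij_betw f U W)"

lemma subrepD:
  assumes "subrep n R U"
  shows "fs.subspace U" "U \<subseteq> rep_space R" "g \<in> GL n \<Longrightarrow> v \<in> U \<Longrightarrow> rep_act R g v \<in> U" "0 \<in> U"
  using assms fs.subspace_0 by (auto simp: subrep_def)

lemma subrep_rep_space: "subrep n R (rep_space R)"
  by (auto simp: subrep_def subspace_rep_space rep_act_in)

lemma irreducible_rep_iff: "irreducible_rep n R \<longleftrightarrow> irreducible_subrep n R (rep_space R)"
  unfolding irreducible_rep_def irreducible_subrep_def subrep_def
  by (auto simp: image_subset_iff subspace_rep_space rep_act_in)

lemma subrep_kernel:
  assumes "rep_hom n R U S f" "subrep n R U"
  shows "subrep n R {v \<in> U. f v = 0}"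
proof -
  have l: "lin f" using assms by (simp add: rep_hom_def)
  have "fs.subspace {v \<in> U. f v = 0}"
    using subrepD[OF assms(2)] lin_add[OF l] lin_scale[OF l] lin_0[OF l]
    by (intro fs.subspaceI) (auto simp: fs.subspace_add fs.subspace_scale)
  moreover have "f (rep_act R g v) = 0" if "g \<in> GL n" "v \<in> U" "f v = 0" for g v
    using assms(1) that lin_0[OF lin_rep_act] by (auto simp: rep_hom_def)
  ultimately show ?thesis using subrepD[OF assms(2)] by (auto simp: subrep_def)
qed

lemma subrep_image:
  assumes "rep_hom n R U S f" "subrep n R U" "f ` U \<subseteq> rep_space S"
  shows "subrep n S (f ` U)"
  unfolding subrep_def
proof (intro conjI ballI)
  have l: "lin f" using assms by (simp add: rep_hom_def)
  show "fs.subspace (f ` U)"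
  proof (rule fs.subspaceI)
    show "0 \<in> f ` U" using lin_0[OF l] subrepD(4)[OF assms(2)] by (metis imageI)
    show "x + y \<in> f ` U" if "x \<in> f ` U" "y \<in> f ` U" for x y
      using that lin_add[OF l] fs.subspace_add[OF subrepD(1)[OF assms(2)]] by (metis (no_types, lifting) imageE imageI)
    show "fun_scale c x \<in> f ` U" if "x \<in> f ` U" for c x
      using that lin_scale[OF l] fs.subspace_scale[OF subrepD(1)[OF assms(2)]] by (metis (no_types, lifting) imageE imageI)
  qed
  show "rep_act S g v \<in> f ` U" if "g \<in> GL n" "v \<in> f ` U" for g v
    using that assms(1) subrepD(3)[OF assms(2)] unfolding rep_hom_def by (metis (no_types, lifting) imageE imageI)
qed (rule assms(3))

lemma schur_bij:
  assumes "irreducible_subrep n R U" "irreducible_subrep n S W" "rep_hom n R U S f" "f ` U \<subseteq> W"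
    "v \<in> U" "f v \<noteq> 0"
  shows "bij_betw f U W"
proof -
  have l: "lin f" using assms by (simp add: rep_hom_def)
  have sU: "subrep n R U" and sW: "subrep n S W" using assms by (auto simp: irreducible_subrep_def)
  have k: "subrep n R {v \<in> U. f v = 0}" using subrep_kernel[OF assms(3) sU] .
  have "{v \<in> U. f v = 0} = {0} \<or> {v \<in> U. f v = 0} = U"
    using assms(1) k unfolding irreducible_subrep_def by blast
  then have ker: "{v \<in> U. f v = 0} = {0}" using assms(5,6) by blast
  have "inj_on f U"
  proof (rule inj_onI)
    fix x y assume xy: "x \<in> U" "y \<in> U" "f x = f y"
    then have "x - y \<in> {v \<in> U. f v = 0}"
      using lin_diff[OF l] fs.subspace_diff[OF subrepD(1)[OF sU]] by simp
    then show "x = y" using ker by simp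
  qed
  moreover have "subrep n S (f ` U)"
    using subrep_image[OF assms(3) sU] assms(4) subrepD(2)[OF sW] by blast
  then have "f ` U = {0} \<or> f ` U = W" using assms(2,4) unfolding irreducible_subrep_def by blast
  then have "f ` U = W" using assms(5,6) by blast
  ultimately show ?thesis by (simp add: bij_betw_def)
qed

lemma schur_scalar:
  assumes "finite (basis R)" "irreducible_subrep n R U" "rep_hom n R U R f" "f ` U \<subseteq> U"
  shows "\<exists>c. \<forall>v\<in>U. f v = fun_scale c v"
proof -
  have l: "lin f" using assms by (simp add: rep_hom_def)
  have sU: "subrep n R U" "U \<noteq> {0}" using assms by (auto simp: irreducible_subrep_def)
  obtain c v where v: "v \<in> U" "v \<noteq> 0" "f v = fun_scale c v"
    using eigenvector_exists[OF assms(1) subrepD(1,2)[OF sU(1)] sU(2) l assms(4)] by blast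
  let ?h = "\<lambda>v. f v - fun_scale c v"
  have "lin ?h" by (rule linI) (simp_all only: lin_add[OF l] lin_scale[OF l], auto simp: fun_eq_iff fun_scale_apply algebra_simps)
  moreover have "?h (rep_act R g v) = rep_act R g (?h v)" if "g \<in> GL n" "v \<in> U" for g v
    using assms(3) that by (simp add: rep_hom_def lin_diff[OF lin_rep_act] lin_scale[OF lin_rep_act])
  ultimately have "rep_hom n R U R ?h" by (simp add: rep_hom_def)
  from subrep_kernel[OF this sU(1)] have "{v \<in> U. ?h v = 0} = {0} \<or> {v \<in> U. ?h v = 0} = U"
    using assms(2) unfolding irreducible_subrep_def by blast
  moreover have "v \<in> {v \<in> U. ?h v = 0}" using v by simp
  ultimately have "{v \<in> U. ?h v = 0} = U" using v(2) by blast
  then have "\<forall>v\<in>U. f v - fun_scale c v = 0" by blast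
  then show ?thesis by (intro exI[of _ c]) (metis eq_iff_diff_eq_0)
qed

lemma rep_equiv_sym:
  assumes "rep_equiv n R U S W" "subrep n R U"
  shows "rep_equiv n S W R U"
proof -
  obtain f where f: "rep_hom n R U S f" "bij_betw f U W" using assms by (auto simp: rep_equiv_def)
  have l: "lin f" using f by (simp add: rep_hom_def)
  \<comment> \<open>The inverse of \<open>f\<close> on \<open>W\<close>, extended to a linear map on
    all coordinate functions.\<close>
  obtain h where h: "lin h" "\<forall>v\<in>U. h (f v) = v"
    using fsp.linear_exists_left_inverse_on[OF l subrepD(1)[OF assms(2)]] f(2) by (auto simp: bij_betw_def)
  have W: "W = f ` U" using f(2) by (simp add: bij_betw_def)
  have "bij_betw h W U" using f(2) h(2) by (intro bij_betw_byWitness[where f' = f]) (auto simp: bij_betw_def)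
  moreover have "h (rep_act S g w) = rep_act R g (h w)" if g: "g \<in> GL n" and w: "w \<in> W" for g w
  proof -
    obtain v where v: "v \<in> U" "w = f v" using w W by blast
    have "rep_act S g w = f (rep_act R g v)" using f(1) g v by (simp add: rep_hom_def)
    then show ?thesis using h(2) v subrepD(3)[OF assms(2) g v(1)] by simp
  qed
  ultimately show ?thesis using h(1) unfolding rep_equiv_def rep_hom_def by blast
qed

lemma rep_hom_comp:
  assumes "rep_hom n R U S f" "rep_hom n S W T h" "f ` U \<subseteq> W"
  shows "rep_hom n R U T (h \<circ> f)"
proof -
  have l: "lin f" "lin h" using assms by (auto simp: rep_hom_def)
  have "lin (h \<circ> f)"
    by (rule linI) (simp_all only: o_apply lin_add[OF l(1)] lin_add[OF l(2)] lin_scale[OF l(1)] lin_scale[OF l(2)])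
  then show ?thesis using assms by (auto simp: rep_hom_def)
qed

lemma rep_equiv_trans:
  assumes "rep_equiv n R U S W" "rep_equiv n S W T X"
  shows "rep_equiv n R U T X"
proof -
  obtain f h where f: "rep_hom n R U S f" "bij_betw f U W" and h: "rep_hom n S W T h" "bij_betw h W X"
    using assms by (auto simp: rep_equiv_def)
  have "rep_hom n R U T (h \<circ> f)" using f(2) by (intro rep_hom_comp[OF f(1) h(1)]) (auto simp: bij_betw_def)
  then show ?thesis unfolding rep_equiv_def using bij_betw_trans[OF f(2) h(2)] by blast
qed

section \<open>Adjoints and complete reducibility\<close>

lemma dim_strict_mono:
  assumes "finite (basis R)" "fs.subspace C" "fs.subspace U" "C \<subset> U" "U \<subseteq> rep_space R"
  shows "fs.dim C < fs.dim U"
proof -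
  obtain B where B: "B \<subseteq> C" "fs.independent B" "C \<subseteq> fs.span B" "card B = fs.dim C"
    using fs.basis_exists[of C] by metis
  obtain D where D: "D \<subseteq> U" "fs.independent D" "U \<subseteq> fs.span D" "card D = fs.dim U"
    using fs.basis_exists[of U] by metis
  have finD: "finite D" using finite_independent_rep_space[OF assms(1) _ D(2)] D(1) assms(5) by blast
  have finB: "finite B" using finite_independent_rep_space[OF assms(1) _ B(2)] B(1) assms(4,5) by blast
  obtain u where u: "u \<in> U" "u \<notin> C" using assms(4) by blast
  have "fs.span B = C" using B assms(2) fs.span_minimal by blast
  then have "fs.independent (insert u B)" using u B(2) fs.independent_insertI by blast
  moreover have "insert u B \<subseteq> fs.span D" using u B(1) D(3) assms(4) by blast
  ultimately have "card (insert u B) \<le> card D" using fs.independent_span_bound[OF finD] by blast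
  moreover have "u \<notin> B" using u B(1) by blast
  ultimately show ?thesis using finB B(4) D(4) by simp
qed

text \<open>
  The conjugate transpose of \<open>g\<close> acts as the adjoint of \<open>g\<close> for the Hermitian form with weights \<open>q\<close>.
  This makes orthogonal complements invariant without averaging over the unitary group.
\<close>

definition star_form :: "nat \<Rightarrow> 'i gl_rep \<Rightarrow> ('i \<Rightarrow> real) \<Rightarrow> bool" where
  "star_form n R q \<longleftrightarrow> (\<forall>i\<in>basis R. q i > 0) \<and> (\<forall>g\<in>GL n. \<forall>i\<in>basis R. \<forall>j\<in>basis R.
     of_real (q i) * entry R g i j = of_real (q j) * cnj (entry R (adj n g) j i))"

lemma herm_rep_act:
  assumes "star_form n R q" "g \<in> GL n"
  shows "herm q (basis R) (rep_act R g v) w = herm q (basis R) v (rep_act R (adj n g) w)"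
proof -
  have "herm q (basis R) (rep_act R g v) w =
    (\<Sum>i\<in>basis R. \<Sum>j\<in>basis R. (of_real (q i) * entry R g i j) * v j * cnj (w i))"
    by (simp add: herm_def rep_act_def sum_distrib_left sum_distrib_right ac_simps)
  also have "\<dots> = (\<Sum>i\<in>basis R. \<Sum>j\<in>basis R. (of_real (q j) * cnj (entry R (adj n g) j i)) * v j * cnj (w i))"
    using assms unfolding star_form_def by (intro sum.cong refl) simp
  also have "\<dots> = (\<Sum>j\<in>basis R. \<Sum>i\<in>basis R. (of_real (q j) * cnj (entry R (adj n g) j i)) * v j * cnj (w i))"
    by (rule sum.swap)
  also have "\<dots> = herm q (basis R) v (rep_act R (adj n g) w)"
    by (simp add: herm_def rep_act_def sum_distrib_left sum_distrib_right ac_simps)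
  finally show ?thesis .
qed

text \<open>\<open>U\<close> is stable under the adjoint of \<open>g\<close>, because the conjugate
  transpose is again invertible. Moving \<open>g\<close> across the form shows that it carries
  vectors orthogonal to \<open>U\<close> to vectors orthogonal to \<open>U\<close>.\<close>

lemma orth_proj_equivariant:
  assumes "finite (basis R)" "star_form n R q" "subrep n R U" "g \<in> GL n"
  shows "orth_proj q R U (rep_act R g v) = rep_act R g (orth_proj q R U v)"
proof -
  have q: "\<forall>i\<in>basis R. q i > 0" using assms(2) by (simp add: star_form_def)
  note p = orth_proj[OF assms(1) q subrepD(1,2)[OF assms(3)]]
  show ?thesis
  proof (rule orth_proj_unique[OF assms(1) q subrepD(1,2)[OF assms(3)]])
    show "rep_act R g (orth_proj q R U v) \<in> U" using p(1) subrepD(3)[OF assms(3,4)] by blast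
    fix w assume "w \<in> U"
    then have "rep_act R (adj n g) w \<in> U" using subrepD(3)[OF assms(3)] GL_adj[OF assms(4)] by blast
    then have "herm q (basis R) (v - orth_proj q R U v) (rep_act R (adj n g) w) = 0" using p(2) by blast
    then show "herm q (basis R) (rep_act R g v - rep_act R g (orth_proj q R U v)) w = 0"
      by (simp add: herm_rep_act[OF assms(2,4), symmetric] lin_diff[OF lin_rep_act])
  qed
qed

lemma irreducible_subrep_exists:
  assumes "finite (basis R)" "subrep n R U" "U \<noteq> {0}"
  shows "\<exists>W. irreducible_subrep n R W \<and> W \<subseteq> U"
proof -
  let ?P = "\<lambda>W. subrep n R W \<and> W \<subseteq> U \<and> W \<noteq> {0}"
  obtain W where W: "?P W" "\<And>W'. ?P W' \<Longrightarrow> fs.dim W \<le> fs.dim W'"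
    using ex_has_least_nat[of ?P U fs.dim] assms by blast
  have "W' = {0} \<or> W' = W" if "subrep n R W'" "W' \<subseteq> W" for W'
  proof (rule ccontr)
    assume c: "\<not> ?thesis"
    then have "fs.dim W' < fs.dim W"
      using that W(1) by (intro dim_strict_mono[OF assms(1)]) (auto simp: subrep_def)
    moreover have "?P W'" using that W(1) c by blast
    ultimately show False using W(2)[of W'] by simp
  qed
  then show ?thesis using W(1) unfolding irreducible_subrep_def by blast
qed

text \<open>Phrased through projections, so that directness and spanning become equations to which
  equivariant linear maps can be applied.\<close>

definition orthogonal_decomposition ::
    "nat \<Rightarrow> 'i gl_rep \<Rightarrow> ('i \<Rightarrow> real) \<Rightarrow> ('i \<Rightarrow> complex) set \<Rightarrow> ('i \<Rightarrow> complex) set set \<Rightarrow> bool" where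
  "orthogonal_decomposition n R q U D \<longleftrightarrow> finite D \<and> (\<forall>W\<in>D. irreducible_subrep n R W \<and> W \<subseteq> U) \<and>
     (\<forall>W\<in>D. \<forall>W'\<in>D. W \<noteq> W' \<longrightarrow> (\<forall>v\<in>W. orth_proj q R W' v = 0)) \<and>
     (\<forall>v\<in>U. v = (\<Sum>W\<in>D. orth_proj q R W v))"

text \<open>Split off an irreducible \<open>W\<close>. Its orthogonal complement in \<open>U\<close>
  is the kernel of an equivariant projection, hence a subrepresentation, and its dimension is
  smaller.\<close>

lemma complete_reducibility:
  assumes "finite (basis R)" "star_form n R q" "subrep n R U"
  shows "\<exists>D. orthogonal_decomposition n R q U D"
  using assms(3)
proof (induction "fs.dim U" arbitrary: U rule: less_induct)
  case less
  have q: "\<forall>i\<in>basis R. q i > 0" using assms(2) by (simp add: star_form_def)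
  show ?case
  proof (cases "U = {0}")
    case True
    then have "orthogonal_decomposition n R q U {}" by (simp add: orthogonal_decomposition_def)
    then show ?thesis by blast
  next
    case False
    obtain W where W: "irreducible_subrep n R W" "W \<subseteq> U"
      using irreducible_subrep_exists[OF assms(1) less.prems False] by blast
    have sW: "subrep n R W" and W0: "W \<noteq> {0}" using W by (auto simp: irreducible_subrep_def)
    let ?p = "orth_proj q R"
    note p = orth_proj[OF assms(1) q subrepD(1,2)[OF sW]] lin_orth_proj[OF assms(1) q subrepD(1,2)[OF sW]]
      orth_proj_id[OF assms(1) q subrepD(1,2)[OF sW]]
    define C where "C = {v \<in> U. ?p W v = 0}"
    have "rep_hom n R U R (?p W)"
      using p(3) orth_proj_equivariant[OF assms(1,2) sW] by (auto simp: rep_hom_def)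
    then have sC: "subrep n R C" unfolding C_def using less.prems by (rule subrep_kernel)
    obtain w where w: "w \<in> W" "w \<noteq> 0" using W0 subrepD(4)[OF sW] by blast
    have "w \<in> U" "w \<notin> C" using w W(2) p(4)[OF w(1)] by (auto simp: C_def)
    then have "C \<subset> U" by (auto simp: C_def)
    then have "fs.dim C < fs.dim U"
      using dim_strict_mono[OF assms(1)] subrepD(1,2)[OF sC] subrepD(1,2)[OF less.prems] by blast
    then obtain D where D: "orthogonal_decomposition n R q C D" using less.hyps sC by blast
    have DI: "irreducible_subrep n R W'" "W' \<subseteq> C" if "W' \<in> D" for W'
      using D that by (auto simp: orthogonal_decomposition_def)
    have finD: "finite D" using D by (simp add: orthogonal_decomposition_def)
    have WD: "W \<notin> D" using DI(2)[of W] \<open>w \<notin> C\<close> w(1) by blast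
    have o1: "?p W v = 0" if "W' \<in> D" "v \<in> W'" for W' v using DI(2) that by (auto simp: C_def)
    \<comment> \<open>Orthogonality is symmetric, so vanishing of the projection to \<open>W\<close>
      on \<open>W'\<close> passes to the projection in the other direction.\<close>
    have o2: "?p W' v = 0" if W': "W' \<in> D" and v: "v \<in> W" for W' v
    proof (rule orth_proj_orthogonal[OF assms(1) q])
      show "fs.subspace W'" "W' \<subseteq> rep_space R"
        using DI(1)[OF W'] by (auto simp: irreducible_subrep_def subrep_def)
      fix x assume "x \<in> W'"
      then have "herm q (basis R) x v = 0" using p(2)[OF v, of x] o1[OF W'] by simp
      then show "herm q (basis R) v x = 0" using herm_commute[of q _ v x] by simp
    qed
    have sum: "v = (\<Sum>X\<in>insert W D. ?p X v)" if v: "v \<in> U" for v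
    proof -
      let ?c = "v - ?p W v"
      have "?c \<in> U" using v p(1)[of v] W(2) subrepD(1)[OF less.prems] by (intro fs.subspace_diff) auto
      moreover have "?p W ?c = 0" using lin_diff[OF p(3)] p(4)[OF p(1)] by simp
      ultimately have "?c \<in> C" by (simp add: C_def)
      then have c: "?c = (\<Sum>X\<in>D. ?p X ?c)" using D by (simp add: orthogonal_decomposition_def)
      have "?p X ?c = ?p X v" if "X \<in> D" for X
      proof -
        have "lin (?p X)" using DI(1)[OF that] unfolding irreducible_subrep_def subrep_def
          by (intro lin_orth_proj[OF assms(1) q]) auto
        then show ?thesis using lin_diff[of "?p X"] o2[OF that p(1)] by simp
      qed
      then have "?c = (\<Sum>X\<in>D. ?p X v)" using c by simp
      then show ?thesis using finD WD by (simp add: algebra_simps)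
    qed
    have "orthogonal_decomposition n R q U (insert W D)"
      unfolding orthogonal_decomposition_def
    proof (intro conjI ballI impI)
      show "finite (insert W D)" using finD by simp
      show "irreducible_subrep n R X" "X \<subseteq> U" if "X \<in> insert W D" for X
        using that W DI by (auto simp: C_def)
      show "?p X' v = 0" if "X \<in> insert W D" "X' \<in> insert W D" "X \<noteq> X'" "v \<in> X" for X X' v
      proof (cases "X = W")
        case True
        then show ?thesis using that o2 by auto
      next
        case False
        then have X: "X \<in> D" using that by simp
        show ?thesis
        proof (cases "X' = W")
          case True
          then show ?thesis using o1[OF X] that by simp
        next
          case False
          then have "X' \<in> D" using that by simp
          then show ?thesis using D X that unfolding orthogonal_decomposition_def by simp
        qed
      qed
      show "v = (\<Sum>X\<in>insert W D. ?p X v)" if "v \<in> U" for v using sum that .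
    qed
    then show ?thesis by blast
  qed
qed

section \<open>Polynomial functions and weight spaces\<close>

abbreviation mat_mon :: "complex mat \<Rightarrow> (nat \<times> nat) multiset \<Rightarrow> complex" where
  "mat_mon g \<equiv> mon (\<lambda>p. g $$ p)"

definition mat_mon_expansion :: "nat \<Rightarrow> (nat \<times> nat) multiset set \<Rightarrow> ((nat \<times> nat) multiset \<Rightarrow> complex) \<Rightarrow>
    (complex mat \<Rightarrow> complex) \<Rightarrow> bool" where
  "mat_mon_expansion n F c p \<longleftrightarrow> finite F \<and> (\<forall>M\<in>F. set_mset M \<subseteq> {..<n} \<times> {..<n}) \<and>
     p = (\<lambda>g. \<Sum>M\<in>F. c M * mat_mon g M)"

lemma entry_polynomial_expand:
  assumes "p \<in> entry_polynomials n"
  shows "\<exists>F c. mat_mon_expansion n F c p"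
  using assms
proof induction
  case (const c)
  show ?case by (rule exI[of _ "{{#}}"], rule exI[of _ "\<lambda>_. c"]) (simp add: mat_mon_expansion_def)
next
  case (coord i j)
  then show ?case by (intro exI[of _ "{{#(i,j)#}}"] exI[of _ "\<lambda>_. 1"]) (simp add: mat_mon_expansion_def)
next
  case (add p q)
  obtain F c where "mat_mon_expansion n F c p" using add.IH(1) by blast
  then have F: "finite F" "\<forall>M\<in>F. set_mset M \<subseteq> {..<n} \<times> {..<n}" "\<And>g. p g = (\<Sum>M\<in>F. c M * mat_mon g M)"
    by (simp_all add: mat_mon_expansion_def)
  obtain G d where "mat_mon_expansion n G d q" using add.IH(2) by blast
  then have G: "finite G" "\<forall>M\<in>G. set_mset M \<subseteq> {..<n} \<times> {..<n}" "\<And>g. q g = (\<Sum>M\<in>G. d M * mat_mon g M)"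
    by (simp_all add: mat_mon_expansion_def)
  have "(\<Sum>M\<in>F \<union> G. ((if M \<in> F then c M else 0) + (if M \<in> G then d M else 0)) * mat_mon g M) = p g + q g" for g
  proof -
    have "(\<Sum>M\<in>F \<union> G. ((if M \<in> F then c M else 0) + (if M \<in> G then d M else 0)) * mat_mon g M) =
      (\<Sum>M\<in>F \<union> G. if M \<in> F then c M * mat_mon g M else 0) + (\<Sum>M\<in>F \<union> G. if M \<in> G then d M * mat_mon g M else 0)"
      unfolding sum.distrib[symmetric] by (intro sum.cong) (auto simp: algebra_simps)
    then show ?thesis using F G by (simp add: sum.inter_restrict[symmetric] Int_absorb1)
  qed
  then have "mat_mon_expansion n (F \<union> G) (\<lambda>M. (if M \<in> F then c M else 0) + (if M \<in> G then d M else 0)) (\<lambda>g. p g + q g)"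
    using F(1,2) G(1,2) by (auto simp: mat_mon_expansion_def)
  then show ?case by (intro exI)
next
  case (mult p q)
  obtain F c where "mat_mon_expansion n F c p" using mult.IH(1) by blast
  then have F: "finite F" "\<forall>M\<in>F. set_mset M \<subseteq> {..<n} \<times> {..<n}" "\<And>g. p g = (\<Sum>M\<in>F. c M * mat_mon g M)"
    by (simp_all add: mat_mon_expansion_def)
  obtain G d where "mat_mon_expansion n G d q" using mult.IH(2) by blast
  then have G: "finite G" "\<forall>M\<in>G. set_mset M \<subseteq> {..<n} \<times> {..<n}" "\<And>g. q g = (\<Sum>M\<in>G. d M * mat_mon g M)"
    by (simp_all add: mat_mon_expansion_def)
  define H where "H = (\<lambda>(A,B). A + B) ` (F \<times> G)"
  define e where "e = (\<lambda>M. \<Sum>(A,B)\<in>{x \<in> F \<times> G. (\<lambda>(A,B). A + B) x = M}. c A * d B)"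
  have "p g * q g = (\<Sum>M\<in>H. e M * mat_mon g M)" for g
  proof -
    have "p g * q g = (\<Sum>(A,B)\<in>F \<times> G. c A * d B * mat_mon g (A + B))"
      by (simp add: F(3) G(3) sum_product sum.cartesian_product ac_simps)
    also have "\<dots> = (\<Sum>M\<in>H. \<Sum>x\<in>{x \<in> F \<times> G. (\<lambda>(A,B). A + B) x = M}. (case x of (A,B) \<Rightarrow> c A * d B * mat_mon g (A + B)))"
      using F(1) G(1) by (intro sum.group[symmetric]) (auto simp: H_def)
    also have "\<dots> = (\<Sum>M\<in>H. e M * mat_mon g M)"
      unfolding e_def sum_distrib_right by (intro sum.cong refl) auto
    finally show ?thesis .
  qed
  moreover have "finite H" "\<forall>M\<in>H. set_mset M \<subseteq> {..<n} \<times> {..<n}" using F(1,2) G(1,2) by (auto simp: H_def)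
  ultimately have "mat_mon_expansion n H e (\<lambda>g. p g * q g)" by (simp add: mat_mon_expansion_def)
  then show ?case by (intro exI)
qed

text \<open>One finite set of monomials serves all matrix entries, with missing coefficients set to
  zero, so whole vectors can be expanded at once.\<close>

lemma polynomial_rep_expand:
  assumes "polynomial_rep n R"
  obtains F c where "finite F" "\<forall>M\<in>F. set_mset M \<subseteq> {..<n} \<times> {..<n}"
    "\<forall>i\<in>basis R. \<forall>j\<in>basis R. \<forall>g\<in>GL n. entry R g i j = (\<Sum>M\<in>F. c i j M * mat_mon g M)"
proof -
  define P where "P = (\<lambda>x F c. finite F \<and> (\<forall>M\<in>F. set_mset M \<subseteq> {..<n} \<times> {..<n}) \<and>
    (\<forall>g\<in>GL n. entry R g (fst x) (snd x) = (\<Sum>M\<in>F. c M * mat_mon g M)))"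
  have fin: "finite (basis R)" using assms by (simp add: polynomial_rep_def is_rep_def)
  have "\<exists>F c. P x F c" if "x \<in> basis R \<times> basis R" for x
  proof -
    have "fst x \<in> basis R" "snd x \<in> basis R" using that by auto
    then obtain p where p: "p \<in> entry_polynomials n" "\<forall>g\<in>GL n. entry R g (fst x) (snd x) = p g"
      using assms unfolding polynomial_rep_def by blast
    obtain F c where "mat_mon_expansion n F c p" using entry_polynomial_expand[OF p(1)] by blast
    then have "P x F c" using p(2) by (simp add: mat_mon_expansion_def P_def)
    then show ?thesis by (intro exI)
  qed
  then obtain F c where "\<And>x. x \<in> basis R \<times> basis R \<Longrightarrow> P x (F x) (c x)" by metis
  then have Fc: "finite (F x)" "\<forall>M\<in>F x. set_mset M \<subseteq> {..<n} \<times> {..<n}"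
    "\<forall>g\<in>GL n. entry R g (fst x) (snd x) = (\<Sum>M\<in>F x. c x M * mat_mon g M)" if "x \<in> basis R \<times> basis R" for x
    using that unfolding P_def by blast+
  define G where "G = (\<Union>x\<in>basis R \<times> basis R. F x)"
  have finG: "finite G" unfolding G_def using fin Fc(1) by blast
  have "entry R g i j = (\<Sum>M\<in>G. (if M \<in> F (i,j) then c (i,j) M else 0) * mat_mon g M)"
    if ij: "i \<in> basis R" "j \<in> basis R" and g: "g \<in> GL n" for i j g
  proof -
    have sub: "F (i,j) \<subseteq> G" using ij by (auto simp: G_def)
    have "(\<Sum>M\<in>G. (if M \<in> F (i,j) then c (i,j) M else 0) * mat_mon g M) =
      (\<Sum>M\<in>G. if M \<in> F (i,j) then c (i,j) M * mat_mon g M else 0)" by (intro sum.cong) auto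
    also have "\<dots> = (\<Sum>M\<in>F (i,j). c (i,j) M * mat_mon g M)"
      using finG sub by (simp add: sum.inter_restrict[symmetric] Int_absorb1)
    finally show ?thesis using Fc(3)[of "(i,j)"] ij g by simp
  qed
  moreover have "\<forall>M\<in>G. set_mset M \<subseteq> {..<n} \<times> {..<n}" unfolding G_def using Fc(2) by blast
  ultimately show ?thesis using finG
    by (intro that[of G "\<lambda>i j M. if M \<in> F (i,j) then c (i,j) M else 0"]) auto
qed

lemma GL_det: 
  assumes "g \<in> carrier_mat n n" "det g \<noteq> 0" shows "g \<in> GL n"
proof -
  have "g \<in> Units (ring_mat TYPE(complex) n ())" using det_non_zero_imp_unit[OF assms] .
  then obtain h where "h \<in> carrier_mat n n" "h * g = 1\<^sub>m n" "g * h = 1\<^sub>m n"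
    by (auto simp: Units_def ring_mat_def)
  then show ?thesis using GL_I[OF assms(1)] by blast
qed

text \<open>The relation is given on invertible matrices, while \<open>mon_independent\<close>
  evaluates at arrays \<open>y\<close> that may be singular. Along the line of matrices
  \<open>y + t\<close> times the identity, the relation is a polynomial in \<open>t\<close> that
  vanishes unless \<open>- t\<close> is an eigenvalue; hence it vanishes identically, in particular
  at 0.\<close>

lemma mat_mon_independent:
  assumes "finite F" "\<And>M. M \<in> F \<Longrightarrow> set_mset M \<subseteq> {..<n} \<times> {..<n}"
    and "\<And>g. g \<in> GL n \<Longrightarrow> (\<Sum>M\<in>F. c M * mat_mon g M) = 0" and "M \<in> F"
  shows "c M = 0"
proof (rule mon_independent[OF assms(1) _ assms(4), of c])
  fix y :: "nat \<times> nat \<Rightarrow> complex"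
  define q where "q = (\<Sum>M\<in>F. smult (c M) (prod_mset (image_mset (\<lambda>p. [:y p, if fst p = snd p then 1 else 0:]) M)))"
  define A where "A = mat n n y"
  define B where "B = (\<lambda>t. mat n n (\<lambda>p. y p + (if fst p = snd p then t else 0)))"
  have q: "poly q t = (\<Sum>M\<in>F. c M * mon (\<lambda>p. y p + (if fst p = snd p then t else 0)) M)" for t
  proof -
    have "poly (prod_mset (image_mset (\<lambda>p. [:y p, if fst p = snd p then 1 else 0:]) M)) t =
      mon (\<lambda>p. y p + (if fst p = snd p then t else 0)) M" for M
      by (induction M) (auto simp: mon_def algebra_simps)
    then show ?thesis by (simp add: q_def poly_sum)
  qed
  have zero: "poly q t = 0" if t: "poly (char_poly A) (- t) \<noteq> 0" for t
  proof -
    have Ac: "A \<in> carrier_mat n n" "B t \<in> carrier_mat n n" by (auto simp: A_def B_def)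
    have "det (B t) \<noteq> 0"
    proof
      assume "det (B t) = 0"
      then obtain v where v: "v \<in> carrier_vec n" "v \<noteq> 0\<^sub>v n" "B t *\<^sub>v v = 0\<^sub>v n"
        using det_0_iff_vec_prod_zero_field[OF Ac(2)] by blast
      \<comment> \<open>A kernel vector of the shifted matrix is an eigenvector of \<open>A\<close>
        for \<open>- t\<close>, which the choice of \<open>t\<close> excludes.\<close>
      have "A *\<^sub>v v = (- t) \<cdot>\<^sub>v v"
      proof (rule eq_vecI)
        fix i assume "i < dim_vec ((- t) \<cdot>\<^sub>v v)"
        then have i: "i < n" using v by simp
        have "0 = (B t *\<^sub>v v) $ i" using v i by simp
        also have "\<dots> = (\<Sum>j = 0..<n. y (i,j) * v $ j + (if i = j then t * v $ j else 0))"
          using i v(1) by (auto simp: B_def scalar_prod_def distrib_right intro!: sum.cong)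
        also have "\<dots> = (A *\<^sub>v v) $ i + t * v $ i"
          using i v(1) by (simp add: sum.distrib A_def scalar_prod_def)
        finally show "(A *\<^sub>v v) $ i = ((- t) \<cdot>\<^sub>v v) $ i" using i v(1) by (simp add: add_eq_0_iff2)
      qed (use v Ac in auto)
      then have "eigenvalue A (- t)" using v Ac unfolding eigenvalue_def eigenvector_def by auto
      then show False using t eigenvalue_root_char_poly[OF Ac(1)] by blast
    qed
    then have "B t \<in> GL n" using GL_det Ac by blast
    from assms(3)[OF this] have "(\<Sum>M\<in>F. c M * mat_mon (B t) M) = 0" .
    moreover have "mat_mon (B t) M = mon (\<lambda>p. y p + (if fst p = snd p then t else 0)) M" if "M \<in> F" for M
      using assms(2)[OF that] by (intro mon_cong) (auto simp: B_def)
    ultimately show ?thesis unfolding q by simp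
  qed
  have "q = 0"
  proof (rule ccontr)
    assume "q \<noteq> 0"
    then have fin: "finite {t. poly q t = 0}" by (rule poly_roots_finite)
    have "monic (char_poly A)" using degree_monic_char_poly[of A n] by (simp add: A_def)
    then have "char_poly A \<noteq> 0" by auto
    then have "finite (uminus ` {t. poly (char_poly A) t = 0})" by (intro finite_imageI poly_roots_finite)
    then have "finite ({t. poly q t = 0} \<union> uminus ` {t. poly (char_poly A) t = 0})" using fin by simp
    moreover have "UNIV \<subseteq> {t. poly q t = 0} \<union> uminus ` {t. poly (char_poly A) t = 0}"
    proof
      fix t show "t \<in> {t. poly q t = 0} \<union> uminus ` {t. poly (char_poly A) t = 0}"
        using zero[of t] by (cases "poly (char_poly A) (- t) = 0") (auto simp: image_iff intro!: exI[of _ "- t"])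
    qed
    ultimately have "finite (UNIV :: complex set)" by (rule finite_subset[rotated])
    then show False using infinite_UNIV_char_0 by blast
  qed
  then show "(\<Sum>M\<in>F. c M * mon y M) = 0" using q[of 0] by simp
qed

section \<open>Torus action, weight spaces and characters\<close>

lemma mat_mon_diag:
  assumes "set_mset M \<subseteq> {..<n} \<times> {..<n}"
  shows "mat_mon (mat_diag n x) M = (if \<forall>p\<in>#M. fst p = snd p then mon x (image_mset fst M) else 0)"
  using assms by (induction M) (auto simp: mat_diag_def)

lemma torus_expansion:
  assumes "polynomial_rep n R"
  obtains W e where "finite W" "\<forall>N\<in>W. set_mset N \<subseteq> {..<n}"
    "\<forall>x. (\<forall>i. x i \<noteq> 0) \<longrightarrow> (\<forall>i\<in>basis R. \<forall>j\<in>basis R.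
      entry R (mat_diag n x) i j = (\<Sum>N\<in>W. e i j N * mon x N))"
proof -
  obtain F c where F0: "finite F" "\<forall>M\<in>F. set_mset M \<subseteq> {..<n} \<times> {..<n}"
    "\<forall>i\<in>basis R. \<forall>j\<in>basis R. \<forall>g\<in>GL n. entry R g i j = (\<Sum>M\<in>F. c i j M * mat_mon g M)"
    using polynomial_rep_expand[OF assms] .
  have F: "finite F" "\<And>M. M \<in> F \<Longrightarrow> set_mset M \<subseteq> {..<n} \<times> {..<n}"
    "\<And>i j g. i \<in> basis R \<Longrightarrow> j \<in> basis R \<Longrightarrow> g \<in> GL n \<Longrightarrow> entry R g i j = (\<Sum>M\<in>F. c i j M * mat_mon g M)"
    using F0 by auto
  define D where "D = {M \<in> F. \<forall>p\<in>#M. fst p = snd p}"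
  define W where "W = image_mset fst ` D"
  define e where "e = (\<lambda>i j N. \<Sum>M\<in>{M \<in> D. image_mset fst M = N}. c i j M)"
  have "entry R (mat_diag n x) i j = (\<Sum>N\<in>W. e i j N * mon x N)"
    if x: "\<forall>i. x i \<noteq> 0" and ij: "i \<in> basis R" "j \<in> basis R" for x i j
  proof -
    have "entry R (mat_diag n x) i j = (\<Sum>M\<in>F. c i j M * mat_mon (mat_diag n x) M)"
      using F(3)[OF ij GL_diag] x by blast
    also have "\<dots> = (\<Sum>M\<in>F. if \<forall>p\<in>#M. fst p = snd p then c i j M * mon x (image_mset fst M) else 0)"
      using F(2) by (intro sum.cong refl) (simp add: mat_mon_diag)
    also have "\<dots> = (\<Sum>M\<in>D. c i j M * mon x (image_mset fst M))"
      using F(1) by (simp add: D_def sum.inter_filter)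
    also have "\<dots> = (\<Sum>N\<in>W. \<Sum>M\<in>{M \<in> D. image_mset fst M = N}. c i j M * mon x (image_mset fst M))"
      using F(1) by (intro sum.group[symmetric]) (auto simp: W_def D_def)
    also have "\<dots> = (\<Sum>N\<in>W. e i j N * mon x N)"
      unfolding e_def sum_distrib_right by (intro sum.cong refl) auto
    finally show ?thesis .
  qed
  moreover have "finite W" using F(1) by (simp add: W_def D_def)
  moreover have "\<forall>N\<in>W. set_mset N \<subseteq> {..<n}"
  proof
    fix N assume "N \<in> W"
    then obtain M where M: "M \<in> F" "N = image_mset fst M" by (auto simp: W_def D_def)
    show "set_mset N \<subseteq> {..<n}" using F(2)[OF M(1)] M(2) by force
  qed
  ultimately show ?thesis by (intro that[of W e]) auto
qed

text \<open>The torus element depends on \<open>x i\<close> for \<open>i < n\<close> only, whereas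
  \<open>mon x N\<close> sees every index in \<open>N\<close>; a multiset with an index outside
  \<open>{..<n}\<close> therefore has the zero weight space.\<close>

definition weight_space :: "nat \<Rightarrow> 'i gl_rep \<Rightarrow> nat multiset \<Rightarrow> ('i \<Rightarrow> complex) set" where
  "weight_space n R N = {v \<in> rep_space R. \<forall>x. (\<forall>i. x i \<noteq> 0) \<longrightarrow>
     rep_act R (mat_diag n x) v = fun_scale (mon x N) v}"

lemma subspace_weight_space: "fs.subspace (weight_space n R N)"
  by (rule fs.subspaceI)
    (auto simp: weight_space_def lin_add[OF lin_rep_act] lin_scale[OF lin_rep_act] lin_0[OF lin_rep_act]
      fs.subspace_0[OF subspace_rep_space] fs.subspace_add[OF subspace_rep_space]
      fs.subspace_scale[OF subspace_rep_space] fs.scale_right_distrib mult.commute)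

lemma weight_spaceD:
  "v \<in> weight_space n R N \<Longrightarrow> v \<in> rep_space R"
  "v \<in> weight_space n R N \<Longrightarrow> \<forall>i. x i \<noteq> 0 \<Longrightarrow> rep_act R (mat_diag n x) v = fun_scale (mon x N) v"
  by (auto simp: weight_space_def)

text \<open>\<open>E N\<close> is the coefficient of the monomial of \<open>N\<close> in the action
  of the torus. The last clause makes the \<open>E N\<close> projections that separate the
  weights.\<close>

definition weight_projections where
  "weight_projections n R W E \<longleftrightarrow> finite W \<and> (\<forall>N\<in>W. set_mset N \<subseteq> {..<n} \<and> lin (E N)) \<and>
    (\<forall>N\<in>W. \<forall>v\<in>rep_space R. E N v \<in> weight_space n R N) \<and>
    (\<forall>v\<in>rep_space R. v = (\<Sum>N\<in>W. E N v)) \<and>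
    (\<forall>x v. (\<forall>i. x i \<noteq> 0) \<longrightarrow> rep_act R (mat_diag n x) v = (\<Sum>N\<in>W. fun_scale (mon x N) (E N v))) \<and>
    (\<forall>M. \<forall>v\<in>weight_space n R M. \<forall>N\<in>W. E N v = (if N = M then v else 0))"

lemma mon_fun_independent:
  assumes "finite F" "\<And>y. (\<forall>p. y p \<noteq> 0) \<Longrightarrow> (\<Sum>M\<in>F. fun_scale (mon y M) (c M)) = 0" "M \<in> F"
  shows "c M = 0"
proof
  fix i
  have "(\<Sum>M\<in>F. c M i * mon y M) = 0" if "\<forall>p. y p \<noteq> 0" for y
    using fun_cong[OF assms(2)[OF that], of i] by (simp add: fun_scale_apply mult.commute)
  from mon_independent[OF assms(1) this assms(3)] show "c M i = 0 i" by simp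
qed

text \<open>The action of \<open>x\<close> after \<open>y\<close> is the action of the product;
  comparing coefficients of monomials in \<open>y\<close> shows that \<open>E M v\<close> has weight
  \<open>M\<close>. At \<open>x = 1\<close> the expansion says that the \<open>E N\<close> sum to
  the identity.\<close>

lemma weight_projections_exist:
  assumes "polynomial_rep n R"
  shows "\<exists>W E. weight_projections n R W E"
proof -
  have rep: "is_rep n R" using assms by (simp add: polynomial_rep_def)
  obtain W e where W0: "finite W" "\<forall>N\<in>W. set_mset N \<subseteq> {..<n}"
    "\<forall>x. (\<forall>i. x i \<noteq> 0) \<longrightarrow> (\<forall>i\<in>basis R. \<forall>j\<in>basis R. entry R (mat_diag n x) i j = (\<Sum>N\<in>W. e i j N * mon x N))"
    using torus_expansion[OF assms] .
  have W: "finite W" "\<forall>N\<in>W. set_mset N \<subseteq> {..<n}"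
    "\<And>x i j. \<forall>i. x i \<noteq> 0 \<Longrightarrow> i \<in> basis R \<Longrightarrow> j \<in> basis R \<Longrightarrow> entry R (mat_diag n x) i j = (\<Sum>N\<in>W. e i j N * mon x N)"
    using W0 by auto
  define E where "E = (\<lambda>N v i. if i \<in> basis R then \<Sum>j\<in>basis R. e i j N * v j else 0)"
  have lE: "lin (E N)" for N
    by (rule linI) (auto simp: E_def fun_eq_iff fun_scale_apply sum.distrib sum_distrib_left algebra_simps)
  have ER: "E N v \<in> rep_space R" for N v by (auto simp: E_def rep_space_def)
  have act: "rep_act R (mat_diag n x) v = (\<Sum>N\<in>W. fun_scale (mon x N) (E N v))" if x: "\<forall>i. x i \<noteq> 0" for x v
  proof
    fix i
    show "rep_act R (mat_diag n x) v i = (\<Sum>N\<in>W. fun_scale (mon x N) (E N v)) i"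
    proof (cases "i \<in> basis R")
      case True
      have "rep_act R (mat_diag n x) v i = (\<Sum>j\<in>basis R. \<Sum>N\<in>W. mon x N * (e i j N * v j))"
        using True W(3)[OF x True] by (simp add: rep_act_def sum_distrib_right sum_distrib_left ac_simps)
      also have "\<dots> = (\<Sum>N\<in>W. \<Sum>j\<in>basis R. mon x N * (e i j N * v j))" by (rule sum.swap)
      finally show ?thesis using True by (simp add: E_def fun_scale_apply sum_distrib_left)
    qed (simp add: rep_act_def E_def fun_scale_apply)
  qed
  have sumE: "v = (\<Sum>N\<in>W. E N v)" if "v \<in> rep_space R" for v
    using act[of "\<lambda>i. 1" v] rep_act_one[OF rep that] by simp
  have EW: "E M v \<in> weight_space n R M" if v: "v \<in> rep_space R" and M: "M \<in> W" for M v
  proof -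
    have "rep_act R (mat_diag n x) (E M v) = fun_scale (mon x M) (E M v)" if x: "\<forall>i. x i \<noteq> 0" for x
    proof -
      have "(\<Sum>N\<in>W. fun_scale (mon y N) (rep_act R (mat_diag n x) (E N v) - fun_scale (mon x N) (E N v))) = 0"
        if y: "\<forall>i. y i \<noteq> 0" for y
      proof -
        have "rep_act R (mat_diag n x) (rep_act R (mat_diag n y) v) = rep_act R (mat_diag n (\<lambda>i. x i * y i)) v"
          using rep_act_mult[OF rep GL_diag GL_diag] x y by (metis mat_diag_diag)
        moreover have "\<forall>i. x i * y i \<noteq> 0" using x y by simp
        ultimately have "(\<Sum>N\<in>W. fun_scale (mon y N) (rep_act R (mat_diag n x) (E N v))) =
            (\<Sum>N\<in>W. fun_scale (mon x N * mon y N) (E N v))"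
          using act[of y v] act[of "\<lambda>i. x i * y i" v] y
          by (simp add: lin_sum[OF lin_rep_act] lin_scale[OF lin_rep_act] mon_mult)
        then show ?thesis by (simp add: fs.scale_right_diff_distrib sum_subtractf mult.commute)
      qed
      from mon_fun_independent[OF W(1) this M] show ?thesis by simp
    qed
    then show ?thesis using ER by (simp add: weight_space_def)
  qed
  have "E N v = (if N = M then v else 0)" if v: "v \<in> weight_space n R M" and N: "N \<in> W" for M N v
  proof -
    have vR: "v \<in> rep_space R" using v by (simp add: weight_space_def)
    \<comment> \<open>A weight vector has two expansions of its torus action: by the
      \<open>E K\<close>, and as a single monomial. This is their difference, indexed so as to allow
      for \<open>M\<close> outside \<open>W\<close>.\<close>
    let ?c = "\<lambda>K. (if K \<in> W then E K v else 0) - (if K = M then v else 0)"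
    have "(\<Sum>K\<in>insert M W. fun_scale (mon x K) (?c K)) = 0" if x: "\<forall>i. x i \<noteq> 0" for x
    proof -
      have "(\<Sum>K\<in>insert M W. fun_scale (mon x K) (?c K)) =
        (\<Sum>K\<in>insert M W. (if K \<in> W then fun_scale (mon x K) (E K v) else 0)) -
        (\<Sum>K\<in>insert M W. (if K = M then fun_scale (mon x M) v else 0))"
        unfolding sum_subtractf[symmetric]
        by (intro sum.cong refl) (auto simp: fs.scale_right_diff_distrib)
      also have "(\<Sum>K\<in>insert M W. (if K \<in> W then fun_scale (mon x K) (E K v) else 0)) =
          (\<Sum>K\<in>W. fun_scale (mon x K) (E K v))"
        using W(1) by (intro sum.mono_neutral_cong_right) auto
      also have "(\<Sum>K\<in>insert M W. (if K = M then fun_scale (mon x M) v else 0)) = fun_scale (mon x M) v"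
        using W(1) by simp
      also have "(\<Sum>K\<in>W. fun_scale (mon x K) (E K v)) = fun_scale (mon x M) v"
        using act[OF x, of v] weight_spaceD(2)[OF v x] by simp
      finally show ?thesis by (simp only: diff_self)
    qed
    then have "?c N = 0" using N W(1) by (intro mon_fun_independent[of "insert M W" ?c]) auto
    then show ?thesis using N by simp
  qed
  then have "weight_projections n R W E"
    unfolding weight_projections_def using W(1,2) lE EW sumE act by blast
  then show ?thesis by blast
qed

text \<open>Factor \<open>P\<close> through a basis \<open>b\<close> of its image, with coefficients
  \<open>a\<close>. The trace is that of the product of the two rectangular matrices; in the
  opposite order their product is the identity of size \<open>fs.dim X\<close>, because
  \<open>P\<close> fixes each \<open>b l\<close>.\<close>

lemma trace_projection:
  assumes "finite (basis R)" "fs.subspace X" "X \<subseteq> rep_space R" "lin P"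
    "\<And>v. v \<in> rep_space R \<Longrightarrow> P v \<in> X" "\<And>v. v \<in> X \<Longrightarrow> P v = v"
  shows "(\<Sum>i\<in>basis R. P (unit_fun i) i) = of_nat (fs.dim X)"
proof -
  let ?d = "fs.dim X"
  obtain b where bf: "basis_family X b" using basis_family_exists[OF assms(1-3)] by blast
  note b = basis_familyD[OF bf]
  have "\<exists>c. P (unit_fun i) = (\<Sum>j<?d. fun_scale (c j) (b j))" if "i \<in> basis R" for i
    using b(2) assms(5) unit_fun_in[OF that] by blast
  then obtain a where a: "\<And>i. i \<in> basis R \<Longrightarrow> P (unit_fun i) = (\<Sum>j<?d. fun_scale (a i j) (b j))" by metis
  have tr: "(\<Sum>i\<in>basis R. b l i * a i l) = 1" if l: "l < ?d" for l
  proof -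
    have bR: "b l \<in> rep_space R" using b(1)[OF l] assms(3) by blast
    have "b l = P (b l)" using assms(6) b(1)[OF l] by simp
    also have "\<dots> = P (\<Sum>i\<in>basis R. fun_scale (b l i) (unit_fun i))"
      using rep_space_expand[OF assms(1) bR] by simp
    also have "\<dots> = (\<Sum>i\<in>basis R. fun_scale (b l i) (P (unit_fun i)))"
      by (simp add: lin_sum[OF assms(4)] lin_scale[OF assms(4)])
    also have "\<dots> = (\<Sum>i\<in>basis R. \<Sum>j<?d. fun_scale (b l i * a i j) (b j))"
      by (intro sum.cong refl) (simp add: a fs.scale_sum_right)
    also have "\<dots> = (\<Sum>j<?d. fun_scale (\<Sum>i\<in>basis R. b l i * a i j) (b j))"
      by (subst sum.swap) (simp add: fs.scale_sum_left)
    finally have e: "b l = (\<Sum>j<?d. fun_scale (\<Sum>i\<in>basis R. b l i * a i j) (b j))" .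
    have "(\<Sum>j<?d. fun_scale ((\<Sum>i\<in>basis R. b l i * a i j) - (if j = l then 1 else 0)) (b j)) =
      (\<Sum>j<?d. fun_scale (\<Sum>i\<in>basis R. b l i * a i j) (b j)) - (\<Sum>j<?d. if j = l then b l else 0)"
      unfolding sum_subtractf[symmetric] by (intro sum.cong refl) (auto simp: fs.scale_left_diff_distrib)
    also have "\<dots> = 0" using e l by simp
    finally have "\<forall>j<?d. (\<Sum>i\<in>basis R. b l i * a i j) - (if j = l then 1 else 0) = 0"
      by (rule b(3))
    then have "(\<Sum>i\<in>basis R. b l i * a i l) - (if l = l then 1 else 0) = 0" using l by blast
    then show ?thesis by simp
  qed
  have "(\<Sum>i\<in>basis R. P (unit_fun i) i) = (\<Sum>i\<in>basis R. \<Sum>j<?d. b j i * a i j)"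
    by (intro sum.cong refl) (simp add: a fun_scale_apply mult.commute)
  also have "\<dots> = (\<Sum>j<?d. \<Sum>i\<in>basis R. b j i * a i j)" by (rule sum.swap)
  also have "\<dots> = of_nat ?d" using tr by simp
  finally show ?thesis .
qed

lemma nonzero_vector: "(0::'a::zero) \<in> X \<Longrightarrow> X \<noteq> {0} \<Longrightarrow> \<exists>v\<in>X. v \<noteq> 0"
  by blast

lemma character_eq_weight_dims:
  assumes "polynomial_rep n R"
  shows "\<exists>W. finite W \<and> (\<forall>N. weight_space n R N \<noteq> {0} \<longrightarrow> N \<in> W) \<and> (\<forall>N\<in>W. set_mset N \<subseteq> {..<n}) \<and>
    (\<forall>x. (\<forall>i. x i \<noteq> 0) \<longrightarrow> rep_character n R x = (\<Sum>N\<in>W. of_nat (fs.dim (weight_space n R N)) * mon x N))"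
proof -
  have fin: "finite (basis R)" using assms by (simp add: polynomial_rep_def is_rep_def)
  obtain W E where "weight_projections n R W E" using weight_projections_exist[OF assms] by blast
  then have WE: "finite W" "\<And>N. N \<in> W \<Longrightarrow> set_mset N \<subseteq> {..<n}" "\<And>N. N \<in> W \<Longrightarrow> lin (E N)"
    "\<And>N v. N \<in> W \<Longrightarrow> v \<in> rep_space R \<Longrightarrow> E N v \<in> weight_space n R N"
    "\<And>v. v \<in> rep_space R \<Longrightarrow> v = (\<Sum>N\<in>W. E N v)"
    "\<And>x v. \<forall>i. x i \<noteq> 0 \<Longrightarrow> rep_act R (mat_diag n x) v = (\<Sum>N\<in>W. fun_scale (mon x N) (E N v))"
    "\<And>M v N. v \<in> weight_space n R M \<Longrightarrow> N \<in> W \<Longrightarrow> E N v = (if N = M then v else 0)"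
    unfolding weight_projections_def by blast+
  have "rep_character n R x = (\<Sum>N\<in>W. of_nat (fs.dim (weight_space n R N)) * mon x N)" if x: "\<forall>i. x i \<noteq> 0" for x
  proof -
    have "rep_character n R x = (\<Sum>i\<in>basis R. rep_act R (mat_diag n x) (unit_fun i) i)"
      using fin unfolding rep_character_def
      by (intro sum.cong refl) (simp add: rep_act_def unit_fun_def if_distrib cong: if_cong)
    also have "\<dots> = (\<Sum>i\<in>basis R. \<Sum>N\<in>W. mon x N * E N (unit_fun i) i)"
      by (simp add: WE(6)[OF x] fun_scale_apply)
    also have "\<dots> = (\<Sum>N\<in>W. mon x N * (\<Sum>i\<in>basis R. E N (unit_fun i) i))"
      by (subst sum.swap) (simp add: sum_distrib_left)
    also have "\<dots> = (\<Sum>N\<in>W. mon x N * of_nat (fs.dim (weight_space n R N)))"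
    proof (intro sum.cong refl arg_cong2[of _ _ _ _ "(*)"])
      fix N assume N: "N \<in> W"
      show "(\<Sum>i\<in>basis R. E N (unit_fun i) i) = of_nat (fs.dim (weight_space n R N))"
      proof (rule trace_projection[OF fin subspace_weight_space _ WE(3)[OF N]])
        show "weight_space n R N \<subseteq> rep_space R" by (auto simp: weight_space_def)
        show "E N v \<in> weight_space n R N" if "v \<in> rep_space R" for v using WE(4)[OF N that] .
        show "E N v = v" if "v \<in> weight_space n R N" for v using WE(7)[OF that N] by simp
      qed
    qed
    finally show ?thesis by (simp add: mult.commute)
  qed
  moreover have "N \<in> W" if ne: "weight_space n R N \<noteq> {0}" for N
  proof (rule ccontr)
    assume N: "N \<notin> W"
    obtain v where v: "v \<in> weight_space n R N" "v \<noteq> 0"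
      using nonzero_vector[OF fs.subspace_0[OF subspace_weight_space] ne] by blast
    have "v = (\<Sum>M\<in>W. E M v)" using WE(5)[OF weight_spaceD(1)[OF v(1)]] .
    also have "\<dots> = 0"
    proof (rule sum.neutral, rule ballI)
      fix M assume "M \<in> W"
      then show "E M v = 0" using WE(7)[OF v(1), of M] N by (metis (full_types))
    qed
    finally show False using v(2) by simp
  qed
  ultimately show ?thesis using WE(1,2) by (intro exI[of _ W]) simp
qed

definition weight_dim :: "nat \<Rightarrow> 'i gl_rep \<Rightarrow> ('i \<Rightarrow> complex) set \<Rightarrow> nat multiset \<Rightarrow> nat" where
  "weight_dim n R U N = fs.dim (U \<inter> weight_space n R N)"

lemma dim_bij:
  assumes "finite (basis R)" "fs.subspace U" "U \<subseteq> rep_space R" "lin f" "bij_betw f U W"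
  shows "fs.dim W = fs.dim U"
proof -
  obtain b where bf: "basis_family U b" using basis_family_exists[OF assms(1-3)] by blast
  note b = basis_familyD[OF bf]
  have "fs.dim W = card {..<fs.dim U}"
  proof (rule dim_eq_card_family)
    show "f (b j) \<in> W" if "j \<in> {..<fs.dim U}" for j using b(1) that assms(5) by (auto simp: bij_betw_def)
    show "\<exists>c. v = (\<Sum>j<fs.dim U. fun_scale (c j) (f (b j)))" if "v \<in> W" for v
    proof -
      obtain u where u: "u \<in> U" "v = f u" using \<open>v \<in> W\<close> assms(5) by (auto simp: bij_betw_def)
      obtain c where "u = (\<Sum>j<fs.dim U. fun_scale (c j) (b j))" using b(2)[OF u(1)] by blast
      then have "v = (\<Sum>j<fs.dim U. fun_scale (c j) (f (b j)))"
        using u(2) by (simp add: lin_sum[OF assms(4)] lin_scale[OF assms(4)])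
      then show ?thesis by blast
    qed
    show "\<forall>j\<in>{..<fs.dim U}. c j = 0" if "(\<Sum>j<fs.dim U. fun_scale (c j) (f (b j))) = 0" for c
    proof -
      let ?u = "\<Sum>j<fs.dim U. fun_scale (c j) (b j)"
      have "f ?u = 0" using that by (simp add: lin_sum[OF assms(4)] lin_scale[OF assms(4)])
      moreover have "?u \<in> U" using b(1) assms(2) by (intro fs.subspace_sum fs.subspace_scale) auto
      moreover have "inj_on f U" using assms(5) by (simp add: bij_betw_def)
      ultimately have "?u = 0"
        using inj_onD[of f U ?u 0] fs.subspace_0[OF assms(2)] lin_0[OF assms(4)] by simp
      from b(3)[OF this] show ?thesis by simp
    qed
  qed simp
  then show ?thesis by simp
qed

lemma weight_dim_equiv:
  assumes "finite (basis R)" "subrep n R U" "subrep n S W" "rep_equiv n R U S W"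
  shows "weight_dim n S W N = weight_dim n R U N"
proof -
  obtain f where f: "rep_hom n R U S f" "bij_betw f U W" using assms(4) by (auto simp: rep_equiv_def)
  have l: "lin f" using f by (simp add: rep_hom_def)
  have inj: "inj_on f U" using f(2) by (simp add: bij_betw_def)
  have "f v \<in> W \<inter> weight_space n S N \<longleftrightarrow> v \<in> weight_space n R N" if v: "v \<in> U" for v
  proof -
    have fv: "f v \<in> W" using v f(2) by (auto simp: bij_betw_def)
    have "rep_act S (mat_diag n x) (f v) = fun_scale (mon x N) (f v) \<longleftrightarrow>
      rep_act R (mat_diag n x) v = fun_scale (mon x N) v" if x: "\<forall>i. x i \<noteq> 0" for x
    proof -
      have d: "mat_diag n x \<in> GL n" using x by (intro GL_diag) simp
      have "rep_act S (mat_diag n x) (f v) = f (rep_act R (mat_diag n x) v)" using f(1) v d by (simp add: rep_hom_def)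
      moreover have "fun_scale (mon x N) (f v) = f (fun_scale (mon x N) v)" by (simp add: lin_scale[OF l])
      moreover have "rep_act R (mat_diag n x) v \<in> U" "fun_scale (mon x N) v \<in> U"
        using subrepD(3)[OF assms(2) d v] fs.subspace_scale[OF subrepD(1)[OF assms(2)] v] by auto
      ultimately show ?thesis using inj_on_eq_iff[OF inj] by simp
    qed
    then show ?thesis using fv v subrepD(2)[OF assms(2)] subrepD(2)[OF assms(3)] by (auto simp: weight_space_def)
  qed
  then have "bij_betw f (U \<inter> weight_space n R N) (W \<inter> weight_space n S N)"
    using f(2) unfolding bij_betw_def by (auto simp: inj_on_def)
  then show ?thesis unfolding weight_dim_def
    using dim_bij[OF assms(1) fs.subspace_inter[OF subrepD(1)[OF assms(2)] subspace_weight_space] _ l]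
      subrepD(2)[OF assms(2)] by blast
qed

text \<open>The projections commute with the torus and so preserve weights; bases of the weight
  spaces of the summands combine to a basis of that of \<open>U\<close>.\<close>

lemma weight_dim_decomposition:
  assumes "finite (basis R)" "star_form n R q" "subrep n R U" "orthogonal_decomposition n R q U D"
  shows "weight_dim n R U N = (\<Sum>W\<in>D. weight_dim n R W N)"
proof -
  let ?p = "orth_proj q R" and ?X = "\<lambda>W. W \<inter> weight_space n R N"
  have q: "\<forall>i\<in>basis R. q i > 0" using assms(2) by (simp add: star_form_def)
  have finD: "finite D" using assms(4) by (simp add: orthogonal_decomposition_def)
  have sD: "subrep n R W" "W \<subseteq> U" if "W \<in> D" for W
    using assms(4) that by (auto simp: orthogonal_decomposition_def irreducible_subrep_def)
  have orth: "?p W' v = 0" if "W \<in> D" "W' \<in> D" "W \<noteq> W'" "v \<in> W" for W W' v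
    using assms(4) that unfolding orthogonal_decomposition_def by blast
  have pl: "lin (?p W)" and pin: "?p W v \<in> W" and pid: "v \<in> W \<Longrightarrow> ?p W v = v" if "W \<in> D" for W v
    using lin_orth_proj[OF assms(1) q] orth_proj(1)[OF assms(1) q] orth_proj_id[OF assms(1) q]
      subrepD(1,2)[OF sD(1)[OF that]] by blast+
  have "\<exists>b. basis_family (?X W) b" if "W \<in> D" for W
    using fs.subspace_inter[OF subrepD(1)[OF sD(1)[OF that]] subspace_weight_space]
      subrepD(2)[OF sD(1)[OF that]] by (intro basis_family_exists[OF assms(1)]) auto
  then obtain b where bB: "\<And>W. W \<in> D \<Longrightarrow> basis_family (?X W) (b W)" by metis
  note b = basis_familyD[OF bB]
  let ?J = "SIGMA W:D. {..<fs.dim (?X W)}"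
  have sumJ: "(\<Sum>j\<in>?J. fun_scale (c j) (case j of (W,i) \<Rightarrow> b W i)) =
      (\<Sum>W\<in>D. \<Sum>i<fs.dim (?X W). fun_scale (c (W,i)) (b W i))" for c
    using finD by (subst sum.Sigma) (auto intro!: sum.cong)
  have "fs.dim (?X U) = card ?J"
  proof (rule dim_eq_card_family[where b = "\<lambda>(W,i). b W i"])
    show "finite ?J" using finD by auto
    show "(case j of (W,i) \<Rightarrow> b W i) \<in> ?X U" if "j \<in> ?J" for j using that b(1) sD(2) by fastforce
    show "\<exists>c. v = (\<Sum>j\<in>?J. fun_scale (c j) (case j of (W,i) \<Rightarrow> b W i))" if v: "v \<in> ?X U" for v
    proof -
      have "?p W v \<in> ?X W" if W: "W \<in> D" for W
      proof -
        have "rep_act R (mat_diag n x) (?p W v) = fun_scale (mon x N) (?p W v)" if x: "\<forall>i. x i \<noteq> 0" for x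
        proof -
          have "rep_act R (mat_diag n x) (?p W v) = ?p W (rep_act R (mat_diag n x) v)"
            using orth_proj_equivariant[OF assms(1,2) sD(1)[OF W] GL_diag] x by simp
          also have "\<dots> = ?p W (fun_scale (mon x N) v)" using v weight_spaceD(2)[of v n R N x] x by simp
          finally show ?thesis by (simp add: lin_scale[OF pl[OF W]])
        qed
        then show ?thesis using pin[OF W] subrepD(2)[OF sD(1)[OF W]] by (auto simp: weight_space_def)
      qed
      then have "\<exists>c. ?p W v = (\<Sum>j<fs.dim (?X W). fun_scale (c j) (b W j))" if "W \<in> D" for W
        using b(2) that by blast
      then obtain c where c: "\<And>W. W \<in> D \<Longrightarrow> ?p W v = (\<Sum>j<fs.dim (?X W). fun_scale (c W j) (b W j))"
        by metis
      have "v = (\<Sum>W\<in>D. ?p W v)" using assms(4) v by (auto simp: orthogonal_decomposition_def)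
      also have "\<dots> = (\<Sum>W\<in>D. \<Sum>j<fs.dim (?X W). fun_scale (c W j) (b W j))" using c by simp
      finally have "v = (\<Sum>j\<in>?J. fun_scale (case_prod c j) (case j of (W,i) \<Rightarrow> b W i))"
        unfolding sumJ by simp
      then show ?thesis by blast
    qed
    show "\<forall>j\<in>?J. c j = 0" if c: "(\<Sum>j\<in>?J. fun_scale (c j) (case j of (W,i) \<Rightarrow> b W i)) = 0" for c
    proof -
      have "\<forall>i<fs.dim (?X W). c (W,i) = 0" if W: "W \<in> D" for W
      proof (rule b(3)[OF W])
        have "0 = ?p W (\<Sum>W'\<in>D. \<Sum>i<fs.dim (?X W'). fun_scale (c (W',i)) (b W' i))"
          using c lin_0[OF pl[OF W]] unfolding sumJ by simp
        also have "\<dots> = (\<Sum>W'\<in>D. \<Sum>i<fs.dim (?X W'). fun_scale (c (W',i)) (?p W (b W' i)))"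
          by (simp add: lin_sum[OF pl[OF W]] lin_scale[OF pl[OF W]])
        also have "\<dots> = (\<Sum>W'\<in>D. if W' = W then \<Sum>i<fs.dim (?X W). fun_scale (c (W,i)) (b W i) else 0)"
        proof (intro sum.cong refl)
          fix W' assume W': "W' \<in> D"
          show "(\<Sum>i<fs.dim (?X W'). fun_scale (c (W',i)) (?p W (b W' i))) =
            (if W' = W then \<Sum>i<fs.dim (?X W). fun_scale (c (W,i)) (b W i) else 0)"
          proof (cases "W' = W")
            case True
            then show ?thesis using b(1)[OF W] pid[OF W] by auto
          next
            case False
            have "?p W (b W' i) = 0" if "i < fs.dim (?X W')" for i
              using orth[OF W' W False] b(1)[OF W' that] by blast
            then show ?thesis using False by simp
          qed
        qed
        also have "\<dots> = (\<Sum>i<fs.dim (?X W). fun_scale (c (W,i)) (b W i))" using finD W by simp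
        finally show "(\<Sum>i<fs.dim (?X W). fun_scale (c (W,i)) (b W i)) = 0" by simp
      qed
      then show ?thesis by auto
    qed
  qed
  then show ?thesis using finD by (simp add: weight_dim_def)
qed

section \<open>Tensor, symmetric and exterior powers\<close>

definition polyfun :: "nat \<Rightarrow> (complex mat \<Rightarrow> complex) \<Rightarrow> bool" where
  "polyfun n f \<longleftrightarrow> (\<exists>p\<in>entry_polynomials n. \<forall>g\<in>GL n. f g = p g)"

lemma polynomial_rep_iff:
  "polynomial_rep n R \<longleftrightarrow> is_rep n R \<and> (\<forall>i\<in>basis R. \<forall>j\<in>basis R. polyfun n (\<lambda>g. entry R g i j))"
  by (simp add: polynomial_rep_def polyfun_def)

lemma polyfun_const: "polyfun n (\<lambda>g. c)"
  unfolding polyfun_def by (rule bexI[of _ "\<lambda>g. c"]) (auto intro: entry_polynomials.const)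

lemma polyfun_coord: "i < n \<Longrightarrow> j < n \<Longrightarrow> polyfun n (\<lambda>g. g $$ (i,j))"
  unfolding polyfun_def by (rule bexI[of _ "\<lambda>g. g $$ (i,j)"]) (auto intro: entry_polynomials.coord)

lemma polyfun_add:
  assumes "polyfun n f" "polyfun n h" shows "polyfun n (\<lambda>g. f g + h g)"
proof -
  obtain p r where "p \<in> entry_polynomials n" "\<forall>g\<in>GL n. f g = p g" "r \<in> entry_polynomials n" "\<forall>g\<in>GL n. h g = r g"
    using assms unfolding polyfun_def by blast
  then show ?thesis unfolding polyfun_def
    by (intro bexI[of _ "\<lambda>g. p g + r g"] entry_polynomials.add) auto
qed

lemma polyfun_mult:
  assumes "polyfun n f" "polyfun n h" shows "polyfun n (\<lambda>g. f g * h g)"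
proof -
  obtain p r where "p \<in> entry_polynomials n" "\<forall>g\<in>GL n. f g = p g" "r \<in> entry_polynomials n" "\<forall>g\<in>GL n. h g = r g"
    using assms unfolding polyfun_def by blast
  then show ?thesis unfolding polyfun_def
    by (intro bexI[of _ "\<lambda>g. p g * r g"] entry_polynomials.mult) auto
qed

lemma polyfun_diff: "polyfun n f \<Longrightarrow> polyfun n h \<Longrightarrow> polyfun n (\<lambda>g. f g - h g)"
  using polyfun_add[of n f "\<lambda>g. - 1 * h g"] polyfun_mult[OF polyfun_const[of n "-1"], of h] by simp

lemma polyfun_sum: "(\<And>i. i \<in> A \<Longrightarrow> polyfun n (f i)) \<Longrightarrow> polyfun n (\<lambda>g. \<Sum>i\<in>A. f i g)"
  by (induction A rule: infinite_finite_induct) (auto intro: polyfun_const polyfun_add)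

lemma polyfun_prod: "(\<And>i. i \<in> A \<Longrightarrow> polyfun n (f i)) \<Longrightarrow> polyfun n (\<lambda>g. \<Prod>i\<in>A. f i g)"
  by (induction A rule: infinite_finite_induct) (auto intro: polyfun_const polyfun_mult)

definition torus_weights :: "nat \<Rightarrow> 'i gl_rep \<Rightarrow> ('i \<Rightarrow> nat multiset) \<Rightarrow> bool" where
  "torus_weights n R wt \<longleftrightarrow> (\<forall>x. \<forall>i\<in>basis R. \<forall>j\<in>basis R.
     entry R (mat_diag n x) i j = (if i = j then mon x (wt i) else 0))"

lemma is_repD:
  assumes "is_rep n R"
  shows "finite (basis R)"
    "i \<in> basis R \<Longrightarrow> j \<in> basis R \<Longrightarrow> entry R (1\<^sub>m n) i j = (if i = j then 1 else 0)"
    "g \<in> GL n \<Longrightarrow> h \<in> GL n \<Longrightarrow> i \<in> basis R \<Longrightarrow> j \<in> basis R \<Longrightarrow>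
      entry R (g * h) i j = (\<Sum>m\<in>basis R. entry R g i m * entry R h m j)"
  using assms by (auto simp: is_rep_def)

lemma star_formD:
  assumes "star_form n R q"
  shows "i \<in> basis R \<Longrightarrow> q i > 0"
    "g \<in> GL n \<Longrightarrow> i \<in> basis R \<Longrightarrow> j \<in> basis R \<Longrightarrow>
      of_real (q i) * entry R g i j = of_real (q j) * cnj (entry R (adj n g) j i)"
  using assms by (auto simp: star_form_def)

lemma std_rep:
  shows "polynomial_rep n (std_rep n)" "star_form n (std_rep n) (\<lambda>_. 1)"
    "torus_weights n (std_rep n) (\<lambda>i. {#i#})"
proof -
  have "(g * h) $$ (i,j) = (\<Sum>m<n. g $$ (i,m) * h $$ (m,j))"
    if "g \<in> GL n" "h \<in> GL n" "i < n" "j < n" for g h i j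
    using GL_carrier[OF that(1)] GL_carrier[OF that(2)] that(3,4)
    by (auto simp: scalar_prod_def atLeast0LessThan)
  then have "is_rep n (std_rep n)" by (auto simp: is_rep_def std_rep_def)
  then show "polynomial_rep n (std_rep n)"
    by (auto simp: polynomial_rep_iff std_rep_def polyfun_coord)
qed (auto simp: star_form_def std_rep_def adj_def torus_weights_def mat_diag_def)

text \<open>The multiplicity space that will carry the column index of a matrix.\<close>

definition trivial_rep :: "nat \<Rightarrow> nat gl_rep" where
  "trivial_rep m = \<lparr>basis = {..<m}, entry = (\<lambda>g i j. if i = j then 1 else 0)\<rparr>"

lemma trivial_rep:
  shows "polynomial_rep n (trivial_rep m)" "star_form n (trivial_rep m) (\<lambda>_. 1)"
    "torus_weights n (trivial_rep m) (\<lambda>i. {#})"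
proof -
  have "(\<Sum>k<m. (if i = k then 1 else 0) * (if k = j then 1 else 0)) = (if i = j then 1 else 0 :: complex)" if "i < m" for i j
  proof -
    have "(\<Sum>k<m. (if i = k then 1 else 0) * (if k = j then 1 else 0)) = (\<Sum>k<m. if k = i then (if i = j then 1 else 0) else 0 :: complex)"
      by (intro sum.cong) auto
    then show ?thesis using that by simp
  qed
  then show "polynomial_rep n (trivial_rep m)"
    by (simp add: polynomial_rep_iff is_rep_def trivial_rep_def polyfun_const)
qed (auto simp: trivial_rep_def star_form_def torus_weights_def)

lemma tensor_rep:
  shows "polynomial_rep n R \<Longrightarrow> polynomial_rep n S \<Longrightarrow> polynomial_rep n (tensor_rep R S)"
    "star_form n R q \<Longrightarrow> star_form n S q' \<Longrightarrow> star_form n (tensor_rep R S) (\<lambda>(i,j). q i * q' j)"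
    "torus_weights n R wt \<Longrightarrow> torus_weights n S wt' \<Longrightarrow> torus_weights n (tensor_rep R S) (\<lambda>(i,j). wt i + wt' j)"
proof -
  assume R: "polynomial_rep n R" and S: "polynomial_rep n S"
  then have r: "is_rep n R" "is_rep n S" by (auto simp: polynomial_rep_def)
  have "(\<Sum>m\<in>basis R. entry R g i m * entry R h m j) * (\<Sum>m\<in>basis S. entry S g i' m * entry S h m j') =
    (\<Sum>(m,m')\<in>basis R \<times> basis S. (entry R g i m * entry S g i' m') * (entry R h m j * entry S h m' j'))"
    for g h i j i' j'
    by (simp add: sum_product sum.cartesian_product ac_simps)
  then have "is_rep n (tensor_rep R S)" unfolding is_rep_def
    by (auto simp: tensor_rep_def is_repD[OF r(1)] is_repD[OF r(2)] case_prod_unfold)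
  then show "polynomial_rep n (tensor_rep R S)"
    using R S by (auto simp: polynomial_rep_iff tensor_rep_def intro!: polyfun_mult)
next
  assume R: "star_form n R q" and S: "star_form n S q'"
  have "of_real (q i * q' i') * (entry R g i j * entry S g i' j') =
    of_real (q j * q' j') * cnj (entry R (adj n g) j i * entry S (adj n g) j' i')"
    if "g \<in> GL n" "i \<in> basis R" "j \<in> basis R" "i' \<in> basis S" "j' \<in> basis S" for g i j i' j'
  proof -
    have "of_real (q i * q' i') * (entry R g i j * entry S g i' j') =
      (of_real (q i) * entry R g i j) * (of_real (q' i') * entry S g i' j')" by (simp add: ac_simps)
    then show ?thesis using star_formD(2)[OF R that(1-3)] star_formD(2)[OF S that(1,4,5)] by (simp add: ac_simps)
  qed
  then show "star_form n (tensor_rep R S) (\<lambda>(i,j). q i * q' j)"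
    using star_formD(1)[OF R] star_formD(1)[OF S] by (auto simp: star_form_def tensor_rep_def)
next
  assume "torus_weights n R wt" "torus_weights n S wt'"
  then show "torus_weights n (tensor_rep R S) (\<lambda>(i,j). wt i + wt' j)"
    by (auto simp: torus_weights_def tensor_rep_def)
qed

text \<open>The pairs \<open>(a, b)\<close> and \<open>(b, a)\<close> combine and the diagonal drops
  out; this is the step from a product of matrices to the Cauchy-Binet formula for minors of size
  two.\<close>

lemma sum_antisymmetric:
  fixes D H :: "'i::linorder \<Rightarrow> 'i \<Rightarrow> complex"
  assumes "finite B" "\<And>a b. D b a = - D a b"
  shows "(\<Sum>a\<in>B. \<Sum>b\<in>B. D a b * H a b) = (\<Sum>(a,b)\<in>{(a,b). a \<in> B \<and> b \<in> B \<and> a < b}. D a b * (H a b - H b a))"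
proof -
  let ?U = "{(a,b). a \<in> B \<and> b \<in> B \<and> a < b}" and ?L = "{(a,b). a \<in> B \<and> b \<in> B \<and> b < a}"
    and ?E = "{(a,b). a \<in> B \<and> b \<in> B \<and> a = b}"
  have fin: "finite ?U" "finite ?L" "finite ?E"
    by (rule finite_subset[of _ "B \<times> B"]; use assms(1) in auto)+
  have diag: "D a a = 0" for a using assms(2)[of a a] by simp
  have eq: "B \<times> B = ?U \<union> ?L \<union> ?E" by auto
  have "(\<Sum>a\<in>B. \<Sum>b\<in>B. D a b * H a b) = (\<Sum>(a,b)\<in>B \<times> B. D a b * H a b)" by (rule sum.cartesian_product)
  also have "\<dots> = (\<Sum>(a,b)\<in>?U. D a b * H a b) + (\<Sum>(a,b)\<in>?L. D a b * H a b) + (\<Sum>(a,b)\<in>?E. D a b * H a b)"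
    unfolding eq using fin by (subst sum.union_disjoint; (subst sum.union_disjoint)?) auto
  also have "(\<Sum>(a,b)\<in>?E. D a b * H a b) = 0" using diag by (intro sum.neutral) auto
  also have "(\<Sum>(a,b)\<in>?L. D a b * H a b) = (\<Sum>(a,b)\<in>?U. D b a * H b a)"
    by (rule sum.reindex_bij_witness[of _ "\<lambda>(a,b). (b,a)" "\<lambda>(a,b). (b,a)"]) auto
  also have "(\<Sum>(a,b)\<in>?U. D a b * H a b) + (\<Sum>(a,b)\<in>?U. D b a * H b a) + 0 =
      (\<Sum>(a,b)\<in>?U. D a b * (H a b - H b a))"
    unfolding add_0_right sum.distrib[symmetric]
  proof (intro sum.cong refl, clarify)
    fix a b
    have "D b a = - D a b" by (rule assms(2))
    then show "D a b * H a b + D b a * H b a = D a b * (H a b - H b a)" by (simp add: algebra_simps)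
  qed
  finally show ?thesis .
qed

lemma ext_square:
  fixes R :: "'i::linorder gl_rep"
  shows "polynomial_rep n R \<Longrightarrow> polynomial_rep n (ext_square R)"
    "star_form n R q \<Longrightarrow> star_form n (ext_square R) (\<lambda>(i,j). q i * q j)"
    "torus_weights n R wt \<Longrightarrow> torus_weights n (ext_square R) (\<lambda>(i,j). wt i + wt j)"
proof -
  assume R: "polynomial_rep n R"
  then have r: "is_rep n R" by (auto simp: polynomial_rep_def)
  note rD = is_repD[OF r]
  let ?B = "basis R" and ?U = "{(a,b). a \<in> basis R \<and> b \<in> basis R \<and> a < b}"
  \<comment> \<open>The entries of the exterior square are the minors of size two, with rows
    \<open>i\<close>, \<open>j\<close> and columns \<open>a\<close>, \<open>b\<close>.\<close>
  let ?D = "\<lambda>g i j a b. entry R g i a * entry R g j b - entry R g j a * entry R g i b"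
  have mult: "?D (g * h) i j k l = (\<Sum>(a,b)\<in>?U. ?D g i j a b * ?D h a b k l)"
    if g: "g \<in> GL n" "h \<in> GL n" and ij: "i \<in> ?B" "j \<in> ?B" "k \<in> ?B" "l \<in> ?B" for g h i j k l
  proof -
    have "?D (g * h) i j k l =
      (\<Sum>a\<in>?B. \<Sum>b\<in>?B. (entry R g i a * entry R h a k) * (entry R g j b * entry R h b l)) -
      (\<Sum>a\<in>?B. \<Sum>b\<in>?B. (entry R g j a * entry R h a k) * (entry R g i b * entry R h b l))"
      using g ij by (simp add: rD sum_product)
    also have "\<dots> = (\<Sum>a\<in>?B. \<Sum>b\<in>?B. ?D g i j a b * (entry R h a k * entry R h b l))"
      unfolding sum_subtractf[symmetric] by (intro sum.cong refl) (simp add: algebra_simps)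
    also have "\<dots> = (\<Sum>(a,b)\<in>?U. ?D g i j a b * (entry R h a k * entry R h b l - entry R h b k * entry R h a l))"
      using rD(1) by (intro sum_antisymmetric) auto
    finally show ?thesis .
  qed
  have "finite ?U" by (rule finite_subset[of _ "?B \<times> ?B"]) (use rD(1) in auto)
  then have "is_rep n (ext_square R)" unfolding is_rep_def
    by (auto simp: ext_square_def tensor_rep_def rD(2) mult case_prod_unfold)
  then show "polynomial_rep n (ext_square R)"
    using R by (auto simp: polynomial_rep_iff ext_square_def tensor_rep_def intro!: polyfun_mult polyfun_diff)
next
  assume R: "star_form n R q"
  have "of_real (q i * q j) * (entry R g i k * entry R g j l - entry R g j k * entry R g i l) =
    of_real (q k * q l) * cnj (entry R (adj n g) k i * entry R (adj n g) l j - entry R (adj n g) l i * entry R (adj n g) k j)"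
    if g: "g \<in> GL n" and "i \<in> basis R" "j \<in> basis R" "k \<in> basis R" "l \<in> basis R" for g i j k l
  proof -
    have "of_real (q i * q j) * (entry R g i k * entry R g j l - entry R g j k * entry R g i l) =
     (of_real (q i) * entry R g i k) * (of_real (q j) * entry R g j l) -
     (of_real (q j) * entry R g j k) * (of_real (q i) * entry R g i l)" by (simp add: algebra_simps)
    then show ?thesis using that by (simp add: star_formD(2)[OF R] algebra_simps)
  qed
  then show "star_form n (ext_square R) (\<lambda>(i,j). q i * q j)"
    using star_formD(1)[OF R] by (auto simp: star_form_def ext_square_def tensor_rep_def)
next
  assume "torus_weights n R wt"
  then show "torus_weights n (ext_square R) (\<lambda>(i,j). wt i + wt j)"
    by (auto simp: torus_weights_def ext_square_def tensor_rep_def)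
qed

section \<open>Symmetric powers computed with words\<close>

definition words :: "'i set \<Rightarrow> nat \<Rightarrow> 'i list set" where
  "words B k = {I. set I \<subseteq> B \<and> length I = k}"

lemma finite_words: "finite B \<Longrightarrow> finite (words B k)"
  unfolding words_def by (rule finite_lists_length_eq)

lemma sum_words_prod:
  fixes f :: "nat \<Rightarrow> 'i \<Rightarrow> complex"
  assumes "finite B"
  shows "(\<Sum>L\<in>words B k. \<Prod>r<k. f r (L ! r)) = (\<Prod>r<k. \<Sum>m\<in>B. f r m)"
proof (induction k arbitrary: f)
  case 0
  have "words B 0 = {[]}" by (auto simp: words_def)
  then show ?case by simp
next
  case (Suc k)
  have "(\<Sum>L\<in>words B (Suc k). \<Prod>r<Suc k. f r (L ! r)) =
    (\<Sum>(m,L)\<in>B \<times> words B k. f 0 m * (\<Prod>r<k. f (Suc r) (L ! r)))"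
    by (rule sum.reindex_bij_witness[of _ "\<lambda>(m,L). m # L" "\<lambda>L. (hd L, tl L)"])
      (auto simp: words_def length_Suc_conv prod.lessThan_Suc_shift simp del: prod.lessThan_Suc)
  also have "\<dots> = (\<Sum>m\<in>B. f 0 m) * (\<Prod>r<k. \<Sum>m\<in>B. f (Suc r) m)"
    unfolding Suc.IH[symmetric] by (simp add: sum_product sum.cartesian_product)
  finally show ?case by (simp add: prod.lessThan_Suc_shift del: prod.lessThan_Suc)
qed

definition word_entry :: "'i gl_rep \<Rightarrow> complex mat \<Rightarrow> 'i list \<Rightarrow> 'i list \<Rightarrow> complex" where
  "word_entry R g I J = (\<Prod>r<length J. entry R g (I ! r) (J ! r))"

lemma word_entry_permute:
  assumes "p permutes {..<length J}" "length I = length J"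
  shows "word_entry R g (permute_list p I) (permute_list p J) = word_entry R g I J"
proof -
  have "word_entry R g (permute_list p I) (permute_list p J) = (\<Prod>r<length J. entry R g (I ! p r) (J ! p r))"
    using assms by (auto simp: word_entry_def permute_list_nth intro!: prod.cong)
  also have "\<dots> = word_entry R g I J" unfolding word_entry_def
    by (rule prod.reindex_bij_betw[OF permutes_imp_bij[OF assms(1)]])
  finally show ?thesis .
qed

text \<open>A permutation taking \<open>J\<close> to \<open>J'\<close> also permutes the words
  summed over.\<close>

lemma sum_permutations_word_entry_cong:
  assumes "mset J = mset J'" "size M = length J"
  shows "(\<Sum>I\<in>permutations_of_multiset M. word_entry R g I J) = (\<Sum>I\<in>permutations_of_multiset M. word_entry R g I J')"
proof -
  obtain p where p: "p permutes {..<length J}" "permute_list p J = J'"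
    using mset_eq_permutation[OF assms(1)[symmetric]] by blast
  let ?P = "permutations_of_multiset M"
  have len: "length I = length J" if "I \<in> ?P" for I
    using that assms(2) by (metis permutations_of_multisetD size_mset)
  have inj: "inj_on (permute_list p) ?P"
  proof (rule inj_onI)
    fix I I' assume I: "I \<in> ?P" "I' \<in> ?P" "permute_list p I = permute_list p I'"
    show "I = I'"
    proof (rule nth_equalityI)
      show "length I = length I'" using len I by simp
      fix r assume "r < length I"
      then obtain s where s: "s < length J" "r = p s"
        using permutes_imp_bij[OF p(1)] len[OF I(1)] by (auto simp: bij_betw_def image_iff)
      then show "I ! r = I' ! r"
        using I(3) len[OF I(1)] len[OF I(2)] p(1) by (metis permute_list_nth)
    qed
  qed
  have "permute_list p ` ?P \<subseteq> ?P"
    using len p(1) by (auto simp: permutations_of_multiset_def)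
  then have "bij_betw (permute_list p) ?P ?P"
    using inj endo_inj_surj[of ?P "permute_list p"] by (auto simp: bij_betw_def)
  then have "(\<Sum>I\<in>?P. word_entry R g I J') = (\<Sum>I\<in>?P. word_entry R g (permute_list p I) J')"
    by (rule sum.reindex_bij_betw[symmetric])
  also have "\<dots> = (\<Sum>I\<in>?P. word_entry R g I J)"
    using p len by (intro sum.cong refl) (metis word_entry_permute)
  finally show ?thesis ..
qed

lemma basis_sym_power: "basis (sym_power k R) = multisets_of_size (basis R) k"
  by (simp add: sym_power_def multisets_of_size_def)

text \<open>Replaces the arbitrarily chosen word in \<open>sym_power\<close> by any convenient word
  with the same multiset.\<close>

lemma entry_sym_power:
  assumes "size M = k" "mset J = N" "size N = k"
  shows "entry (sym_power k R) g M N = (\<Sum>I\<in>permutations_of_multiset M. word_entry R g I J)"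
proof -
  let ?J = "SOME J. mset J = N"
  have J: "mset ?J = N" by (rule someI_ex) (rule ex_mset)
  then have l: "length ?J = k" using assms by (metis size_mset)
  have "entry (sym_power k R) g M N = (\<Sum>I\<in>permutations_of_multiset M. word_entry R g I ?J)"
    by (simp add: sym_power_def tensor_power_def word_entry_def l)
  also have "\<dots> = (\<Sum>I\<in>permutations_of_multiset M. word_entry R g I J)"
    using J assms l by (intro sum_permutations_word_entry_cong) auto
  finally show ?thesis .
qed

lemma permutations_eq_words:
  assumes "M \<in> multisets_of_size B k"
  shows "permutations_of_multiset M = {L \<in> words B k. mset L = M}"
  using assms by (auto simp: permutations_of_multiset_def words_def multisets_of_size_def)

lemma words_nth: "I \<in> words B k \<Longrightarrow> r < k \<Longrightarrow> I ! r \<in> B"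
  by (auto simp: words_def)

lemma word_delta:
  assumes "length I = length J" "length J = k"
  shows "(\<Prod>r<k. if I ! r = J ! r then f (I ! r) else 0) = (if I = J then \<Prod>r<k. f (J ! r) else (0::complex))"
proof (cases "I = J")
  case False
  then obtain r where "r < k" "I ! r \<noteq> J ! r" using assms nth_equalityI by metis
  then show ?thesis using False by (auto simp: prod_zero_iff)
qed simp

lemma prod_nth_mset: "(\<Prod>r<length J. f (J ! r)) = prod_mset (image_mset f (mset J))"
  by (simp add: prod_mset_prod_list prod.list_conv_set_nth atLeast0LessThan flip: mset_map)

lemma ex_word: "M \<in> multisets_of_size B k \<Longrightarrow> \<exists>J\<in>words B k. mset J = M"
proof -
  assume M: "M \<in> multisets_of_size B k"
  obtain J where "mset J = M" using ex_mset by blast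
  then show ?thesis using M by (intro bexI[of _ J]) (auto simp: words_def multisets_of_size_def)
qed

lemma sym_power_is_rep:
  assumes "is_rep n R"
  shows "is_rep n (sym_power k R)"
  unfolding is_rep_def basis_sym_power
proof (intro conjI ballI)
  let ?B = "basis R" and ?S = "multisets_of_size (basis R) k"
  note rD = is_repD[OF assms]
  show "finite ?S" using rD(1) by blast
  fix M N assume M: "M \<in> ?S" and N: "N \<in> ?S"
  obtain J where J: "J \<in> words ?B k" "mset J = N" using ex_word[OF N] by blast
  have sz: "size M = k" "size N = k" using M N by (auto simp: multisets_of_size_def)
  note e = entry_sym_power[OF sz(1) J(2) sz(2)]
  have lJ: "length J = k" using J by (simp add: words_def)
  have perm: "I \<in> words ?B k" if "I \<in> permutations_of_multiset M" for I
    using that permutations_eq_words[OF M] by simp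
  have "word_entry R (1\<^sub>m n) I J = (if I = J then 1 else 0)" if "I \<in> permutations_of_multiset M" for I
  proof -
    have "word_entry R (1\<^sub>m n) I J = (\<Prod>r<k. if I ! r = J ! r then 1 else 0)"
      using words_nth[OF perm[OF that]] words_nth[OF J(1)] lJ unfolding word_entry_def
      by (intro prod.cong) (auto simp: rD(2))
    also have "\<dots> = (if I = J then 1 else 0)"
      using word_delta[of I J k "\<lambda>_. 1"] perm[OF that] lJ by (simp add: words_def)
    finally show ?thesis .
  qed
  then have "entry (sym_power k R) (1\<^sub>m n) M N = (\<Sum>I\<in>permutations_of_multiset M. if I = J then 1 else 0)"
    unfolding e by simp
  also have "\<dots> = (if J \<in> permutations_of_multiset M then 1 else 0)" by (simp add: sum.delta)
  finally show "entry (sym_power k R) (1\<^sub>m n) M N = (if M = N then 1 else 0)"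
    using J(2) by (auto simp: permutations_of_multiset_def)
  fix g h assume g: "g \<in> GL n" "h \<in> GL n"
  have we: "word_entry R (g * h) I J = (\<Sum>L\<in>words ?B k. word_entry R g I L * word_entry R h L J)"
    if "I \<in> permutations_of_multiset M" for I
  proof -
    have "word_entry R (g * h) I J = (\<Prod>r<k. \<Sum>m\<in>?B. entry R g (I ! r) m * entry R h m (J ! r))"
      using words_nth[OF perm[OF that]] words_nth[OF J(1)] lJ g unfolding word_entry_def
      by (intro prod.cong) (auto simp: rD(3))
    also have "\<dots> = (\<Sum>L\<in>words ?B k. \<Prod>r<k. entry R g (I ! r) (L ! r) * entry R h (L ! r) (J ! r))"
      by (rule sum_words_prod[OF rD(1), symmetric])
    also have "\<dots> = (\<Sum>L\<in>words ?B k. word_entry R g I L * word_entry R h L J)"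
      using lJ by (intro sum.cong refl) (auto simp: word_entry_def words_def prod.distrib)
    finally show ?thesis .
  qed
  have "entry (sym_power k R) (g * h) M N =
    (\<Sum>I\<in>permutations_of_multiset M. \<Sum>L\<in>words ?B k. word_entry R g I L * word_entry R h L J)"
    unfolding e using we by simp
  also have "\<dots> = (\<Sum>L\<in>words ?B k. (\<Sum>I\<in>permutations_of_multiset M. word_entry R g I L) * word_entry R h L J)"
    by (subst sum.swap) (simp add: sum_distrib_right)
  also have "\<dots> = (\<Sum>L\<in>words ?B k. entry (sym_power k R) g M (mset L) * word_entry R h L J)"
    using sz by (intro sum.cong refl arg_cong2[of _ _ _ _ "(*)"] entry_sym_power[symmetric])
      (auto simp: words_def)
  \<comment> \<open>The first factor depends on the word \<open>L\<close> only through its multiset,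
    and summing the second over all words with the same multiset gives an entry for
    \<open>h\<close>.\<close>
  also have "\<dots> = (\<Sum>P\<in>?S. \<Sum>L\<in>{L \<in> words ?B k. mset L = P}. entry (sym_power k R) g M (mset L) * word_entry R h L J)"
    by (intro sum.group[symmetric] finite_words finite_multisets_of_size rD(1))
      (auto simp: words_def multisets_of_size_def)
  also have "\<dots> = (\<Sum>P\<in>?S. entry (sym_power k R) g M P * entry (sym_power k R) h P N)"
  proof (intro sum.cong refl)
    fix P assume P: "P \<in> ?S"
    then have "size P = k" by (simp add: multisets_of_size_def)
    from entry_sym_power[OF this J(2) sz(2), of R h]
    show "(\<Sum>L\<in>{L \<in> words ?B k. mset L = P}. entry (sym_power k R) g M (mset L) * word_entry R h L J) =
      entry (sym_power k R) g M P * entry (sym_power k R) h P N"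
      unfolding permutations_eq_words[OF P] by (simp add: sum_distrib_left)
  qed
  finally show "entry (sym_power k R) (g * h) M N =
    (\<Sum>P\<in>?S. entry (sym_power k R) g M P * entry (sym_power k R) h P N)" .
qed

text \<open>The weights of the form divide by the number of words of a multiset, because an entry
  sums over the words of the row index but uses a single word of the column index. The sum over both
  is symmetric under taking adjoints.\<close>

lemma sym_power:
  shows "polynomial_rep n R \<Longrightarrow> polynomial_rep n (sym_power k R)"
    "star_form n R q \<Longrightarrow> star_form n (sym_power k R)
       (\<lambda>M. prod_mset (image_mset q M) / real (card (permutations_of_multiset M)))"
    "torus_weights n R wt \<Longrightarrow> torus_weights n (sym_power k R) (\<lambda>M. sum_mset (image_mset wt M))"
proof -
  let ?B = "basis R" and ?S = "multisets_of_size (basis R) k"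
  have perm: "I \<in> words ?B k" if "M \<in> ?S" "I \<in> permutations_of_multiset M" for I M
    using that permutations_eq_words by blast
  {
    assume R: "polynomial_rep n R"
    have "polyfun n (\<lambda>g. entry (sym_power k R) g M N)" if M: "M \<in> ?S" and N: "N \<in> ?S" for M N
    proof -
      obtain J where J: "J \<in> words ?B k" "mset J = N" using ex_word[OF N] by blast
      have sz: "size M = k" "size N = k" using M N by (auto simp: multisets_of_size_def)
      have "polyfun n (\<lambda>g. \<Sum>I\<in>permutations_of_multiset M. word_entry R g I J)"
        unfolding word_entry_def
        using R words_nth[OF perm[OF M]] words_nth[OF J(1)] J(1)
        by (intro polyfun_sum polyfun_prod) (auto simp: polynomial_rep_iff words_def)
      then show ?thesis unfolding entry_sym_power[OF sz(1) J(2) sz(2)] .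
    qed
    then show "polynomial_rep n (sym_power k R)"
      using R sym_power_is_rep by (auto simp: polynomial_rep_iff basis_sym_power)
  next
    assume R: "star_form n R q"
    let ?q = "\<lambda>M. prod_mset (image_mset q M)" and ?c = "\<lambda>M :: 'a multiset. card (permutations_of_multiset M)"
    have c: "?c M > 0" for M :: "'a multiset" by (simp add: card_gt_0_iff)
    have pos: "?q M > 0" if "M \<in> ?S" for M
    proof -
      have "\<forall>i\<in>#M. q i > 0" using that star_formD(1)[OF R] by (auto simp: multisets_of_size_def)
      then show ?thesis by (induction M) auto
    qed
    have main: "of_real (?q M / real (?c M)) * entry (sym_power k R) g M N =
      of_real (?q N / real (?c N)) * cnj (entry (sym_power k R) (adj n g) N M)"
      if g: "g \<in> GL n" and M: "M \<in> ?S" and N: "N \<in> ?S" for g M N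
    proof -
      have sz: "size M = k" "size N = k" using M N by (auto simp: multisets_of_size_def)
      have sw: "of_real (?q M) * word_entry R g I J = of_real (?q N) * cnj (word_entry R (adj n g) J I)"
        if I: "I \<in> permutations_of_multiset M" and J: "J \<in> permutations_of_multiset N" for I J
      proof -
        have l: "length I = k" "length J = k" using perm[OF M I] perm[OF N J] by (auto simp: words_def)
        have mm: "mset I = M" "mset J = N" using I J by (auto simp: permutations_of_multiset_def)
        have "?q M = (\<Prod>r<k. q (I ! r))" "?q N = (\<Prod>r<k. q (J ! r))"
          using prod_nth_mset[of q I] prod_nth_mset[of q J] l mm by simp_all
        then have qIJ: "complex_of_real (?q M) = (\<Prod>r<k. of_real (q (I ! r)))"
          "complex_of_real (?q N) = (\<Prod>r<k. of_real (q (J ! r)))" by simp_all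
        have "of_real (?q M) * word_entry R g I J = (\<Prod>r<k. of_real (q (I ! r)) * entry R g (I ! r) (J ! r))"
          unfolding qIJ using l by (simp add: word_entry_def prod.distrib)
        also have "\<dots> = (\<Prod>r<k. of_real (q (J ! r)) * cnj (entry R (adj n g) (J ! r) (I ! r)))"
          using words_nth[OF perm[OF M I]] words_nth[OF perm[OF N J]]
          by (intro prod.cong refl star_formD(2)[OF R g]) auto
        also have "\<dots> = of_real (?q N) * cnj (word_entry R (adj n g) J I)"
          unfolding qIJ using l by (simp add: word_entry_def prod.distrib)
        finally show ?thesis .
      qed
      \<comment> \<open>Every word of \<open>N\<close> gives the same entry, so averaging over them
        produces the double sum.\<close>
      have "of_nat (?c N) * entry (sym_power k R) g M N =
        (\<Sum>J\<in>permutations_of_multiset N. \<Sum>I\<in>permutations_of_multiset M. word_entry R g I J)"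
        by (simp add: entry_sym_power[OF sz(1) permutations_of_multisetD sz(2), symmetric] cong: sum.cong)
      then have "of_real (?q M) * (of_nat (?c N) * entry (sym_power k R) g M N) =
        (\<Sum>J\<in>permutations_of_multiset N. \<Sum>I\<in>permutations_of_multiset M. of_real (?q N) * cnj (word_entry R (adj n g) J I))"
        using sw by (simp add: sum_distrib_left)
      also have "\<dots> = of_real (?q N) * cnj (\<Sum>I\<in>permutations_of_multiset M. \<Sum>J\<in>permutations_of_multiset N. word_entry R (adj n g) J I)"
        by (subst sum.swap) (simp add: sum_distrib_left)
      also have "(\<Sum>I\<in>permutations_of_multiset M. \<Sum>J\<in>permutations_of_multiset N. word_entry R (adj n g) J I) =
        of_nat (?c M) * entry (sym_power k R) (adj n g) N M"
        by (simp add: entry_sym_power[OF sz(2) permutations_of_multisetD sz(1), symmetric] cong: sum.cong)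
      finally show ?thesis using c[of M] c[of N] by (simp add: field_simps)
    qed
    then show "star_form n (sym_power k R) (\<lambda>M. ?q M / real (?c M))"
      using pos c by (auto simp: star_form_def basis_sym_power)
  next
    assume R: "torus_weights n R wt"
    let ?w = "\<lambda>M. sum_mset (image_mset wt M)"
    have "entry (sym_power k R) (mat_diag n x) M N = (if M = N then mon x (?w M) else 0)"
      if M: "M \<in> ?S" and N: "N \<in> ?S" for M N x
    proof -
      obtain J where J: "J \<in> words ?B k" "mset J = N" using ex_word[OF N] by blast
      have sz: "size M = k" "size N = k" using M N by (auto simp: multisets_of_size_def)
      have lJ: "length J = k" using J by (simp add: words_def)
      have "prod_mset (image_mset (\<lambda>i. mon x (wt i)) N) = mon x (?w N)" by (induction N) auto
      then have pr: "(\<Prod>r<k. mon x (wt (J ! r))) = mon x (?w N)"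
        using prod_nth_mset[of "\<lambda>i. mon x (wt i)" J] lJ J(2) by simp
      have "word_entry R (mat_diag n x) I J = (if I = J then mon x (?w N) else 0)"
        if I: "I \<in> permutations_of_multiset M" for I
      proof -
        have "word_entry R (mat_diag n x) I J = (\<Prod>r<k. if I ! r = J ! r then mon x (wt (I ! r)) else 0)"
          using words_nth[OF perm[OF M I]] words_nth[OF J(1)] lJ R unfolding word_entry_def torus_weights_def
          by (intro prod.cong) auto
        also have "\<dots> = (if I = J then mon x (?w N) else 0)"
          using word_delta[of I J k "\<lambda>i. mon x (wt i)"] perm[OF M I] lJ pr by (simp add: words_def)
        finally show ?thesis .
      qed
      then have "entry (sym_power k R) (mat_diag n x) M N =
          (\<Sum>I\<in>permutations_of_multiset M. if I = J then mon x (?w N) else 0)"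
        unfolding entry_sym_power[OF sz(1) J(2) sz(2)] by simp
      also have "\<dots> = (if J \<in> permutations_of_multiset M then mon x (?w N) else 0)" by (simp add: sum.delta)
      finally show ?thesis using J(2) by (auto simp: permutations_of_multiset_def)
    qed
    then show "torus_weights n (sym_power k R) ?w" by (simp add: torus_weights_def basis_sym_power)
  }
qed

section \<open>Polynomial functions on matrices\<close>

text \<open>
  The polynomial functions of degree \<open>d\<close> in the entries of an \<open>n \<times> n\<close> matrix: the pair \<open>(i, a)\<close> stands for
  the entry in row \<open>i\<close> and column \<open>a\<close>, and the group acts on the row index only.
\<close>

definition matrix_poly_rep :: "nat \<Rightarrow> nat \<Rightarrow> (nat \<times> nat) multiset gl_rep" where
  "matrix_poly_rep n d = sym_power d (tensor_rep (std_rep n) (trivial_rep n))"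

definition column_space :: "nat \<Rightarrow> nat \<Rightarrow> nat multiset \<Rightarrow> ((nat \<times> nat) multiset \<Rightarrow> complex) set" where
  "column_space n d N = {v \<in> rep_space (matrix_poly_rep n d). \<forall>M. image_mset snd M \<noteq> N \<longrightarrow> v M = 0}"

text \<open>The monomial in the diagonal variables with exponents \<open>N\<close>. It lies in the
  column space of \<open>N\<close>, has weight \<open>N\<close>, and will generate this space as a
  representation.\<close>

definition diag_mset :: "nat multiset \<Rightarrow> (nat \<times> nat) multiset" where
  "diag_mset N = image_mset (\<lambda>a. (a,a)) N"

lemma basis_matrix_poly_rep: "basis (matrix_poly_rep n d) = multisets_of_size ({..<n} \<times> {..<n}) d"
  by (simp add: matrix_poly_rep_def basis_sym_power tensor_rep_def std_rep_def trivial_rep_def)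

lemma finite_basis_matrix_poly_rep: "finite (basis (matrix_poly_rep n d))"
  unfolding basis_matrix_poly_rep by blast

lemma polynomial_matrix_poly_rep: "polynomial_rep n (matrix_poly_rep n d)"
  unfolding matrix_poly_rep_def by (intro sym_power(1) tensor_rep(1) std_rep trivial_rep)

lemma is_rep_matrix_poly_rep: "is_rep n (matrix_poly_rep n d)"
  using polynomial_matrix_poly_rep by (simp add: polynomial_rep_def)

lemma star_form_matrix_poly_rep: "\<exists>q. star_form n (matrix_poly_rep n d) q"
  unfolding matrix_poly_rep_def
  using sym_power(2)[OF tensor_rep(2)[OF std_rep(2) trivial_rep(2)]] by blast

lemma torus_weights_matrix_poly_rep: "torus_weights n (matrix_poly_rep n d) (image_mset fst)"
proof -
  have "sum_mset (image_mset (\<lambda>(i,j). {#i#} + {#}) M) = image_mset fst M" for M :: "(nat \<times> nat) multiset"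
    by (induction M) auto
  then have "(\<lambda>M :: (nat \<times> nat) multiset. sum_mset (image_mset (\<lambda>(i,j). {#i#} + {#}) M)) = image_mset fst"
    by (rule ext)
  then show ?thesis unfolding matrix_poly_rep_def
    using sym_power(3)[OF tensor_rep(3)[OF std_rep(3) trivial_rep(3)], of n d n] by (simp only:)
qed

text \<open>The trivial tensor factor only lets matching column indices through.\<close>

lemma word_entry_matrix:
  assumes "length I = length J"
  shows "word_entry (tensor_rep (std_rep n) (trivial_rep n)) g I J =
    (if map snd I = map snd J then \<Prod>r<length J. g $$ (fst (I ! r), fst (J ! r)) else 0)"
proof -
  have "word_entry (tensor_rep (std_rep n) (trivial_rep n)) g I J =
    (\<Prod>r<length J. if snd (I ! r) = snd (J ! r) then g $$ (fst (I ! r), fst (J ! r)) else 0)"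
    unfolding word_entry_def
    by (intro prod.cong) (auto simp: tensor_rep_def std_rep_def trivial_rep_def case_prod_unfold)
  also have "\<dots> = (if map snd I = map snd J then \<Prod>r<length J. g $$ (fst (I ! r), fst (J ! r)) else 0)"
  proof (cases "map snd I = map snd J")
    case True
    have "snd (I ! r) = snd (J ! r)" if "r < length J" for r
      using arg_cong[OF True, of "\<lambda>L. L ! r"] that assms by simp
    then show ?thesis using True by simp
  next
    case False
    then obtain r where "r < length J" "snd (I ! r) \<noteq> snd (J ! r)"
      using assms by (auto simp: list_eq_iff_nth_eq)
    then show ?thesis using False by (auto simp: prod_zero_iff)
  qed
  finally show ?thesis .
qed

lemma matrix_poly_entry_columns:
  assumes "M \<in> basis (matrix_poly_rep n d)" "N \<in> basis (matrix_poly_rep n d)"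
    "image_mset snd M \<noteq> image_mset snd N"
  shows "entry (matrix_poly_rep n d) g M N = 0"
proof -
  obtain J where J: "mset J = N" using ex_mset by blast
  have sz: "size M = d" "size N = d" using assms by (auto simp: basis_matrix_poly_rep multisets_of_size_def)
  have "word_entry (tensor_rep (std_rep n) (trivial_rep n)) g I J = 0" if I: "I \<in> permutations_of_multiset M" for I
  proof -
    have m: "mset I = M" using I by (rule permutations_of_multisetD)
    then have "length I = length J" using sz J by (metis size_mset)
    moreover have "map snd I \<noteq> map snd J" using assms(3) m J by (metis mset_map)
    ultimately show ?thesis by (simp add: word_entry_matrix)
  qed
  then show ?thesis unfolding matrix_poly_rep_def entry_sym_power[OF sz(1) J sz(2)] by simp
qed

lemma diag_mset_in_basis: "N \<in> multisets_of_size {..<n} d \<Longrightarrow> diag_mset N \<in> basis (matrix_poly_rep n d)"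
  by (auto simp: basis_matrix_poly_rep diag_mset_def multisets_of_size_def)

lemma diag_mset_margins: "image_mset snd (diag_mset N) = N" "image_mset fst (diag_mset N) = N"
  by (simp_all add: diag_mset_def multiset.map_comp comp_def)

lemma ex_word_over_column:
  assumes "image_mset snd M = mset K"
  shows "\<exists>I. mset I = M \<and> map snd I = K"
proof -
  obtain I0 where I0: "mset I0 = M" using ex_mset by blast
  then have "mset K = mset (map snd I0)" using assms by simp
  then obtain p where p: "p permutes {..<length (map snd I0)}" "permute_list p (map snd I0) = K"
    using mset_eq_permutation by blast
  then have "map snd (permute_list p I0) = K" "mset (permute_list p I0) = M"
    using I0 by (simp_all add: permute_list_map)
  then show ?thesis by blast
qed

text \<open>If \<open>M\<close> has column degrees \<open>N\<close>, this is the product over the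
  columns of the multinomial coefficients counting the arrangements of the entries of
  \<open>M\<close> in that column.\<close>

definition column_coeff :: "nat multiset \<Rightarrow> (nat \<times> nat) multiset \<Rightarrow> complex" where
  "column_coeff N M = of_nat (card {I \<in> permutations_of_multiset M. map snd I = (SOME K. mset K = N)})"

lemma column_coeff_nonzero:
  assumes "image_mset snd M = N" shows "column_coeff N M \<noteq> 0"
proof -
  have "mset (SOME K. mset K = N) = N" by (rule someI_ex) (rule ex_mset)
  then obtain I where "mset I = M" "map snd I = (SOME K. mset K = N)"
    using ex_word_over_column[of M "SOME K. mset K = N"] assms by auto
  then have "I \<in> {I \<in> permutations_of_multiset M. map snd I = (SOME K. mset K = N)}"
    by (auto intro: permutations_of_multisetI)
  moreover have "finite {I \<in> permutations_of_multiset M. map snd I = (SOME K. mset K = N)}" by simp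
  ultimately show ?thesis unfolding column_coeff_def by (simp only: of_nat_eq_0_iff card_0_eq) blast
qed

text \<open>The vector obtained by acting with \<open>g\<close> on the diagonal monomial has, up to
  nonzero constants, all monomials in the entries of \<open>g\<close> with column degrees
  \<open>N\<close> as coordinates.\<close>

lemma matrix_poly_entry_diag:
  assumes "M \<in> basis (matrix_poly_rep n d)" "N \<in> multisets_of_size {..<n} d"
  shows "entry (matrix_poly_rep n d) g M (diag_mset N) =
    (if image_mset snd M = N then column_coeff N M * mat_mon g M else 0)"
proof (cases "image_mset snd M = N")
  case False
  then show ?thesis
    using matrix_poly_entry_columns[OF assms(1) diag_mset_in_basis[OF assms(2)]] by (simp add: diag_mset_margins)
next
  case True
  define K where "K = (SOME K. mset K = N)"
  define J where "J = map (\<lambda>a. (a,a)) K"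
  have K: "mset K = N" unfolding K_def by (rule someI_ex) (rule ex_mset)
  have J: "mset J = diag_mset N" by (simp add: J_def diag_mset_def K)
  have sz: "size M = d" "size (diag_mset N) = d"
    using assms by (auto simp: basis_matrix_poly_rep multisets_of_size_def diag_mset_def)
  have we: "word_entry (tensor_rep (std_rep n) (trivial_rep n)) g I J = (if map snd I = K then mat_mon g M else 0)"
    if I: "I \<in> permutations_of_multiset M" for I
  proof -
    have m: "mset I = M" using I by (rule permutations_of_multisetD)
    then have len: "length I = length J" using sz J by (metis size_mset)
    have mJ: "map snd J = K" by (simp add: J_def comp_def)
    have "(\<Prod>r<length J. g $$ (fst (I ! r), fst (J ! r))) = mat_mon g M" if s: "map snd I = K"
    proof -
      \<comment> \<open>In a diagonal word the row index equals the column index, which matching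
        columns identify with that of \<open>I\<close>; each factor becomes the entry of
        \<open>g\<close> at a letter of \<open>I\<close>.\<close>
      have "fst (J ! r) = snd (I ! r)" if r: "r < length J" for r
      proof -
        have "J ! r = (K ! r, K ! r)" using r by (simp add: J_def)
        moreover have "map snd I ! r = snd (I ! r)" using r len by simp
        ultimately show ?thesis unfolding s by simp
      qed
      then have "(\<Prod>r<length J. g $$ (fst (I ! r), fst (J ! r))) = (\<Prod>r<length I. g $$ (I ! r))"
        using len by (intro prod.cong) auto
      also have "\<dots> = mat_mon g M" unfolding mon_def m[symmetric] by (rule prod_nth_mset)
      finally show ?thesis .
    qed
    then show ?thesis using word_entry_matrix[OF len, of n g] mJ by auto
  qed
  have "entry (matrix_poly_rep n d) g M (diag_mset N) =
      (\<Sum>I\<in>permutations_of_multiset M. if map snd I = K then mat_mon g M else 0)"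
    unfolding matrix_poly_rep_def entry_sym_power[OF sz(1) J sz(2)] using we by simp
  also have "\<dots> = (\<Sum>I\<in>{I \<in> permutations_of_multiset M. map snd I = K}. mat_mon g M)"
    by (rule sum.inter_filter[symmetric]) simp
  finally show ?thesis using True by (simp add: column_coeff_def K_def)
qed

section \<open>Column spaces: cyclic vectors and multiplicities\<close>

context
  fixes n d :: nat
begin

abbreviation (input) "A \<equiv> matrix_poly_rep n d"
abbreviation (input) "C \<equiv> column_space n d"
abbreviation (input) "Wts \<equiv> multisets_of_size {..<n} d"
abbreviation (input) "gen N \<equiv> unit_fun (diag_mset N) :: (nat \<times> nat) multiset \<Rightarrow> complex"

lemma subrep_column_space: "subrep n A (C N)"
  unfolding subrep_def
proof (intro conjI ballI)
  show "fs.subspace (C N)"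
    by (rule fs.subspaceI) (auto simp: column_space_def fs.subspace_0[OF subspace_rep_space]
        fs.subspace_add[OF subspace_rep_space] fs.subspace_scale[OF subspace_rep_space] fun_scale_apply)
  show "C N \<subseteq> rep_space A" by (auto simp: column_space_def)
  fix g v assume v: "v \<in> C N"
  have "rep_act A g v M = 0" if M: "image_mset snd M \<noteq> N" for M
  proof (cases "M \<in> basis A")
    case True
    have "entry A g M L * v L = 0" if "L \<in> basis A" for L
      using matrix_poly_entry_columns[OF True that, of g] v M
      by (cases "image_mset snd L = N") (auto simp: column_space_def)
    then have "(\<Sum>L\<in>basis A. entry A g M L * v L) = 0" by (intro sum.neutral ballI)
    then show ?thesis by (simp add: rep_act_def)
  qed (simp add: rep_act_def)
  then show "rep_act A g v \<in> C N" by (simp add: column_space_def rep_act_in)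
qed

lemma gen_in_column_space: "N \<in> Wts \<Longrightarrow> gen N \<in> C N"
  using unit_fun_in[OF diag_mset_in_basis, of N n d]
  by (auto simp: column_space_def unit_fun_def diag_mset_margins)

lemma rep_act_gen:
  assumes "N \<in> Wts" "M \<in> basis A"
  shows "rep_act A g (gen N) M = (if image_mset snd M = N then column_coeff N M * mat_mon g M else 0)"
proof -
  have "rep_act A g (gen N) M = (\<Sum>L\<in>basis A. if L = diag_mset N then entry A g M (diag_mset N) else 0)"
    using assms(2) by (auto simp: rep_act_def unit_fun_def intro!: sum.cong)
  also have "\<dots> = entry A g M (diag_mset N)"
    using diag_mset_in_basis[OF assms(1)] finite_basis_matrix_poly_rep by simp
  finally show ?thesis using matrix_poly_entry_diag[OF assms(2,1)] by simp
qed

lemma gen_weight: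
  assumes "N \<in> Wts" shows "gen N \<in> weight_space n A N"
proof -
  have "rep_act A (mat_diag n x) (gen N) = fun_scale (mon x N) (gen N)" for x
  proof
    fix M
    show "rep_act A (mat_diag n x) (gen N) M = fun_scale (mon x N) (gen N) M"
    proof (cases "M \<in> basis A")
      case True
      have "rep_act A (mat_diag n x) (gen N) M =
        (\<Sum>L\<in>basis A. if L = diag_mset N then entry A (mat_diag n x) M (diag_mset N) else 0)"
        using True by (auto simp: rep_act_def unit_fun_def intro!: sum.cong)
      also have "\<dots> = entry A (mat_diag n x) M (diag_mset N)"
        using diag_mset_in_basis[OF assms] finite_basis_matrix_poly_rep by simp
      also have "\<dots> = (if M = diag_mset N then mon x N else 0)"
        using torus_weights_matrix_poly_rep[of n d] True diag_mset_in_basis[OF assms]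
        by (auto simp: torus_weights_def diag_mset_margins)
      finally show ?thesis by (simp add: unit_fun_def fun_scale_apply)
    next
      case False
      then show ?thesis using diag_mset_in_basis[OF assms] by (auto simp: rep_act_def unit_fun_def fun_scale_apply)
    qed
  qed
  then show ?thesis using unit_fun_in[OF diag_mset_in_basis[OF assms]] by (simp add: weight_space_def)
qed

text \<open>Let \<open>u\<close> in the column space be orthogonal to \<open>U\<close>. Pairing
  \<open>u\<close> with the translates of the generator gives a polynomial in \<open>g\<close> that
  vanishes on the group, and its coefficients are nonzero multiples of the conjugated coordinates of
  \<open>u\<close>.\<close>

lemma column_space_cyclic:
  assumes "N \<in> Wts" "subrep n A U" "U \<subseteq> C N" "gen N \<in> U"
  shows "U = C N"
proof -
  obtain q where q: "star_form n A q" using star_form_matrix_poly_rep by blast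
  note fin = finite_basis_matrix_poly_rep[of n d]
  have qp: "\<forall>i\<in>basis A. q i > 0" using star_formD(1)[OF q] by blast
  note p = orth_proj[OF fin qp subrepD(1,2)[OF assms(2)]]
  have "v \<in> U" if v: "v \<in> C N" for v
  proof -
    define u where "u = v - orth_proj q A U v"
    have u: "u \<in> C N" unfolding u_def
      using v p(1)[of v] assms(3) subrepD(1)[OF subrep_column_space] by (intro fs.subspace_diff) auto
    define F where "F = {M \<in> basis A. image_mset snd M = N}"
    have "u M = 0" if M: "M \<in> F" for M
    proof -
      let ?c = "\<lambda>M. of_real (q M) * column_coeff N M * cnj (u M)"
      have "?c M = 0"
      proof (rule mat_mon_independent[of F n ?c])
        show "finite F" using fin by (simp add: F_def)
        show "set_mset L \<subseteq> {..<n} \<times> {..<n}" if "L \<in> F" for L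
          using that by (auto simp: F_def basis_matrix_poly_rep multisets_of_size_def)
        fix g assume g: "g \<in> GL n"
        have "herm q (basis A) u (rep_act A g (gen N)) = 0"
          unfolding u_def using p(2) subrepD(3)[OF assms(2) g assms(4)] by blast
        then have "herm q (basis A) (rep_act A g (gen N)) u = 0" using herm_commute[of q "basis A" _ u] by simp
        moreover have "herm q (basis A) (rep_act A g (gen N)) u =
            (\<Sum>M\<in>basis A. if image_mset snd M = N then ?c M * mat_mon g M else 0)"
          unfolding herm_def by (intro sum.cong refl) (simp add: rep_act_gen[OF assms(1)] ac_simps)
        ultimately show "(\<Sum>M\<in>F. ?c M * mat_mon g M) = 0"
          using fin by (simp add: F_def sum.inter_filter)
      qed (rule M)
      then show ?thesis using M qp column_coeff_nonzero[of M N] by (auto simp: F_def)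
    qed
    moreover have "u M = 0" if "M \<notin> F" for M
      using that u by (auto simp: F_def column_space_def rep_space_def)
    ultimately have "u = 0" by (metis ext zero_fun_apply)
    then have "v = orth_proj q A U v" by (simp add: u_def)
    then show ?thesis using p(1) by metis
  qed
  then show ?thesis using assms(3) by blast
qed

lemma column_hom_eq_0:
  assumes "N \<in> Wts" "rep_hom n A (C N) R f" "f (gen N) = 0" "v \<in> C N"
  shows "f v = 0"
proof -
  have "{v \<in> C N. f v = 0} = C N"
    using column_space_cyclic[OF assms(1) subrep_kernel[OF assms(2) subrep_column_space]]
      gen_in_column_space[OF assms(1)] assms(3) by blast
  then show ?thesis using assms(4) by blast
qed

lemma mat_mon_mult_diag:
  assumes "set_mset M \<subseteq> {..<n} \<times> {..<n}" "g \<in> GL n"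
  shows "mat_mon (g * mat_diag n x) M = mat_mon g M * mon x (image_mset snd M)"
proof -
  have "mat_mon (g * mat_diag n x) M = mon (\<lambda>p. g $$ p * x (snd p)) M"
    using assms(1) by (intro mon_cong) (auto simp: mat_diag_mult_right[OF GL_carrier[OF assms(2)]])
  then show ?thesis by (simp add: mon_mult mon_image)
qed

text \<open>
  A weight vector \<open>v\<close> of weight \<open>N\<close> extends to a homomorphism on the polynomial functions of column
  degree \<open>N\<close>, since \<open>g \<mapsto> g v\<close> is itself homogeneous of degree \<open>N\<close> in the columns of \<open>g\<close>.
\<close>

lemma column_hom_exists:
  fixes R :: "'i gl_rep"
  assumes "polynomial_rep n R" "N \<in> Wts" "subrep n R U" "v \<in> U" "v \<in> weight_space n R N"
  shows "\<exists>f. rep_hom n A (C N) R f \<and> f (gen N) = v \<and> f ` C N \<subseteq> U"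
proof -
  have rep: "is_rep n R" using assms(1) by (simp add: polynomial_rep_def)
  have vR: "v \<in> rep_space R" using assms(5) by (rule weight_spaceD(1))
  obtain F c where F: "finite F" "\<forall>M\<in>F. set_mset M \<subseteq> {..<n} \<times> {..<n}"
    and c: "\<forall>i\<in>basis R. \<forall>j\<in>basis R. \<forall>g\<in>GL n. entry R g i j = (\<Sum>M\<in>F. c i j M * mat_mon g M)"
    using polynomial_rep_expand[OF assms(1)] .
  define r where "r = (\<lambda>M i. if i \<in> basis R then \<Sum>j\<in>basis R. c i j M * v j else 0)"
  have act0: "rep_act R g v = (\<Sum>M\<in>F. fun_scale (mat_mon g M) (r M))" if g: "g \<in> GL n" for g
  proof
    fix i
    show "rep_act R g v i = (\<Sum>M\<in>F. fun_scale (mat_mon g M) (r M)) i"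
    proof (cases "i \<in> basis R")
      case True
      have "rep_act R g v i = (\<Sum>j\<in>basis R. \<Sum>M\<in>F. mat_mon g M * (c i j M * v j))"
        using True c g by (simp add: rep_act_def sum_distrib_right sum_distrib_left ac_simps)
      also have "\<dots> = (\<Sum>M\<in>F. \<Sum>j\<in>basis R. mat_mon g M * (c i j M * v j))" by (rule sum.swap)
      finally show ?thesis using True by (simp add: r_def fun_scale_apply sum_distrib_left)
    qed (simp add: rep_act_def r_def fun_scale_apply)
  qed
  define G where "G = {M \<in> F. image_mset snd M = N}"
  \<comment> \<open>Replacing \<open>g\<close> by \<open>g\<close> times a diagonal matrix
    multiplies a monomial by its column degrees and multiplies \<open>g v\<close> by the monomial of
    \<open>N\<close>; comparing coefficients leaves only the monomials with column degrees
    \<open>N\<close>.\<close>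
  have act: "rep_act R g v = (\<Sum>M\<in>G. fun_scale (mat_mon g M) (r M))" if g: "g \<in> GL n" for g
  proof -
    define h where "h = (\<lambda>K. (\<Sum>M\<in>{M \<in> F. image_mset snd M = K}. fun_scale (mat_mon g M) (r M)) -
      (if K = N then rep_act R g v else 0))"
    let ?K = "insert N (image_mset snd ` F)"
    have "h N = 0"
    proof (rule mon_fun_independent[of ?K h])
      fix x :: "nat \<Rightarrow> complex" assume x: "\<forall>i. x i \<noteq> 0"
      have dx: "mat_diag n x \<in> GL n" using x by (intro GL_diag) simp
      have "fun_scale (mon x N) (rep_act R g v) = rep_act R g (rep_act R (mat_diag n x) v)"
        using weight_spaceD(2)[OF assms(5) x] by (simp add: lin_scale[OF lin_rep_act])
      also have "\<dots> = rep_act R (g * mat_diag n x) v" using rep_act_mult[OF rep g dx] by simp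
      also have "\<dots> = (\<Sum>M\<in>F. fun_scale (mon x (image_mset snd M)) (fun_scale (mat_mon g M) (r M)))"
        unfolding act0[OF GL_mult[OF g dx]] using F(2) g
        by (intro sum.cong refl) (simp add: mat_mon_mult_diag mult.commute)
      also have "\<dots> = (\<Sum>K\<in>?K. \<Sum>M\<in>{M \<in> F. image_mset snd M = K}. fun_scale (mon x (image_mset snd M)) (fun_scale (mat_mon g M) (r M)))"
        using F(1) by (intro sum.group[symmetric]) auto
      also have "\<dots> = (\<Sum>K\<in>?K. fun_scale (mon x K) (\<Sum>M\<in>{M \<in> F. image_mset snd M = K}. fun_scale (mat_mon g M) (r M)))"
        unfolding fs.scale_sum_right by (intro sum.cong refl) auto
      finally have e: "fun_scale (mon x N) (rep_act R g v) =
        (\<Sum>K\<in>?K. fun_scale (mon x K) (\<Sum>M\<in>{M \<in> F. image_mset snd M = K}. fun_scale (mat_mon g M) (r M)))" .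
      have "(\<Sum>K\<in>?K. fun_scale (mon x K) (h K)) =
        (\<Sum>K\<in>?K. fun_scale (mon x K) (\<Sum>M\<in>{M \<in> F. image_mset snd M = K}. fun_scale (mat_mon g M) (r M))) -
        (\<Sum>K\<in>?K. if K = N then fun_scale (mon x N) (rep_act R g v) else 0)"
        unfolding sum_subtractf[symmetric] h_def
        by (intro sum.cong refl) (simp add: fs.scale_right_diff_distrib)
      also have "(\<Sum>K\<in>?K. if K = N then fun_scale (mon x N) (rep_act R g v) else 0) = fun_scale (mon x N) (rep_act R g v)"
        using F(1) by simp
      finally show "(\<Sum>K\<in>?K. fun_scale (mon x K) (h K)) = 0" unfolding e by (simp only: diff_self)
    qed (use F in auto)
    then show ?thesis unfolding h_def G_def by simp
  qed
  have GA: "M \<in> basis A" "image_mset snd M = N" if "M \<in> G" for M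
  proof -
    show s: "image_mset snd M = N" using that by (simp add: G_def)
    have "size M = size N" using s by (metis size_image_mset)
    then show "M \<in> basis A" using that F(2) assms(2) by (auto simp: G_def basis_matrix_poly_rep multisets_of_size_def)
  qed
  \<comment> \<open>Chosen so that the translate of the generator by \<open>g\<close> goes to the
    translate of \<open>v\<close> by \<open>g\<close>: the coordinates of the former are the
    monomials in \<open>g\<close> up to \<open>column_coeff\<close>, and \<open>r\<close> collects
    the coefficients of the latter.\<close>
  define f where "f = (\<lambda>w. \<Sum>M\<in>G. fun_scale (w M / column_coeff N M) (r M))"
  have lf: "lin f"
    by (rule linI) (simp_all add: f_def add_divide_distrib fs.scale_left_distrib sum.distrib fs.scale_sum_right fun_scale_apply)
  have fgen: "f (rep_act A g (gen N)) = rep_act R g v" if g: "g \<in> GL n" for g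
    unfolding f_def act[OF g]
  proof (intro sum.cong refl)
    fix M assume M: "M \<in> G"
    show "fun_scale (rep_act A g (gen N) M / column_coeff N M) (r M) = fun_scale (mat_mon g M) (r M)"
      using column_coeff_nonzero[OF GA(2)[OF M]] GA(2)[OF M] by (simp add: rep_act_gen[OF assms(2) GA(1)[OF M]])
  qed
  have genA: "gen N \<in> rep_space A" using gen_in_column_space[OF assms(2)] by (simp add: column_space_def)
  have f1: "f (gen N) = v"
    using fgen[OF GL_one] rep_act_one[OF is_rep_matrix_poly_rep genA] rep_act_one[OF rep vR] by simp
  \<comment> \<open>The vectors on which \<open>f\<close> behaves as required form a
    subrepresentation containing the generator, hence the whole column space.\<close>
  define Z where "Z = {w \<in> C N. f w \<in> U \<and> (\<forall>h\<in>GL n. f (rep_act A h w) = rep_act R h (f w))}"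
  have "subrep n A Z" unfolding subrep_def
  proof (intro conjI ballI)
    note sC = subrepD[OF subrep_column_space[of N]]
    note sU = subrepD[OF assms(3)]
    show "fs.subspace Z"
      by (rule fs.subspaceI)
        (auto simp: Z_def lin_0[OF lf] lin_0[OF lin_rep_act] lin_add[OF lf] lin_add[OF lin_rep_act]
          lin_scale[OF lf] lin_scale[OF lin_rep_act] sC(4) sU(4) fs.subspace_add[OF sC(1)] fs.subspace_add[OF sU(1)]
          fs.subspace_scale[OF sC(1)] fs.subspace_scale[OF sU(1)])
    show "Z \<subseteq> rep_space A" by (auto simp: Z_def column_space_def)
    fix g w assume g: "g \<in> GL n" and w: "w \<in> Z"
    have "f (rep_act A h (rep_act A g w)) = rep_act R h (f (rep_act A g w))" if h: "h \<in> GL n" for h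
    proof -
      have "f (rep_act A h (rep_act A g w)) = f (rep_act A (h * g) w)"
        using rep_act_mult[OF is_rep_matrix_poly_rep h g] by simp
      also have "\<dots> = rep_act R (h * g) (f w)" using w GL_mult[OF h g] by (simp add: Z_def)
      also have "\<dots> = rep_act R h (rep_act R g (f w))" by (rule rep_act_mult[OF rep h g])
      also have "rep_act R g (f w) = f (rep_act A g w)" using w g by (simp add: Z_def)
      finally show ?thesis .
    qed
    then show "rep_act A g w \<in> Z" using w g sC(3)[OF g] sU(3)[OF g] by (simp add: Z_def)
  qed
  moreover have "gen N \<in> Z"
    using gen_in_column_space[OF assms(2)] f1 fgen assms(4) by (simp add: Z_def)
  ultimately have "Z = C N" using column_space_cyclic[OF assms(2)] by (auto simp: Z_def)
  then have "rep_hom n A (C N) R f" "f ` C N \<subseteq> U" using lf by (auto simp: rep_hom_def Z_def)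
  then show ?thesis using f1 by blast
qed

text \<open>Vectors of weight \<open>N\<close> in \<open>U\<close> are the values at the generator
  of homomorphisms from the column space to \<open>U\<close>. By Schur's lemma these are
  combinations of the projections to the summands isomorphic to \<open>U\<close>, each followed by a
  fixed isomorphism.\<close>

lemma weight_dim_eq_multiplicity:
  fixes R :: "'i gl_rep"
  assumes "polynomial_rep n R" "N \<in> Wts" "irreducible_subrep n R U"
    "star_form n A q" "orthogonal_decomposition n A q (C N) D"
  shows "weight_dim n R U N = card {W \<in> D. rep_equiv n A W R U}"
proof -
  let ?p = "orth_proj q A"
  note fin = finite_basis_matrix_poly_rep[of n d]
  have qp: "\<forall>i\<in>basis A. q i > 0" using star_formD(1)[OF assms(4)] by blast
  have finD: "finite D" using assms(5) by (simp add: orthogonal_decomposition_def)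
  have irrD: "irreducible_subrep n A W" "subrep n A W" "W \<subseteq> C N" if "W \<in> D" for W
    using assms(5) that by (auto simp: orthogonal_decomposition_def irreducible_subrep_def)
  have orth: "?p W' v = 0" if "W \<in> D" "W' \<in> D" "W \<noteq> W'" "v \<in> W" for W W' v
    using assms(5) that unfolding orthogonal_decomposition_def by blast
  have pl: "lin (?p W)" and pin: "?p W v \<in> W" and pid: "v \<in> W \<Longrightarrow> ?p W v = v"
    and peq: "g \<in> GL n \<Longrightarrow> ?p W (rep_act A g v) = rep_act A g (?p W v)" if "W \<in> D" for W v g
    using lin_orth_proj[OF fin qp subrepD(1,2)[OF irrD(2)[OF that]]]
      orth_proj(1)[OF fin qp subrepD(1,2)[OF irrD(2)[OF that]]]
      orth_proj_id[OF fin qp subrepD(1,2)[OF irrD(2)[OF that]]]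
      orth_proj_equivariant[OF fin assms(4) irrD(2)[OF that]] by auto
  have sU: "subrep n R U" using assms(3) by (simp add: irreducible_subrep_def)
  define J where "J = {W \<in> D. rep_equiv n A W R U}"
  have JD: "J \<subseteq> D" and finJ: "finite J" using finD by (auto simp: J_def)
  have "\<exists>f. rep_hom n A W R f \<and> bij_betw f W U" if "W \<in> J" for W using that by (simp add: J_def rep_equiv_def)
  then obtain \<phi> where \<phi>: "\<And>W. W \<in> J \<Longrightarrow> rep_hom n A W R (\<phi> W) \<and> bij_betw (\<phi> W) W U" by metis
  have l\<phi>: "lin (\<phi> W)" if "W \<in> J" for W using \<phi>[OF that] by (simp add: rep_hom_def)
  let ?e = "gen N"
  let ?b = "\<lambda>W. \<phi> W (?p W ?e)"
  have eC: "?e \<in> C N" using gen_in_column_space[OF assms(2)] .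
  have "weight_dim n R U N = card J" unfolding weight_dim_def
  proof (rule dim_eq_card_family[where b = ?b])
    show "finite J" by (rule finJ)
    fix W assume W: "W \<in> J"
    then have WD: "W \<in> D" using JD by blast
    have "rep_act R (mat_diag n x) (?b W) = fun_scale (mon x N) (?b W)" if x: "\<forall>i. x i \<noteq> 0" for x
    proof -
      have dx: "mat_diag n x \<in> GL n" using x by (intro GL_diag) simp
      have "rep_act R (mat_diag n x) (?b W) = \<phi> W (rep_act A (mat_diag n x) (?p W ?e))"
        using \<phi>[OF W] pin[OF WD] dx by (simp add: rep_hom_def)
      also have "\<dots> = \<phi> W (?p W (rep_act A (mat_diag n x) ?e))" using peq[OF WD dx] by simp
      also have "\<dots> = \<phi> W (?p W (fun_scale (mon x N) ?e))"
        using weight_spaceD(2)[OF gen_weight[OF assms(2)] x] by simp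
      finally show ?thesis by (simp add: lin_scale[OF pl[OF WD]] lin_scale[OF l\<phi>[OF W]])
    qed
    moreover have "?b W \<in> U" using \<phi>[OF W] pin[OF WD] by (auto simp: bij_betw_def)
    ultimately show "?b W \<in> U \<inter> weight_space n R N" using subrepD(2)[OF sU] by (auto simp: weight_space_def)
  next
    fix v assume v: "v \<in> U \<inter> weight_space n R N"
    then obtain f where f: "rep_hom n A (C N) R f" "f ?e = v" "f ` C N \<subseteq> U"
      using column_hom_exists[OF assms(1,2) sU] by blast
    have lf: "lin f" using f(1) by (simp add: rep_hom_def)
    have hW: "rep_hom n A W R f" "f ` W \<subseteq> U" if "W \<in> D" for W
      using f(1,3) irrD(3)[OF that] by (auto simp: rep_hom_def)
    \<comment> \<open>A nonzero value would make \<open>f\<close> an isomorphism from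
      \<open>W\<close> onto \<open>U\<close>.\<close>
    have zero: "f (?p W ?e) = 0" if W: "W \<in> D" "W \<notin> J" for W
    proof (rule ccontr)
      assume "f (?p W ?e) \<noteq> 0"
      then have "bij_betw f W U" using schur_bij[OF irrD(1)[OF W(1)] assms(3) hW[OF W(1)] pin[OF W(1)]] by blast
      then show False using W hW(1)[OF W(1)] by (auto simp: J_def rep_equiv_def)
    qed
    have "\<exists>c. f (?p W ?e) = fun_scale c (?b W)" if W: "W \<in> J" for W
    proof -
      have WD: "W \<in> D" using W JD by blast
      have injW: "inj_on (\<phi> W) W" and imW: "\<phi> W ` W = U" using \<phi>[OF W] by (auto simp: bij_betw_def)
      \<comment> \<open>An inverse of the fixed isomorphism, so that composing it with
        \<open>f\<close> gives an endomorphism of \<open>W\<close>, to which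
        \<open>schur_scalar\<close> applies.\<close>
      obtain h where h: "lin h" "\<forall>w\<in>W. h (\<phi> W w) = w"
        using fsp.linear_exists_left_inverse_on[OF l\<phi>[OF W] subrepD(1)[OF irrD(2)[OF WD]] injW] by blast
      have hU: "h u \<in> W" "\<phi> W (h u) = u" if "u \<in> U" for u
      proof -
        obtain w where w: "w \<in> W" "u = \<phi> W w" using \<open>u \<in> U\<close> imW by blast
        then show "h u \<in> W" "\<phi> W (h u) = u" using h(2) by simp_all
      qed
      have hh: "rep_hom n R U A h" unfolding rep_hom_def
      proof (intro conjI ballI)
        show "lin h" by (rule h(1))
        fix g u assume g: "g \<in> GL n" and u: "u \<in> U"
        have "rep_act R g u = \<phi> W (rep_act A g (h u))" using \<phi>[OF W] hU[OF u] g by (simp add: rep_hom_def)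
        then show "h (rep_act R g u) = rep_act A g (h u)"
          using h(2) subrepD(3)[OF irrD(2)[OF WD] g hU(1)[OF u]] by simp
      qed
      have "rep_hom n A W A (h \<circ> f)" using rep_hom_comp[OF hW(1)[OF WD] hh hW(2)[OF WD]] .
      moreover have "(h \<circ> f) ` W \<subseteq> W" using hW(2)[OF WD] hU(1) by auto
      ultimately obtain c where c: "\<forall>w\<in>W. (h \<circ> f) w = fun_scale c w"
        using schur_scalar[OF fin irrD(1)[OF WD]] by blast
      have "f (?p W ?e) \<in> U" using hW(2)[OF WD] pin[OF WD] by blast
      then have "f (?p W ?e) = \<phi> W (h (f (?p W ?e)))" using hU(2) by simp
      also have "h (f (?p W ?e)) = fun_scale c (?p W ?e)" using c pin[OF WD] by simp
      also have "\<phi> W (fun_scale c (?p W ?e)) = fun_scale c (?b W)" by (rule lin_scale[OF l\<phi>[OF W]])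
      finally show ?thesis by blast
    qed
    then obtain c where c: "\<And>W. W \<in> J \<Longrightarrow> f (?p W ?e) = fun_scale (c W) (?b W)" by metis
    have "?e = (\<Sum>W\<in>D. ?p W ?e)" using assms(5) eC by (simp add: orthogonal_decomposition_def)
    then have "v = (\<Sum>W\<in>D. f (?p W ?e))" using f(2) lin_sum[OF lf] by metis
    also have "\<dots> = (\<Sum>W\<in>J. f (?p W ?e))" using finD JD zero by (intro sum.mono_neutral_right) auto
    also have "\<dots> = (\<Sum>W\<in>J. fun_scale (c W) (?b W))" using c by simp
    finally show "\<exists>c. v = (\<Sum>W\<in>J. fun_scale (c W) (?b W))" by blast
  next
    fix c assume c0: "(\<Sum>W\<in>J. fun_scale (c W) (?b W)) = 0"
    \<comment> \<open>The same combination taken of homomorphisms instead of their values at the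
      generator. It kills the generator, hence the whole column space; on the summand
      \<open>W\<close> it is \<open>c W\<close> times an isomorphism.\<close>
    define F where "F = (\<lambda>w. \<Sum>W\<in>J. fun_scale (c W) (\<phi> W (?p W w)))"
    have JDD: "W \<in> D" if "W \<in> J" for W using that JD by blast
    have "lin F" unfolding F_def
      by (rule linI) (simp_all add: lin_add[OF pl[OF JDD]] lin_add[OF l\<phi>] lin_scale[OF pl[OF JDD]] lin_scale[OF l\<phi>]
          fs.scale_right_distrib sum.distrib fs.scale_sum_right mult.commute)
    moreover have "F (rep_act A g w) = rep_act R g (F w)" if g: "g \<in> GL n" for g w
    proof -
      have "\<phi> W (?p W (rep_act A g w)) = rep_act R g (\<phi> W (?p W w))" if "W \<in> J" for W
        using peq[OF JDD[OF that] g] \<phi>[OF that] pin[OF JDD[OF that]] g by (simp add: rep_hom_def)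
      then show ?thesis unfolding F_def by (simp add: lin_sum[OF lin_rep_act] lin_scale[OF lin_rep_act])
    qed
    ultimately have hF: "rep_hom n A (C N) R F" by (simp add: rep_hom_def)
    have Fe: "F ?e = 0" using c0 by (simp add: F_def)
    show "\<forall>W\<in>J. c W = 0"
    proof
      fix W assume W: "W \<in> J"
      obtain w where w: "w \<in> W" "w \<noteq> 0"
        using nonzero_vector[OF subrepD(4)[OF irrD(2)[OF JDD[OF W]]]] irrD(1)[OF JDD[OF W]]
        by (auto simp: irreducible_subrep_def)
      have "0 = F w" using column_hom_eq_0[OF assms(2) hF Fe] irrD(3)[OF JDD[OF W]] w(1) by auto
      also have "\<dots> = (\<Sum>W'\<in>J. if W' = W then fun_scale (c W) (\<phi> W w) else 0)" unfolding F_def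
      proof (intro sum.cong refl)
        fix W' assume W': "W' \<in> J"
        show "fun_scale (c W') (\<phi> W' (?p W' w)) = (if W' = W then fun_scale (c W) (\<phi> W w) else 0)"
        proof (cases "W' = W")
          case True
          then show ?thesis using pid[OF JDD[OF W] w(1)] by simp
        next
          case False
          then have "?p W' w = 0" using orth[OF JDD[OF W] JDD[OF W'] _ w(1)] by blast
          then show ?thesis using False lin_0[OF l\<phi>[OF W']] by simp
        qed
      qed
      also have "\<dots> = fun_scale (c W) (\<phi> W w)" using finJ W by simp
      finally have "fun_scale (c W) (\<phi> W w) = 0" by simp
      moreover have "\<phi> W w \<noteq> 0"
      proof
        assume "\<phi> W w = 0"
        then have "\<phi> W w = \<phi> W 0" using lin_0[OF l\<phi>[OF W]] by simp
        moreover have "inj_on (\<phi> W) W" using \<phi>[OF W] by (simp add: bij_betw_def)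
        ultimately show False using w inj_onD[of "\<phi> W" W w 0] subrepD(4)[OF irrD(2)[OF JDD[OF W]]] by simp
      qed
      ultimately show "c W = 0" by (simp add: fs.scale_eq_0_iff)
    qed
  qed
  then show ?thesis by (simp add: J_def)
qed

end

section \<open>Irreducible polynomial representations\<close>

lemma mon_inject:
  assumes "\<And>x. \<forall>p. x p \<noteq> 0 \<Longrightarrow> mon x M = mon x N"
  shows "M = N"
proof (rule ccontr)
  assume "M \<noteq> N"
  have "(if M = M then 1 else - 1 :: complex) = 0"
    by (rule mon_independent[of "{M,N}" "\<lambda>K. if K = M then 1 else - 1"])
      (use assms \<open>M \<noteq> N\<close> in auto)
  then show False by simp
qed

lemma rep_act_diag:
  assumes "finite (basis R)" "torus_weights n R wt" "i \<in> basis R"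
  shows "rep_act R (mat_diag n x) v i = mon x (wt i) * v i"
proof -
  have "rep_act R (mat_diag n x) v i = (\<Sum>j\<in>basis R. if j = i then mon x (wt i) * v i else 0)"
    using assms(2,3) by (auto simp: rep_act_def torus_weights_def intro!: sum.cong)
  then show ?thesis using assms(1,3) by simp
qed

lemma weight_vector_support:
  assumes "finite (basis R)" "torus_weights n R wt" "v \<in> weight_space n R N" "v i \<noteq> 0"
  shows "i \<in> basis R" "wt i = N"
proof -
  show i: "i \<in> basis R" using assms(3,4) by (auto simp: weight_space_def rep_space_def)
  show "wt i = N"
  proof (rule mon_inject)
    fix x :: "nat \<Rightarrow> complex" assume x: "\<forall>p. x p \<noteq> 0"
    have "mon x (wt i) * v i = mon x N * v i"
      using weight_spaceD(2)[OF assms(3) x] rep_act_diag[OF assms(1,2) i, of x v] by (metis fun_scale_apply)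
    then show "mon x (wt i) = mon x N" using assms(4) by simp
  qed
qed

lemma weight_dim_coordinates:
  assumes "finite (basis R)" "torus_weights n R wt" "B \<subseteq> basis R"
  shows "weight_dim n R {v \<in> rep_space R. \<forall>i. i \<notin> B \<longrightarrow> v i = 0} N = card {i \<in> B. wt i = N}"
  unfolding weight_dim_def
proof (rule dim_eq_card_family[where b = unit_fun])
  let ?J = "{i \<in> B. wt i = N}"
  show finJ: "finite ?J" using assms(1,3) finite_subset by fastforce
  have ev: "(\<Sum>j\<in>?J. fun_scale (c j) (unit_fun j)) i = (if i \<in> ?J then c i else 0)" for c and i
  proof -
    have "(\<Sum>j\<in>?J. fun_scale (c j) (unit_fun j)) i = (\<Sum>j\<in>?J. if j = i then c i else 0)"
      unfolding sum_fun_apply by (intro sum.cong) (auto simp: fun_scale_apply unit_fun_def)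
    then show ?thesis using finJ by (simp only: sum.delta)
  qed
  show "unit_fun i \<in> {v \<in> rep_space R. \<forall>i. i \<notin> B \<longrightarrow> v i = 0} \<inter> weight_space n R N" if "i \<in> ?J" for i
  proof -
    have i: "i \<in> basis R" "i \<in> B" "wt i = N" using that assms(3) by auto
    have "rep_act R (mat_diag n x) (unit_fun i) = fun_scale (mon x N) (unit_fun i)" for x
    proof
      fix j
      show "rep_act R (mat_diag n x) (unit_fun i) j = fun_scale (mon x N) (unit_fun i) j"
        using rep_act_diag[OF assms(1,2), of j x "unit_fun i"] i
        by (cases "j \<in> basis R") (auto simp: rep_act_def fun_scale_apply unit_fun_def)
    qed
    then show ?thesis using unit_fun_in[OF i(1)] i(2) by (auto simp: weight_space_def unit_fun_def)
  qed
  show "\<exists>c. v = (\<Sum>j\<in>?J. fun_scale (c j) (unit_fun j))"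
    if v: "v \<in> {v \<in> rep_space R. \<forall>i. i \<notin> B \<longrightarrow> v i = 0} \<inter> weight_space n R N" for v
  proof -
    have "v = (\<Sum>j\<in>?J. fun_scale (v j) (unit_fun j))"
    proof
      fix i
      have "v i = 0" if "i \<notin> ?J"
        using that v weight_vector_support(2)[OF assms(1,2), of v N i] by blast
      then show "v i = (\<Sum>j\<in>?J. fun_scale (v j) (unit_fun j)) i" unfolding ev by simp
    qed
    then show ?thesis by (rule exI[of _ v])
  qed
  show "\<forall>j\<in>?J. c j = 0" if c: "(\<Sum>j\<in>?J. fun_scale (c j) (unit_fun j)) = 0" for c
  proof
    fix i assume "i \<in> ?J"
    then show "c i = 0" using ev[of c i] c by simp
  qed
qed

lemma weight_dim_rep_space:
  assumes "finite (basis R)" "torus_weights n R wt"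
  shows "weight_dim n R (rep_space R) N = card {i \<in> basis R. wt i = N}"
proof -
  have "{v \<in> rep_space R. \<forall>i. i \<notin> basis R \<longrightarrow> v i = 0} = rep_space R" by (auto simp: rep_space_def)
  then show ?thesis using weight_dim_coordinates[OF assms order_refl, of N] by simp
qed

section \<open>Unitriangularity of the Kostka matrix and types of irreducibles\<close>

definition shape_mset :: "nat \<Rightarrow> (nat \<Rightarrow> nat) \<Rightarrow> nat multiset" where
  "shape_mset n f = (\<Sum>i<n. replicate_mset (f i) i)"

lemma count_shape_mset: "i < n \<Longrightarrow> count (shape_mset n f) i = f i"
  by (simp add: shape_mset_def count_sum count_replicate_mset if_distrib cong: if_cong)

lemma shape_mset_in:
  assumes "f \<in> parts n" shows "shape_mset n f \<in> multisets_of_size {..<n} (weight f)"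
proof -
  have "size (shape_mset n f) = (\<Sum>i<n. f i)" by (simp add: shape_mset_def)
  also have "\<dots> = weight f" using assms by (subst weight_eq[of n]) (auto simp: parts_zero)
  finally have "size (shape_mset n f) = weight f" .
  moreover have "set_mset (shape_mset n f) \<subseteq> {..<n}"
    unfolding shape_mset_def by (auto simp: set_mset_sum split: if_splits)
  ultimately show ?thesis by (simp add: multisets_of_size_def)
qed

text \<open>The sum of the partial sums of \<open>f\<close>, hence strictly increasing in the dominance order.\<close>

definition height :: "nat \<Rightarrow> (nat \<Rightarrow> nat) \<Rightarrow> nat" where
  "height n f = (\<Sum>i<n. (n - i) * f i)"

lemma kostka_shape: "f \<in> parts n \<Longrightarrow> kostka n f (shape_mset n f) = 1"
  by (rule kostka_diag) (simp_all add: count_shape_mset)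

lemma kostka_height:
  assumes "f \<in> parts n" "g \<in> parts n" "kostka n g (shape_mset n f) \<noteq> 0"
  shows "g = f \<or> height n f < height n g"
proof -
  have c: "(\<Sum>i<n. (n - i) * count (shape_mset n f) i) = height n f"
    unfolding height_def by (intro sum.cong) (auto simp: count_shape_mset)
  have d: "height n f \<le> height n g \<and> (height n f = height n g \<longrightarrow> (\<forall>i<n. f i = g i))"
    using kostka_dominance[OF assms(2,3)] unfolding c by (auto simp: height_def[symmetric] count_shape_mset)
  moreover have "g = f" if "\<forall>i<n. f i = g i"
  proof
    fix i show "g i = f i"
      using that parts_zero[OF assms(1), of i] parts_zero[OF assms(2), of i] by (cases "i < n") auto
  qed
  ultimately show ?thesis by fastforce
qed

lemma finite_parts_eq: "finite {f \<in> parts n. weight f = d}"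
  by (rule finite_subset[OF _ finite_parts[of n d]]) auto

text \<open>Among the shapes with nonzero coefficient take one of maximal height: at its own content
  no other of them contributes. Coefficients are integers because the lemma is applied to a
  difference of multiplicities.\<close>

lemma kostka_independent:
  fixes a :: "(nat \<Rightarrow> nat) \<Rightarrow> int"
  assumes "\<And>N. N \<in> multisets_of_size {..<n} d \<Longrightarrow>
      (\<Sum>f\<in>{f \<in> parts n. weight f = d}. a f * int (kostka n f N)) = 0"
    and "f \<in> parts n" "weight f = d"
  shows "a f = 0"
proof (rule ccontr)
  let ?P = "{f \<in> parts n. weight f = d}"
  assume "a f \<noteq> 0"
  then have "{g \<in> ?P. a g \<noteq> 0} \<noteq> {}" using assms(2,3) by blast
  moreover have fin: "finite {g \<in> ?P. a g \<noteq> 0}" by (rule finite_subset[OF _ finite_parts_eq[of n d]]) auto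
  ultimately obtain g where g: "g \<in> ?P" "a g \<noteq> 0" "\<And>h. h \<in> ?P \<Longrightarrow> a h \<noteq> 0 \<Longrightarrow> height n h \<le> height n g"
  proof -
    let ?S = "{g \<in> ?P. a g \<noteq> 0}"
    assume ne: "?S \<noteq> {}"
    have "Max (height n ` ?S) \<in> height n ` ?S" using fin ne by (intro Max_in) auto
    then obtain g0 where g0: "Max (height n ` ?S) = height n g0" "g0 \<in> ?S" by (elim imageE)
    have "height n h \<le> Max (height n ` ?S)" if "h \<in> ?S" for h using fin that by (intro Max_ge) auto
    then have "height n h \<le> height n g0" if "h \<in> ?P" "a h \<noteq> 0" for h using that g0(1) by auto
    then show ?thesis using that[of g0] g0(2) by blast
  qed
  have "(\<Sum>h\<in>?P. a h * int (kostka n h (shape_mset n g))) = (\<Sum>h\<in>?P. if h = g then a g else 0)"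
  proof (intro sum.cong refl)
    fix h assume h: "h \<in> ?P"
    show "a h * int (kostka n h (shape_mset n g)) = (if h = g then a g else 0)"
    proof (cases "h = g")
      case True
      then show ?thesis using kostka_shape[of g n] g(1) by simp
    next
      case False
      then have "kostka n h (shape_mset n g) = 0 \<or> a h = 0"
        using kostka_height[of g n h] g(1) h g(3)[OF h] by fastforce
      then show ?thesis using False by auto
    qed
  qed
  also have "\<dots> = a g" using finite_parts_eq[of n d] g(1) by (simp only: sum.delta if_True)
  finally show False using assms(1)[of "shape_mset n g"] shape_mset_in[of g n] g by simp
qed

text \<open>
  \<open>I\<close> is a set of representatives of the irreducible constituents, and \<open>\<pi>\<close> sends each of them to the
  partition whose Schur polynomial is its character.
\<close>

definition type_system :: "nat \<Rightarrow> nat \<Rightarrow> ((nat \<times> nat) multiset \<Rightarrow> real) \<Rightarrow> ((nat \<times> nat) multiset \<Rightarrow> complex) set set \<Rightarrow>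
    (((nat \<times> nat) multiset \<Rightarrow> complex) set \<Rightarrow> nat \<Rightarrow> nat) \<Rightarrow> bool" where
  "type_system n d q I \<pi> \<longleftrightarrow> star_form n (matrix_poly_rep n d) q \<and>
     bij_betw \<pi> I {f \<in> parts n. weight f = d} \<and>
     (\<forall>S\<in>I. irreducible_subrep n (matrix_poly_rep n d) S \<and>
        (\<forall>N\<in>multisets_of_size {..<n} d. weight_dim n (matrix_poly_rep n d) S N = kostka n (\<pi> S) N)) \<and>
     (\<forall>N\<in>multisets_of_size {..<n} d. \<exists>D. orthogonal_decomposition n (matrix_poly_rep n d) q (column_space n d N) D \<and>
        (\<forall>X\<in>D. \<exists>S\<in>I. rep_equiv n (matrix_poly_rep n d) X (matrix_poly_rep n d) S))"

text \<open>The monomials are weight vectors, so this is a count of matrices with given margins, and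
  the same count as in \<open>kostka_cauchy\<close>.\<close>

lemma weight_dim_column_space:
  "weight_dim n (matrix_poly_rep n d) (column_space n d M) N =
    card {A \<in> multisets_of_size ({..<n} \<times> {..<n}) d. image_mset snd A = M \<and> image_mset fst A = N}"
proof -
  let ?R = "matrix_poly_rep n d"
  let ?B = "{A \<in> basis ?R. image_mset snd A = M}"
  have "column_space n d M = {v \<in> rep_space ?R. \<forall>A. A \<notin> ?B \<longrightarrow> v A = 0}"
    by (auto simp: column_space_def rep_space_def)
  then have "weight_dim n ?R (column_space n d M) N = card {A \<in> ?B. image_mset fst A = N}"
    using weight_dim_coordinates[OF finite_basis_matrix_poly_rep torus_weights_matrix_poly_rep, of ?B n d N] by simp
  moreover have "{A \<in> ?B. image_mset fst A = N} =
      {A \<in> multisets_of_size ({..<n} \<times> {..<n}) d. image_mset snd A = M \<and> image_mset fst A = N}"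
    by (auto simp: basis_matrix_poly_rep)
  ultimately show ?thesis by simp
qed

text \<open>One representative is taken from each isomorphism class of summands of the column
  spaces, and the multiplicities of its weights are compared with the Kostka numbers through their
  Gram matrices.\<close>

lemma type_system_exists: "\<exists>q I \<pi>. type_system n d q I \<pi>"
proof -
  let ?R = "matrix_poly_rep n d" and ?W = "multisets_of_size {..<n} d" and ?P = "{f \<in> parts n. weight f = d}"
  note fin = finite_basis_matrix_poly_rep[of n d]
  obtain q where q: "star_form n ?R q" using star_form_matrix_poly_rep by blast
  have "\<exists>D. orthogonal_decomposition n ?R q (column_space n d N) D" for N
    by (rule complete_reducibility[OF fin q subrep_column_space])
  then obtain D where D: "\<And>N. orthogonal_decomposition n ?R q (column_space n d N) (D N)" by metis
  have irrD: "irreducible_subrep n ?R X" if "X \<in> D N" for X N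
    using D[of N] that by (simp add: orthogonal_decomposition_def)
  have finD: "finite (D N)" for N using D[of N] by (simp add: orthogonal_decomposition_def)
  define DD where "DD = (\<Union>N\<in>?W. D N)"
  have finDD: "finite DD" using finD by (auto simp: DD_def)
  have irrDD: "irreducible_subrep n ?R X" if "X \<in> DD" for X using that irrD by (auto simp: DD_def)
  have subDD: "subrep n ?R X" if "X \<in> DD" for X using irrDD[OF that] by (simp add: irreducible_subrep_def)
  let ?eq = "\<lambda>X Y. rep_equiv n ?R X ?R Y"
  have eqv_sym: "?eq Y X" if "?eq X Y" "X \<in> DD" for X Y using rep_equiv_sym that subDD by blast
  have eqv_trans: "?eq X Z" if "?eq X Y" "?eq Y Z" for X Y Z using rep_equiv_trans that by blast
  have eqv_refl: "?eq X X" for X unfolding rep_equiv_def rep_hom_def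
    by (intro exI[of _ "\<lambda>v. v"]) (auto intro: linI simp: bij_betw_def)
  \<comment> \<open>The condition on \<open>Y\<close> depends only on the isomorphism class of
    \<open>X\<close>, so the choice is constant on classes.\<close>
  define \<rho> where "\<rho> = (\<lambda>X. SOME Y. Y \<in> DD \<and> ?eq X Y)"
  have \<rho>: "\<rho> X \<in> DD" "?eq X (\<rho> X)" if "X \<in> DD" for X
    using someI_ex[of "\<lambda>Y. Y \<in> DD \<and> ?eq X Y"] that eqv_refl unfolding \<rho>_def by blast+
  have \<rho>_cong: "\<rho> X = \<rho> Y" if "X \<in> DD" "Y \<in> DD" "?eq X Y" for X Y
  proof -
    have "(Z \<in> DD \<and> ?eq X Z) = (Z \<in> DD \<and> ?eq Y Z)" for Z using that eqv_sym eqv_trans by blast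
    then show ?thesis unfolding \<rho>_def by simp
  qed
  define I where "I = \<rho> ` DD"
  have ID: "S \<in> DD" if "S \<in> I" for S using that \<rho> by (auto simp: I_def)
  define K where "K = (\<lambda>S N. weight_dim n ?R S N)"
  have fiber: "{X \<in> D N. \<rho> X = S} = {X \<in> D N. ?eq X S}" if S: "S \<in> I" and N: "N \<in> ?W" for S N
  proof -
    obtain Y where Y: "Y \<in> DD" "S = \<rho> Y" using S by (auto simp: I_def)
    have "\<rho> X = S \<longleftrightarrow> ?eq X S" if "X \<in> D N" for X
    proof -
      have X: "X \<in> DD" using that N by (auto simp: DD_def)
      have "\<rho> X = \<rho> Y" if "?eq X (\<rho> Y)"
        using \<rho>_cong[OF X Y(1)] eqv_trans[OF that eqv_sym[OF \<rho>(2)[OF Y(1)] Y(1)]] by blast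
      then show ?thesis using \<rho>(2)[OF X] Y(2) by auto
    qed
    then show ?thesis by blast
  qed
  have mult: "card {X \<in> D N. ?eq X S} = K S N" if S: "S \<in> I" and N: "N \<in> ?W" for S N
    unfolding K_def
    by (rule weight_dim_eq_multiplicity[OF polynomial_matrix_poly_rep N irrDD[OF ID[OF S]] q D, symmetric])
  \<comment> \<open>The column space of \<open>M\<close> contains \<open>S\<close> with multiplicity
    \<open>K S M\<close>, and every copy contributes \<open>K S N\<close> to the weight
    \<open>N\<close>.\<close>
  have gram: "(\<Sum>S\<in>I. K S M * K S N) = (\<Sum>f\<in>?P. kostka n f M * kostka n f N)" if M: "M \<in> ?W" and N: "N \<in> ?W" for M N
  proof -
    have DM: "X \<in> DD" if "X \<in> D M" for X using that M by (auto simp: DD_def)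
    have "(\<Sum>f\<in>?P. kostka n f M * kostka n f N) = weight_dim n ?R (column_space n d M) N"
      unfolding weight_dim_column_space using kostka_cauchy[OF M N] by simp
    also have "\<dots> = (\<Sum>X\<in>D M. K X N)" unfolding K_def
      by (rule weight_dim_decomposition[OF fin q subrep_column_space D])
    also have "\<dots> = (\<Sum>S\<in>I. \<Sum>X\<in>{X \<in> D M. \<rho> X = S}. K X N)"
      using finD finDD DM by (intro sum.group[symmetric]) (auto simp: I_def)
    also have "\<dots> = (\<Sum>S\<in>I. K S M * K S N)"
    proof (intro sum.cong refl)
      fix S assume S: "S \<in> I"
      have "K X N = K S N" if X: "X \<in> {X \<in> D M. \<rho> X = S}" for X
      proof -
        have XD: "X \<in> DD" using X DM by blast
        have "?eq X S" using \<rho>(2)[OF XD] X by simp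
        from weight_dim_equiv[OF fin subDD[OF XD] subDD[OF ID[OF S]] this, of N]
        show ?thesis by (simp add: K_def)
      qed
      then have "(\<Sum>X\<in>{X \<in> D M. \<rho> X = S}. K X N) = card {X \<in> D M. \<rho> X = S} * K S N" by simp
      then show "(\<Sum>X\<in>{X \<in> D M. \<rho> X = S}. K X N) = K S M * K S N"
        unfolding fiber[OF S M] mult[OF S M] .
    qed
    finally show ?thesis ..
  qed
  have "\<exists>\<pi>. bij_betw \<pi> I ?P \<and> (\<forall>S\<in>I. \<forall>N\<in>?W. K S N = kostka n (\<pi> S) N)"
  proof (rule unitriangular_gram_unique[where w = "shape_mset n" and height = "height n" and J = "kostka n"])
    show "finite ?P" by (rule finite_parts_eq)
    show "finite I" using finDD by (simp add: I_def)
    show "shape_mset n f \<in> ?W \<and> kostka n f (shape_mset n f) = 1" if "f \<in> ?P" for f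
      using that shape_mset_in[of f n] kostka_shape[of f n] by auto
    show "g = f \<or> height n f < height n g"
      if "f \<in> ?P" "g \<in> ?P" "kostka n g (shape_mset n f) \<noteq> 0" for f g
      using kostka_height that by blast
    \<comment> \<open>\<open>S\<close> is a summand of some column space, and its multiplicity there
      is one of its weight multiplicities.\<close>
    show "\<exists>M\<in>?W. K S M \<noteq> 0" if S: "S \<in> I" for S
    proof -
      obtain N where N: "N \<in> ?W" "S \<in> D N" using ID[OF S] by (auto simp: DD_def)
      have "S \<in> {X \<in> D N. ?eq X S}" using N(2) eqv_refl by simp
      then have "card {X \<in> D N. ?eq X S} \<noteq> 0" using finD[of N] by (auto simp: card_eq_0_iff)
      then show ?thesis using mult[OF S N(1)] N(1) by auto
    qed
  qed (rule gram)
  then obtain \<pi> where \<pi>: "bij_betw \<pi> I ?P" "\<forall>S\<in>I. \<forall>N\<in>?W. K S N = kostka n (\<pi> S) N" by blast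
  have "\<exists>S\<in>I. ?eq X S" if "X \<in> D N" "N \<in> ?W" for X N
    using \<rho>(2)[of X] that by (auto simp: I_def DD_def)
  then have "type_system n d q I \<pi>"
    unfolding type_system_def using q \<pi> irrDD[OF ID] D K_def by blast
  then show ?thesis by blast
qed

lemma type_systemD:
  assumes "type_system n d q I \<pi>"
  shows "star_form n (matrix_poly_rep n d) q" "bij_betw \<pi> I {f \<in> parts n. weight f = d}"
    "S \<in> I \<Longrightarrow> irreducible_subrep n (matrix_poly_rep n d) S"
    "S \<in> I \<Longrightarrow> N \<in> multisets_of_size {..<n} d \<Longrightarrow> weight_dim n (matrix_poly_rep n d) S N = kostka n (\<pi> S) N"
    "N \<in> multisets_of_size {..<n} d \<Longrightarrow> \<exists>D. orthogonal_decomposition n (matrix_poly_rep n d) q (column_space n d N) D \<and>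
        (\<forall>X\<in>D. \<exists>S\<in>I. rep_equiv n (matrix_poly_rep n d) X (matrix_poly_rep n d) S)"
  using assms unfolding type_system_def by simp_all

text \<open>A nonzero vector of weight \<open>N\<close> forces a summand isomorphic to
  \<open>U\<close> in the column space of \<open>N\<close>, so every irreducible with a weight of
  size \<open>d\<close> is already in the list.\<close>

lemma irreducible_has_type:
  assumes "type_system n d q I \<pi>" "polynomial_rep n R" "irreducible_subrep n R U"
    "N \<in> multisets_of_size {..<n} d" "weight_dim n R U N \<noteq> 0"
  shows "\<exists>S\<in>I. rep_equiv n (matrix_poly_rep n d) S R U"
proof -
  let ?A = "matrix_poly_rep n d"
  obtain D where D: "orthogonal_decomposition n ?A q (column_space n d N) D"
    "\<forall>X\<in>D. \<exists>S\<in>I. rep_equiv n ?A X ?A S" using type_systemD(5)[OF assms(1,4)] by blast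
  have "card {X \<in> D. rep_equiv n ?A X R U} \<noteq> 0"
    using weight_dim_eq_multiplicity[OF assms(2,4,3) type_systemD(1)[OF assms(1)] D(1)] assms(5) by simp
  then have "{X \<in> D. rep_equiv n ?A X R U} \<noteq> {}" by (metis card.empty)
  then obtain X where X: "X \<in> D" "rep_equiv n ?A X R U" by blast
  obtain S where S: "S \<in> I" "rep_equiv n ?A X ?A S" using D(2) X(1) by blast
  have "subrep n ?A X" using D(1) X(1) by (auto simp: orthogonal_decomposition_def irreducible_subrep_def)
  then have "rep_equiv n ?A S R U" using rep_equiv_trans[OF rep_equiv_sym[OF S(2)] X(2)] by blast
  then show ?thesis using S(1) by blast
qed

lemma weight_dim_type:
  assumes "type_system n d q I \<pi>" "S \<in> I" "subrep n R U" "rep_equiv n (matrix_poly_rep n d) S R U"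
    "N \<in> multisets_of_size {..<n} d"
  shows "weight_dim n R U N = kostka n (\<pi> S) N"
  using weight_dim_equiv[OF finite_basis_matrix_poly_rep _ assms(3,4), of N]
    type_systemD(3,4)[OF assms(1,2)] assms(5) by (simp add: irreducible_subrep_def)

section \<open>Existence and uniqueness of the Schur representations\<close>

text \<open>\<open>schur_rep\<close> chooses among representations with index type
  \<open>nat\<close>, and weight projections are available for representations but not for
  subspaces; both call for coordinates on an invariant subspace.\<close>

lemma subrep_to_nat:
  fixes R :: "'i gl_rep"
  assumes "polynomial_rep n R" "subrep n R U"
  shows "\<exists>T :: nat gl_rep. polynomial_rep n T \<and> rep_equiv n T (rep_space T) R U"
proof -
  have rep: "is_rep n R" using assms(1) by (simp add: polynomial_rep_def)
  note fin = is_repD(1)[OF rep]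
  obtain b where bf: "basis_family U b" using basis_family_exists[OF fin subrepD(1,2)[OF assms(2)]] by blast
  note b = basis_familyD[OF bf]
  define m where "m = fs.dim U"
  define f where "f = (\<lambda>c :: nat \<Rightarrow> complex. \<Sum>j<m. fun_scale (c j) (b j))"
  define V where "V = {c :: nat \<Rightarrow> complex. \<forall>j. j \<notin> {..<m} \<longrightarrow> c j = 0}"
  have lf: "lin f"
    by (rule linI) (simp_all add: f_def fun_scale_apply fs.scale_left_distrib sum.distrib fs.scale_sum_right)
  have sV: "fs.subspace V" by (rule fs.subspaceI) (auto simp: V_def fun_scale_apply)
  have fU: "f c \<in> U" for c unfolding f_def m_def
    using b(1) subrepD(1)[OF assms(2)] by (intro fs.subspace_sum fs.subspace_scale) auto
  have injf: "inj_on f V"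
  proof (rule inj_onI)
    fix x y assume xy: "x \<in> V" "y \<in> V" "f x = f y"
    have "f (x - y) = 0" using xy(3) lin_diff[OF lf] by simp
    then have "\<forall>j<m. (x - y) j = 0" using b(3)[of "x - y"] by (simp add: f_def m_def)
    then show "x = y" using xy(1,2) by (auto simp: V_def fun_eq_iff) (metis lessThan_iff right_minus_eq)
  qed
  obtain h where h: "lin h" "\<forall>v\<in>V. h (f v) = v"
    using fsp.linear_exists_left_inverse_on[OF lf sV injf] by blast
  have surj: "\<exists>c\<in>V. u = f c" if u: "u \<in> U" for u
  proof -
    obtain c where c: "u = (\<Sum>j<m. fun_scale (c j) (b j))" using b(2)[OF u] unfolding m_def by blast
    then have "u = f (\<lambda>j. if j < m then c j else 0)" by (simp add: f_def)
    moreover have "(\<lambda>j. if j < m then c j else 0) \<in> V" by (simp add: V_def)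
    ultimately show ?thesis by blast
  qed
  have hU: "h u \<in> V" "f (h u) = u" if u: "u \<in> U" for u
    using surj[OF u] h(2) by auto
  \<comment> \<open>The entries are the coordinates, read off by \<open>h\<close>, of the translates
    of the basis vectors \<open>b j\<close>.\<close>
  define T :: "nat gl_rep" where "T = \<lparr>basis = {..<m}, entry = (\<lambda>g i j. h (rep_act R g (b j)) i)\<rparr>"
  have TV: "rep_space T = V" by (simp add: rep_space_def V_def T_def)
  have act: "rep_act T g c = h (rep_act R g (f c))" if g: "g \<in> GL n" for g c
  proof
    fix i
    have "h (rep_act R g (f c)) = (\<Sum>j<m. fun_scale (c j) (h (rep_act R g (b j))))"
      by (simp add: f_def lin_sum[OF lin_rep_act] lin_scale[OF lin_rep_act] lin_sum[OF h(1)] lin_scale[OF h(1)])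
    then have e: "h (rep_act R g (f c)) i = (\<Sum>j<m. c j * h (rep_act R g (b j)) i)" by (simp add: fun_scale_apply)
    show "rep_act T g c i = h (rep_act R g (f c)) i"
    proof (cases "i < m")
      case True
      then show ?thesis unfolding e by (simp add: rep_act_def T_def mult.commute)
    next
      case False
      then have "h (rep_act R g (f c)) i = 0"
        using hU(1)[OF subrepD(3)[OF assms(2) g fU[of c]]] by (simp add: V_def)
      then show ?thesis using False by (simp add: rep_act_def T_def)
    qed
  qed
  have fact: "f (rep_act T g c) = rep_act R g (f c)" if g: "g \<in> GL n" for g c
    using act[OF g] hU(2)[OF subrepD(3)[OF assms(2) g fU]] by simp
  have bU: "b j \<in> U" if "j < m" for j using b(1) that by (simp add: m_def)
  have hb: "h (b j) = unit_fun j" if j: "j < m" for j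
  proof -
    have "f (unit_fun j) = (\<Sum>k<m. if k = j then b j else 0)"
      unfolding f_def by (intro sum.cong) (auto simp: unit_fun_def)
    then have "f (unit_fun j) = b j" using j by simp
    moreover have "unit_fun j \<in> V" using j by (auto simp: V_def unit_fun_def)
    ultimately show ?thesis using h(2) by metis
  qed
  have "entry T (g * k) i j = (\<Sum>l\<in>basis T. entry T g i l * entry T k l j)"
    if g: "g \<in> GL n" and k: "k \<in> GL n" and ij: "i < m" "j < m" for g k i j
  proof -
    have kb: "rep_act R k (b j) \<in> U" using subrepD(3)[OF assms(2) k bU[OF ij(2)]] .
    have "entry T (g * k) i j = h (rep_act R g (f (h (rep_act R k (b j))))) i"
      using hU(2)[OF kb] rep_act_mult[OF rep g k] by (simp add: T_def)
    also have "\<dots> = rep_act T g (h (rep_act R k (b j))) i" using act[OF g] by simp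
    finally show ?thesis using ij by (simp add: rep_act_def T_def)
  qed
  moreover have "entry T (1\<^sub>m n) i j = (if i = j then 1 else 0)" if "i < m" "j < m" for i j
  proof -
    have "b j \<in> rep_space R" using bU[OF that(2)] subrepD(2)[OF assms(2)] by blast
    then show ?thesis using rep_act_one[OF rep] hb[OF that(2)] by (auto simp: T_def unit_fun_def)
  qed
  ultimately have repT: "is_rep n T" by (simp add: is_rep_def T_def)
  have "polyfun n (\<lambda>g. entry T g i j)" if "i < m" "j < m" for i j
  proof -
    have "h (rep_act R g (b j)) = (\<Sum>k\<in>basis R. fun_scale (rep_act R g (b j) k) (h (unit_fun k)))" for g
      using arg_cong[OF rep_space_expand[OF fin rep_act_in[of R g "b j"]], of h]
      by (simp only: lin_sum[OF h(1)] lin_scale[OF h(1)])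
    then have "entry T g i j = (\<Sum>k\<in>basis R. (\<Sum>l\<in>basis R. entry R g k l * b j l) * h (unit_fun k) i)" for g
      by (simp add: T_def fun_scale_apply rep_act_def)
    moreover have "polyfun n (\<lambda>g. \<Sum>k\<in>basis R. (\<Sum>l\<in>basis R. entry R g k l * b j l) * h (unit_fun k) i)"
      using assms(1) by (intro polyfun_sum polyfun_mult polyfun_const) (auto simp: polynomial_rep_iff)
    ultimately show ?thesis by simp
  qed
  then have "polynomial_rep n T" using repT by (simp add: polynomial_rep_iff T_def)
  moreover have "bij_betw f (rep_space T) U"
    unfolding TV bij_betw_def using injf fU surj by blast
  then have "rep_equiv n T (rep_space T) R U" unfolding rep_equiv_def rep_hom_def using lf fact by blast
  ultimately show ?thesis by blast
qed

lemma irreducible_subrep_transfer: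
  assumes "rep_equiv n S X R U" "irreducible_subrep n R U" "subrep n S X"
  shows "irreducible_subrep n S X"
proof -
  obtain f where f: "rep_hom n S X R f" "bij_betw f X U" using assms(1) by (auto simp: rep_equiv_def)
  have l: "lin f" using f(1) by (simp add: rep_hom_def)
  have inj: "inj_on f X" and im: "f ` X = U" using f(2) by (auto simp: bij_betw_def)
  have sU: "subrep n R U" "U \<noteq> {0}" using assms(2) by (auto simp: irreducible_subrep_def)
  have "X \<noteq> {0}" using im sU(2) lin_0[OF l] by auto
  moreover have "W = {0} \<or> W = X" if W: "subrep n S W" "W \<subseteq> X" for W
  proof -
    have hW: "rep_hom n S W R f" using f(1) W(2) by (auto simp: rep_hom_def)
    have fWU: "f ` W \<subseteq> U" using W(2) im by blast
    then have "subrep n R (f ` W)" using subrep_image[OF hW W(1)] subrepD(2)[OF sU(1)] by blast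
    then have "f ` W = {0} \<or> f ` W = U" using assms(2) fWU unfolding irreducible_subrep_def by blast
    then show ?thesis
    proof
      assume 0: "f ` W = {0}"
      have "w = 0" if w: "w \<in> W" for w
      proof -
        have "f w = f 0" using 0 w lin_0[OF l] by auto
        then show ?thesis using inj_onD[OF inj, of w 0] w W(2) subrepD(4)[OF assms(3)] by blast
      qed
      then show ?thesis using subrepD(4)[OF W(1)] by blast
    next
      assume "f ` W = U"
      then have "f ` W = f ` X" using im by simp
      then show ?thesis using inj_on_image_eq_iff[OF inj W(2) order_refl] by simp
    qed
  qed
  ultimately show ?thesis using assms(3) unfolding irreducible_subrep_def by blast
qed

lemma dim_zero: "fs.dim {0 :: 'i \<Rightarrow> complex} = 0"
  using dim_eq_card_family[of "{}" undefined "{0 :: 'i \<Rightarrow> complex}"] by simp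

lemma weight_dim_eq_0:
  assumes "finite (basis R)" "torus_weights n R wt" "subrep n R U" "\<And>i. i \<in> basis R \<Longrightarrow> wt i \<noteq> N"
  shows "weight_dim n R U N = 0"
proof -
  have "v = 0" if "v \<in> weight_space n R N" for v
    using weight_vector_support[OF assms(1,2) that] assms(4) by (metis ext zero_fun_apply)
  then have "U \<inter> weight_space n R N = {0}"
    using subrepD(4)[OF assms(3)] fs.subspace_0[OF subspace_weight_space[of n R N]] by blast
  then show ?thesis by (simp add: weight_dim_def dim_zero)
qed

lemma schur_rep_exists:
  assumes "la \<in> partitions_of d" "length la \<le> n"
  shows "\<exists>R :: nat gl_rep. polynomial_rep n R \<and> irreducible_rep n R \<and>
    (\<forall>x. (\<forall>i<n. x i \<noteq> 0) \<longrightarrow> rep_character n R x = schur_poly n la x)"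
proof -
  let ?A = "matrix_poly_rep n d" and ?W = "multisets_of_size {..<n} d"
  note finA = finite_basis_matrix_poly_rep[of n d]
  obtain q I \<pi> where ts: "type_system n d q I \<pi>" using type_system_exists by blast
  have rp: "rows la \<in> {f \<in> parts n. weight f = d}"
    using rows_parts[OF assms(1)] parts_mono[OF assms(2)] weight_rows[OF assms(1)] by auto
  then obtain S where S: "S \<in> I" "\<pi> S = rows la"
    using type_systemD(2)[OF ts] unfolding bij_betw_def by (metis imageE)
  have irr: "irreducible_subrep n ?A S" using type_systemD(3)[OF ts S(1)] .
  then have sS: "subrep n ?A S" by (simp add: irreducible_subrep_def)
  obtain T :: "nat gl_rep" where T: "polynomial_rep n T" "rep_equiv n T (rep_space T) ?A S"
    using subrep_to_nat[OF polynomial_matrix_poly_rep sS] by blast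
  have finT: "finite (basis T)" using T(1) by (simp add: polynomial_rep_def is_rep_def)
  have irrT: "irreducible_rep n T"
    unfolding irreducible_rep_iff using irreducible_subrep_transfer[OF T(2) irr subrep_rep_space] .
  have wd: "fs.dim (weight_space n T N) = weight_dim n ?A S N" for N
  proof -
    have "rep_space T \<inter> weight_space n T N = weight_space n T N" by (auto simp: weight_space_def)
    then have "fs.dim (weight_space n T N) = weight_dim n T (rep_space T) N" by (simp add: weight_dim_def)
    also have "\<dots> = weight_dim n ?A S N" using weight_dim_equiv[OF finT subrep_rep_space sS T(2)] by simp
    finally show ?thesis .
  qed
  have wd0: "fs.dim (weight_space n T N) = 0" if "N \<notin> ?W" for N
    unfolding wd
  proof (rule weight_dim_eq_0[OF finA torus_weights_matrix_poly_rep sS])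
    fix M assume "M \<in> basis ?A"
    then have "image_mset fst M \<in> ?W" by (force simp: basis_matrix_poly_rep multisets_of_size_def)
    then show "image_mset fst M \<noteq> N" using that by blast
  qed
  obtain W where W: "finite W" "\<forall>N. weight_space n T N \<noteq> {0} \<longrightarrow> N \<in> W"
    "\<forall>x. (\<forall>i. x i \<noteq> 0) \<longrightarrow> rep_character n T x = (\<Sum>N\<in>W. of_nat (fs.dim (weight_space n T N)) * mon x N)"
    using character_eq_weight_dims[OF T(1)] by blast
  have W0: "fs.dim (weight_space n T N) = 0" if "N \<notin> W" for N
  proof -
    have "weight_space n T N = {0}" using W(2) that by blast
    then show ?thesis by (simp add: dim_zero)
  qed
  have "rep_character n T x = schur_poly n la x" if x: "\<forall>i<n. x i \<noteq> 0" for x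
  proof -
    \<comment> \<open>Characters are known at points with no zero coordinate at all. Values from
      \<open>n\<close> on do not affect either side, so they are reset to 1.\<close>
    define y where "y = (\<lambda>i. if i < n then x i else 1)"
    have y: "\<forall>i. y i \<noteq> 0" using x by (simp add: y_def)
    have "mat_diag n x = mat_diag n y" by (intro eq_matI) (auto simp: mat_diag_def y_def)
    then have "rep_character n T x = rep_character n T y" by (simp add: rep_character_def)
    also have "\<dots> = (\<Sum>N\<in>W. of_nat (fs.dim (weight_space n T N)) * mon y N)" using W(3) y by blast
    \<comment> \<open>Neither index set need contain the other; outside either of them the weight
      spaces have dimension zero.\<close>
    also have "\<dots> = (\<Sum>N\<in>W \<union> ?W. of_nat (fs.dim (weight_space n T N)) * mon y N)"
      using W(1) W0 by (intro sum.mono_neutral_left) (auto intro!: finite_multisets_of_size)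
    also have "\<dots> = (\<Sum>N\<in>?W. of_nat (fs.dim (weight_space n T N)) * mon y N)"
      using W(1) wd0 by (intro sum.mono_neutral_right) (auto intro!: finite_multisets_of_size)
    also have "\<dots> = (\<Sum>N\<in>?W. of_nat (kostka n (rows la) N) * mon y N)"
      unfolding wd using type_systemD(4)[OF ts S(1)] S(2) by simp
    also have "\<dots> = schur_poly n la y"
      using gt_poly_eq_kostka[of "rows la" n y] rp schur_poly_eq_gt_poly[OF assms] by simp
    also have "\<dots> = schur_poly n la x" unfolding schur_poly_def
      by (intro sum.cong prod.cong refl) (simp add: y_def)
    finally show ?thesis .
  qed
  then show ?thesis using T(1) irrT by blast
qed

lemma schur_rep:
  assumes "la \<in> partitions_of d" "length la \<le> n"
  shows "polynomial_rep n (schur_rep n la)" "irreducible_rep n (schur_rep n la)"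
    "\<forall>i<n. x i \<noteq> 0 \<Longrightarrow> rep_character n (schur_rep n la) x = schur_poly n la x"
proof -
  let ?P = "\<lambda>R :: nat gl_rep. polynomial_rep n R \<and> irreducible_rep n R \<and>
    (\<forall>x. (\<forall>i<n. x i \<noteq> 0) \<longrightarrow> rep_character n R x = schur_poly n la x)"
  have "?P (SOME R. ?P R)" by (rule someI_ex) (rule schur_rep_exists[OF assms])
  then have "?P (schur_rep n la)" using assms(2) by (simp add: schur_rep_def)
  then show "polynomial_rep n (schur_rep n la)" "irreducible_rep n (schur_rep n la)"
    "\<forall>i<n. x i \<noteq> 0 \<Longrightarrow> rep_character n (schur_rep n la) x = schur_poly n la x" by blast+
qed

text \<open>\<open>schur_rep\<close> is accessible only through its specification, so its weight
  multiplicities are read off from its character by comparing coefficients.\<close>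

lemma weight_dim_schur_rep:
  assumes "la \<in> partitions_of d" "length la \<le> n" "N \<in> multisets_of_size {..<n} d"
  shows "weight_dim n (schur_rep n la) (rep_space (schur_rep n la)) N = kostka n (rows la) N"
proof -
  let ?R = "schur_rep n la" and ?W = "multisets_of_size {..<n} d"
  have rp: "rows la \<in> parts n" "weight (rows la) = d"
    using rows_parts[OF assms(1)] parts_mono[OF assms(2)] weight_rows[OF assms(1)] by auto
  obtain W where W: "finite W" "\<forall>N. weight_space n ?R N \<noteq> {0} \<longrightarrow> N \<in> W"
    "\<forall>x. (\<forall>i. x i \<noteq> 0) \<longrightarrow> rep_character n ?R x = (\<Sum>N\<in>W. of_nat (fs.dim (weight_space n ?R N)) * mon x N)"
    using character_eq_weight_dims[OF schur_rep(1)[OF assms(1,2)]] by blast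
  have W0: "fs.dim (weight_space n ?R N) = 0" if "N \<notin> W" for N
  proof -
    have "weight_space n ?R N = {0}" using W(2) that by blast
    then show ?thesis by (simp add: dim_zero)
  qed
  have finW: "finite (W \<union> ?W)" using W(1) by (auto intro: finite_multisets_of_size)
  let ?k = "\<lambda>N. if N \<in> ?W then of_nat (kostka n (rows la) N) else (0::complex)"
  have "of_nat (fs.dim (weight_space n ?R N)) = ?k N"
  proof (rule mon_coeff_unique[OF finW, where c = "\<lambda>N. of_nat (fs.dim (weight_space n ?R N))" and d = ?k])
    fix y :: "nat \<Rightarrow> complex" assume y: "\<forall>p. y p \<noteq> 0"
    have "(\<Sum>N\<in>W \<union> ?W. of_nat (fs.dim (weight_space n ?R N)) * mon y N) =
      (\<Sum>N\<in>W. of_nat (fs.dim (weight_space n ?R N)) * mon y N)"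
      using finW W0 by (intro sum.mono_neutral_right) auto
    also have "\<dots> = schur_poly n la y" using W(3) y schur_rep(3)[OF assms(1,2), of y] by simp
    also have "\<dots> = (\<Sum>N\<in>?W. of_nat (kostka n (rows la) N) * mon y N)"
      using gt_poly_eq_kostka[OF rp(1), of y] rp(2) schur_poly_eq_gt_poly[OF assms(1,2)] by simp
    also have "\<dots> = (\<Sum>N\<in>W \<union> ?W. ?k N * mon y N)"
      using finW by (intro sum.mono_neutral_cong_left) auto
    finally show "(\<Sum>N\<in>W \<union> ?W. of_nat (fs.dim (weight_space n ?R N)) * mon y N) = (\<Sum>N\<in>W \<union> ?W. ?k N * mon y N)" .
  qed (use assms(3) in simp)
  then have "fs.dim (weight_space n ?R N) = kostka n (rows la) N" using assms(3) by simp
  moreover have "rep_space ?R \<inter> weight_space n ?R N = weight_space n ?R N" by (auto simp: weight_space_def)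
  ultimately show ?thesis by (simp add: weight_dim_def)
qed

text \<open>Each shape has a nonzero Kostka number at the content of the other; if they were
  different, each would have the greater height.\<close>

lemma kostka_eq_imp_eq:
  assumes "f \<in> parts n" "g \<in> parts n" "weight f = d" "weight g = d"
    "\<And>N. N \<in> multisets_of_size {..<n} d \<Longrightarrow> kostka n f N = kostka n g N"
  shows "f = g"
proof -
  have "kostka n g (shape_mset n f) \<noteq> 0" "kostka n f (shape_mset n g) \<noteq> 0"
    using assms(5)[of "shape_mset n f"] assms(5)[of "shape_mset n g"] shape_mset_in[OF assms(1)]
      shape_mset_in[OF assms(2)] kostka_shape[OF assms(1)] kostka_shape[OF assms(2)] assms(3,4) by auto
  then show ?thesis using kostka_height[OF assms(1,2)] kostka_height[OF assms(2,1)] by fastforce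
qed

text \<open>Uniqueness up to isomorphism: the type of \<open>schur_rep n la\<close> has the Kostka
  row of \<open>rows la\<close>, distinct shapes have distinct rows, and distinct types have
  distinct shapes.\<close>

lemma schur_rep_type:
  assumes "type_system n d q I \<pi>" "la \<in> partitions_of d" "length la \<le> n" "S \<in> I" "\<pi> S = rows la"
  shows "rep_equiv n (matrix_poly_rep n d) S (schur_rep n la) (rep_space (schur_rep n la))"
proof -
  let ?R = "schur_rep n la"
  have rp: "rows la \<in> parts n" "weight (rows la) = d"
    using rows_parts[OF assms(2)] parts_mono[OF assms(3)] weight_rows[OF assms(2)] by auto
  have sh: "shape_mset n (rows la) \<in> multisets_of_size {..<n} d" using shape_mset_in[OF rp(1)] rp(2) by simp
  have irr: "irreducible_subrep n ?R (rep_space ?R)"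
    using schur_rep(2)[OF assms(2,3)] by (simp add: irreducible_rep_iff)
  have "weight_dim n ?R (rep_space ?R) (shape_mset n (rows la)) \<noteq> 0"
    using weight_dim_schur_rep[OF assms(2,3) sh] kostka_shape[OF rp(1)] by simp
  then obtain S' where S': "S' \<in> I" "rep_equiv n (matrix_poly_rep n d) S' ?R (rep_space ?R)"
    using irreducible_has_type[OF assms(1) schur_rep(1)[OF assms(2,3)] irr sh] by blast
  have "kostka n (\<pi> S') N = kostka n (rows la) N" if "N \<in> multisets_of_size {..<n} d" for N
    using weight_dim_type[OF assms(1) S'(1) subrep_rep_space S'(2) that] weight_dim_schur_rep[OF assms(2,3) that] by simp
  moreover have "\<pi> S' \<in> {f \<in> parts n. weight f = d}"
    using type_systemD(2)[OF assms(1)] S'(1) by (auto simp: bij_betw_def)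
  ultimately have "\<pi> S' = \<pi> S" using kostka_eq_imp_eq[OF _ rp(1) _ rp(2)] assms(5) by auto
  then have "S' = S" using type_systemD(2)[OF assms(1)] S'(1) assms(4) by (auto simp: bij_betw_def inj_on_def)
  then show ?thesis using S'(2) by simp
qed

section \<open>The decomposition\<close>

lemma dim_eq_0_imp:
  assumes "finite (basis R)" "fs.subspace U" "U \<subseteq> rep_space R" "fs.dim U = 0" "v \<in> U"
  shows "v = 0"
proof -
  obtain b where bf: "basis_family U b" using basis_family_exists[OF assms(1-3)] by blast
  show ?thesis using basis_familyD(2)[OF bf assms(5)] assms(4) by simp
qed

text \<open>Weight projections sum to the identity, so one of them does not kill a given nonzero
  vector. They are taken in a copy of \<open>X\<close> with coordinates of its own.\<close>

lemma subrep_has_weight: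
  fixes R :: "'i gl_rep"
  assumes "polynomial_rep n R" "subrep n R X" "X \<noteq> {0}"
  shows "\<exists>N. weight_dim n R X N \<noteq> 0"
proof -
  obtain T :: "nat gl_rep" where T: "polynomial_rep n T" "rep_equiv n T (rep_space T) R X"
    using subrep_to_nat[OF assms(1,2)] by blast
  have finT: "finite (basis T)" using T(1) by (simp add: polynomial_rep_def is_rep_def)
  obtain f where f: "rep_hom n T (rep_space T) R f" "bij_betw f (rep_space T) X"
    using T(2) by (auto simp: rep_equiv_def)
  have lf: "lin f" using f(1) by (simp add: rep_hom_def)
  have "rep_space T \<noteq> {0}"
  proof
    assume "rep_space T = {0}"
    then have "X = {f 0}" using f(2) by (simp add: bij_betw_def)
    then show False using assms(3) lin_0[OF lf] by simp
  qed
  then obtain v where v: "v \<in> rep_space T" "v \<noteq> 0"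
    using nonzero_vector[OF fs.subspace_0[OF subspace_rep_space[of T]]] by blast
  obtain W E where WE: "weight_projections n T W E" using weight_projections_exist[OF T(1)] by blast
  have "\<exists>N\<in>W. E N v \<noteq> 0"
  proof (rule ccontr)
    assume "\<not> ?thesis"
    then have "(\<Sum>N\<in>W. E N v) = 0" by (intro sum.neutral) simp
    moreover have "v = (\<Sum>N\<in>W. E N v)" using WE v(1) by (simp add: weight_projections_def)
    ultimately show False using v(2) by simp
  qed
  then obtain N where N: "N \<in> W" "E N v \<noteq> 0" by blast
  have EN: "E N v \<in> rep_space T \<inter> weight_space n T N"
    using WE v(1) N(1) by (auto simp: weight_projections_def weight_space_def)
  have "weight_dim n T (rep_space T) N \<noteq> 0"
    using dim_eq_0_imp[OF finT fs.subspace_inter[OF subspace_rep_space subspace_weight_space] _ _ EN] N(2)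
    by (auto simp: weight_dim_def)
  then show ?thesis using weight_dim_equiv[OF finT subrep_rep_space assms(2) T(2)] by metis
qed

section \<open>Assembling the isomorphism\<close>

text \<open>\<open>L\<close> will be all partitions in the sum and \<open>B\<close> those with at
  most \<open>n\<close> parts. The remaining summands are zero and have no basis elements, so the
  sum reduces to the finite set \<open>B\<close>.\<close>

lemma rep_act_direct_sum:
  assumes "finite B" "B \<subseteq> L" "\<And>a. a \<in> B \<Longrightarrow> finite (basis (T a))" "\<And>a. a \<in> L - B \<Longrightarrow> basis (T a) = {}"
    and "a \<in> B"
  shows "rep_act (direct_sum L T) g w (a, i) = rep_act (T a) g (\<lambda>j. w (a, j)) i"
proof -
  have basis: "basis (direct_sum L T) = (SIGMA b:B. basis (T b))"
    using assms(2,4) by (fastforce simp: direct_sum_def)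
  show ?thesis
  proof (cases "i \<in> basis (T a)")
    case True
    have "rep_act (direct_sum L T) g w (a, i) =
      (\<Sum>(b,j)\<in>(SIGMA b:B. basis (T b)). (if a = b then entry (T a) g i j else 0) * w (b,j))"
      using True assms(5) unfolding rep_act_def basis
      by (auto simp: direct_sum_def intro!: sum.cong)
    also have "\<dots> = (\<Sum>b\<in>B. \<Sum>j\<in>basis (T b). (if a = b then entry (T a) g i j else 0) * w (b,j))"
      using assms(1,3) by (subst sum.Sigma) auto
    also have "\<dots> = (\<Sum>b\<in>B. if b = a then \<Sum>j\<in>basis (T a). entry (T a) g i j * w (a,j) else 0)"
      by (intro sum.cong refl) auto
    also have "\<dots> = (\<Sum>j\<in>basis (T a). entry (T a) g i j * w (a,j))" using assms(1,5) by simp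
    finally show ?thesis using True by (simp add: rep_act_def)
  next
    case False
    then have "(a, i) \<notin> basis (direct_sum L T)" unfolding basis by simp
    then show ?thesis using False by (simp add: rep_act_def)
  qed
qed

text \<open>A vector goes to the family of its projections, each carried over by the given
  equivalence. Orthogonality of the summands makes any prescribed family attainable.\<close>

lemma rep_iso_direct_sum:
  assumes "finite (basis R)" "star_form n R q" "orthogonal_decomposition n R q (rep_space R) D"
    and \<chi>: "bij_betw \<chi> B D" and "B \<subseteq> L" "\<And>a. a \<in> B \<Longrightarrow> finite (basis (T a))" "\<And>a. a \<in> L - B \<Longrightarrow> basis (T a) = {}"
    and "\<And>a. a \<in> B \<Longrightarrow> rep_equiv n R (\<chi> a) (T a) (rep_space (T a))"
  shows "rep_iso n R (direct_sum L T)"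
proof -
  let ?p = "orth_proj q R" and ?S = "direct_sum L T"
  have qp: "\<forall>i\<in>basis R. q i > 0" using star_formD(1)[OF assms(2)] by blast
  have finD: "finite D" using assms(3) by (simp add: orthogonal_decomposition_def)
  have finB: "finite B" using bij_betw_finite[OF \<chi>] finD by simp
  have \<chi>D: "\<chi> a \<in> D" if "a \<in> B" for a using \<chi> that by (auto simp: bij_betw_def)
  have sD: "subrep n R X" if "X \<in> D" for X
    using assms(3) that by (auto simp: orthogonal_decomposition_def irreducible_subrep_def)
  have orth: "?p X' v = 0" if "X \<in> D" "X' \<in> D" "X \<noteq> X'" "v \<in> X" for X X' v
    using assms(3) that unfolding orthogonal_decomposition_def by blast
  have pl: "lin (?p X)" and pin: "?p X v \<in> X" and pid: "v \<in> X \<Longrightarrow> ?p X v = v"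
    and peq: "g \<in> GL n \<Longrightarrow> ?p X (rep_act R g v) = rep_act R g (?p X v)" if "X \<in> D" for X v g
    using lin_orth_proj[OF assms(1) qp subrepD(1,2)[OF sD[OF that]]]
      orth_proj(1)[OF assms(1) qp subrepD(1,2)[OF sD[OF that]]]
      orth_proj_id[OF assms(1) qp subrepD(1,2)[OF sD[OF that]]]
      orth_proj_equivariant[OF assms(1,2) sD[OF that]] by auto
  have sumD: "v = (\<Sum>X\<in>D. ?p X v)" if "v \<in> rep_space R" for v
    using assms(3) that by (simp add: orthogonal_decomposition_def)
  have "\<exists>f. rep_hom n R (\<chi> a) (T a) f \<and> bij_betw f (\<chi> a) (rep_space (T a))" if "a \<in> B" for a
    using assms(8)[OF that] by (simp add: rep_equiv_def)
  then obtain \<phi> where \<phi>: "\<And>a. a \<in> B \<Longrightarrow> rep_hom n R (\<chi> a) (T a) (\<phi> a) \<and> bij_betw (\<phi> a) (\<chi> a) (rep_space (T a))"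
    by metis
  have l\<phi>: "lin (\<phi> a)" if "a \<in> B" for a using \<phi>[OF that] by (simp add: rep_hom_def)
  have in\<phi>: "\<phi> a v \<in> rep_space (T a)" if "a \<in> B" "v \<in> \<chi> a" for a v
    using \<phi>[OF that(1)] that(2) by (auto simp: bij_betw_def)
  define F where "F = (\<lambda>v (a, i). if a \<in> B then \<phi> a (?p (\<chi> a) v) i else 0)"
  have F: "F v (a, i) = (if a \<in> B then \<phi> a (?p (\<chi> a) v) i else 0)" for v a i by (simp add: F_def)
  have lF: "lin F"
  proof (rule linI)
    fix v w c
    show "F (v + w) = F v + F w"
    proof (rule ext, clarify)
      fix a i
      show "F (v + w) (a, i) = (F v + F w) (a, i)"
        by (cases "a \<in> B") (simp_all add: F lin_add[OF pl[OF \<chi>D]] lin_add[OF l\<phi>])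
    qed
    show "F (fun_scale c v) = fun_scale c (F v)"
    proof (rule ext, clarify)
      fix a i
      show "F (fun_scale c v) (a, i) = fun_scale c (F v) (a, i)"
        by (cases "a \<in> B") (simp_all add: F fun_scale_apply lin_scale[OF pl[OF \<chi>D]] lin_scale[OF l\<phi>])
    qed
  qed
  have FS: "F v \<in> rep_space ?S" for v
  proof -
    have "F v (a, i) = 0" if "(a, i) \<notin> basis ?S" for a i
    proof (cases "a \<in> B")
      case True
      then have "i \<notin> basis (T a)" using that assms(5) by (auto simp: direct_sum_def)
      then show ?thesis using in\<phi>[OF True pin[OF \<chi>D[OF True]], of v] True by (simp add: F rep_space_def)
    qed (simp add: F)
    then show ?thesis by (auto simp: rep_space_def)
  qed
  have "inj_on F (rep_space R)"
  proof (rule inj_onI)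
    fix v w assume vw: "v \<in> rep_space R" "w \<in> rep_space R" "F v = F w"
    have "?p X v = ?p X w" if X: "X \<in> D" for X
    proof -
      obtain a where a: "a \<in> B" "X = \<chi> a" using X \<chi> by (auto simp: bij_betw_def)
      have "\<phi> a (?p (\<chi> a) v) i = \<phi> a (?p (\<chi> a) w) i" for i
        using fun_cong[OF vw(3), of "(a, i)"] a(1) by (simp add: F)
      then have "\<phi> a (?p (\<chi> a) v) = \<phi> a (?p (\<chi> a) w)" by (rule ext)
      moreover have "inj_on (\<phi> a) (\<chi> a)" using \<phi>[OF a(1)] by (simp add: bij_betw_def)
      ultimately show ?thesis using pin[OF \<chi>D[OF a(1)]] a(2) by (simp add: inj_on_eq_iff)
    qed
    then have "(\<Sum>X\<in>D. ?p X v) = (\<Sum>X\<in>D. ?p X w)" by (intro sum.cong refl)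
    then show "v = w" using sumD[OF vw(1)] sumD[OF vw(2)] by simp
  qed
  moreover have "F ` rep_space R = rep_space ?S"
  proof
    show "F ` rep_space R \<subseteq> rep_space ?S" using FS by blast
    show "rep_space ?S \<subseteq> F ` rep_space R"
    proof
      fix w assume w: "w \<in> rep_space ?S"
      have w0: "w (a, i) = 0" if "a \<notin> B \<or> i \<notin> basis (T a)" for a i
      proof -
        have "(a, i) \<notin> basis ?S" using that assms(7) by (auto simp: direct_sum_def)
        then show ?thesis using w by (simp add: rep_space_def)
      qed
      have "\<exists>u\<in>\<chi> a. \<phi> a u = (\<lambda>i. w (a, i))" if a: "a \<in> B" for a
      proof -
        have "(\<lambda>i. w (a, i)) \<in> rep_space (T a)" using w0 by (simp add: rep_space_def)
        then show ?thesis using \<phi>[OF a] unfolding bij_betw_def by (metis imageE)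
      qed
      then obtain u where u: "\<And>a. a \<in> B \<Longrightarrow> u a \<in> \<chi> a \<and> \<phi> a (u a) = (\<lambda>i. w (a, i))" by metis
      define v where "v = (\<Sum>b\<in>B. u b)"
      have pv: "?p (\<chi> a) v = u a" if a: "a \<in> B" for a
      proof -
        have "?p (\<chi> a) v = (\<Sum>b\<in>B. ?p (\<chi> a) (u b))" unfolding v_def by (rule lin_sum[OF pl[OF \<chi>D[OF a]]])
        also have "\<dots> = (\<Sum>b\<in>B. if b = a then u a else 0)"
        proof (intro sum.cong refl)
          fix b assume b: "b \<in> B"
          show "?p (\<chi> a) (u b) = (if b = a then u a else 0)"
          proof (cases "b = a")
            case True
            then show ?thesis using pid[OF \<chi>D[OF a]] u[OF a] by simp
          next
            case False
            then have "\<chi> b \<noteq> \<chi> a" using \<chi> a b by (auto simp: bij_betw_def inj_on_def)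
            then show ?thesis using False orth[OF \<chi>D[OF b] \<chi>D[OF a]] u[OF b] by simp
          qed
        qed
        also have "\<dots> = u a" using finB a by simp
        finally show ?thesis .
      qed
      have "F v = w"
      proof (rule ext, clarify)
        fix a i
        show "F v (a, i) = w (a, i)"
          using u[of a] pv[of a] w0[of a i] by (cases "a \<in> B") (simp_all add: F)
      qed
      moreover have "v \<in> rep_space R" unfolding v_def
        using u subrepD(2)[OF sD[OF \<chi>D]] by (intro fs.subspace_sum[OF subspace_rep_space]) blast
      ultimately show "w \<in> F ` rep_space R" by blast
    qed
  qed
  ultimately have "bij_betw F (rep_space R) (rep_space ?S)" by (simp add: bij_betw_def)
  moreover have "F (rep_act R g v) = rep_act ?S g (F v)" if g: "g \<in> GL n" for g v
  proof (rule ext, clarify)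
    fix a i
    show "F (rep_act R g v) (a, i) = rep_act ?S g (F v) (a, i)"
    proof (cases "a \<in> B")
      case True
      have "F (rep_act R g v) (a, i) = rep_act (T a) g (\<phi> a (?p (\<chi> a) v)) i"
        using True \<phi>[OF True] pin[OF \<chi>D[OF True]] g by (simp add: F peq[OF \<chi>D[OF True] g] rep_hom_def)
      also have "\<phi> a (?p (\<chi> a) v) = (\<lambda>j. F v (a, j))" using True by (simp add: F)
      also have "rep_act (T a) g (\<lambda>j. F v (a, j)) i = rep_act ?S g (F v) (a, i)"
        by (rule rep_act_direct_sum[OF finB assms(5-7) True, symmetric])
      finally show ?thesis .
    next
      case False
      then have "(a, i) \<notin> basis ?S" using assms(7) by (auto simp: direct_sum_def)
      then show ?thesis using False by (simp add: F rep_act_def)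
    qed
  qed
  ultimately show ?thesis unfolding rep_iso_def using lF by blast
qed

lemma mon_sum_mset: "mon x (sum_mset (image_mset f M)) = mon (\<lambda>i. mon x (f i)) M"
  by (induction M) auto

lemma rows_inj:
  assumes "la \<in> partitions_of d" "la' \<in> partitions_of d" "rows la = rows la'"
  shows "la = la'"
  using bij_betw_rows[of d "max (length la) (length la')"] assms by (auto simp: bij_betw_def inj_on_def)

theorem theorem26:
  fixes n k l :: nat
  assumes "n \<ge> 1"
  shows "rep_iso n
           (tensor_rep (sym_power k (std_rep n)) (sym_power l (ext_square (std_rep n))))
           (direct_sum {la \<in> partitions_of (k + 2 * l). odd_columns la = k} (schur_rep n))"
proof -
  define V where "V = tensor_rep (sym_power k (std_rep n)) (sym_power l (ext_square (std_rep n)))"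
  define d where "d = k + 2 * l"
  define L where "L = {la \<in> partitions_of d. odd_columns la = k}"
  \<comment> \<open>Only these partitions have a nonzero \<open>schur_rep\<close>.\<close>
  define B where "B = {la \<in> L. length la \<le> n}"
  let ?W = "multisets_of_size {..<n} d" and ?A = "matrix_poly_rep n d"
  define P where "P = {f \<in> parts n. weight f = d}"
  define Q where "Q = {f \<in> P. alt_weight f = int k}"
  \<comment> \<open>A basis vector of the standard representation has its own index as weight, and
    the wedge of \<open>i\<close> and \<open>j\<close> has weight
    \<open>{#i#} + {#j#}\<close>.\<close>
  define wt where "wt = (\<lambda>(M :: nat multiset, N :: (nat \<times> nat) multiset).
    sum_mset (image_mset (\<lambda>i. {#i#}) M) + sum_mset (image_mset (\<lambda>(i,j). {#i#} + {#j#}) N))"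
  have polyV: "polynomial_rep n V"
    unfolding V_def by (intro tensor_rep(1) sym_power(1) ext_square(1) std_rep(1))
  then have finV: "finite (basis V)" by (simp add: polynomial_rep_def is_rep_def)
  obtain q where q: "star_form n V q"
    using tensor_rep(2)[OF sym_power(2)[OF std_rep(2)] sym_power(2)[OF ext_square(2)[OF std_rep(2)]]]
    unfolding V_def by blast
  have torV: "torus_weights n V wt"
    using tensor_rep(3)[OF sym_power(3)[OF std_rep(3)] sym_power(3)[OF ext_square(3)[OF std_rep(3)]]]
    unfolding V_def wt_def .
  let ?B1 = "multisets_of_size {..<n} k" and ?B2 = "multisets_of_size {(i,j). i < j \<and> j < n} l"
  have "{(i, j). i < n \<and> j < n \<and> i < j} = {(i, j). i < j \<and> j < n}" by auto
  then have basisV: "basis V = ?B1 \<times> ?B2"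
    by (simp add: V_def tensor_rep_def basis_sym_power std_rep_def ext_square_def)
  have wtW: "wt p \<in> ?W" if "p \<in> basis V" for p
  proof -
    have "p \<in> ?B1 \<times> ?B2" using that basisV by simp
    then obtain M N where p: "p = (M, N)" "M \<in> ?B1" "N \<in> ?B2" by blast
    have "size (sum_mset (image_mset (\<lambda>(i,j). {#i#} + {#j#}) N)) = 2 * size N" for N :: "(nat \<times> nat) multiset"
      by (induction N) auto
    moreover have "sum_mset (image_mset (\<lambda>i. {#i#}) M) = M" for M :: "nat multiset" by (induction M) auto
    moreover have "set_mset (sum_mset (image_mset (\<lambda>(i,j). {#i#} + {#j#}) N)) \<subseteq> {..<n}"
      using p(3) by (auto simp: multisets_of_size_def set_mset_Union_mset split: prod.splits)
        (use order.strict_trans in blast)+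
    ultimately show ?thesis using p by (auto simp: wt_def d_def multisets_of_size_def)
  qed
  \<comment> \<open>The generating function of these weights is the product of complete symmetric
    polynomials in \<open>gt_poly_littlewood\<close>; expanding both sides in monomials compares
    multiplicities.\<close>
  have wdV: "weight_dim n V (rep_space V) N = (\<Sum>f\<in>Q. kostka n f N)" if N: "N \<in> ?W" for N
  proof -
    have finW: "finite ?W" by blast
    have "of_nat (card {p \<in> basis V. wt p = N}) = (of_nat (\<Sum>f\<in>Q. kostka n f N) :: complex)"
    proof (rule mon_coeff_unique[OF finW, where c = "\<lambda>N. of_nat (card {p \<in> basis V. wt p = N})"
          and d = "\<lambda>N. of_nat (\<Sum>f\<in>Q. kostka n f N)"])
      fix x :: "nat \<Rightarrow> complex"
      have "(\<Sum>N\<in>?W. of_nat (card {p \<in> basis V. wt p = N}) * mon x N) =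
        (\<Sum>N\<in>?W. \<Sum>p\<in>{p \<in> basis V. wt p = N}. mon x (wt p))"
        by (intro sum.cong refl) simp
      also have "\<dots> = (\<Sum>p\<in>basis V. mon x (wt p))"
        using finV finW wtW by (intro sum.group) auto
      also have "\<dots> = (\<Sum>(M,N)\<in>?B1 \<times> ?B2. mon x M * mon (\<lambda>(i,j). x i * x j) N)"
        unfolding basisV by (intro sum.cong refl) (auto simp: wt_def mon_sum_mset case_prod_unfold mult.commute)
      also have "\<dots> = complete_sym {..<n} x k * complete_sym {(i,j). i < j \<and> j < n} (\<lambda>(i,j). x i * x j) l"
        by (simp add: complete_sym_def sum_product sum.cartesian_product)
      also have "\<dots> = (\<Sum>f\<in>Q. gt_poly n f x)"
        unfolding gt_poly_littlewood[symmetric] Q_def P_def d_def by (rule sum.cong) auto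
      also have "\<dots> = (\<Sum>f\<in>Q. \<Sum>N\<in>?W. of_nat (kostka n f N) * mon x N)"
        by (intro sum.cong refl) (auto simp: Q_def P_def gt_poly_eq_kostka)
      also have "\<dots> = (\<Sum>N\<in>?W. of_nat (\<Sum>f\<in>Q. kostka n f N) * mon x N)"
        by (subst sum.swap) (simp add: sum_distrib_right)
      finally show "(\<Sum>N\<in>?W. of_nat (card {p \<in> basis V. wt p = N}) * mon x N) =
        (\<Sum>N\<in>?W. of_nat (\<Sum>f\<in>Q. kostka n f N) * mon x N)" .
    qed (rule N)
    then have "card {p \<in> basis V. wt p = N} = (\<Sum>f\<in>Q. kostka n f N)" by (simp only: of_nat_eq_iff)
    then show ?thesis using weight_dim_rep_space[OF finV torV, of N] by simp
  qed
  obtain D where D: "orthogonal_decomposition n V q (rep_space V) D"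
    using complete_reducibility[OF finV q subrep_rep_space] by blast
  have finD: "finite D" using D by (simp add: orthogonal_decomposition_def)
  have irrD: "irreducible_subrep n V X" if "X \<in> D" for X
    using D that by (simp add: orthogonal_decomposition_def)
  have sD: "subrep n V X" "X \<noteq> {0}" if "X \<in> D" for X
    using irrD[OF that] by (auto simp: irreducible_subrep_def)
  obtain r I \<pi> where ts: "type_system n d r I \<pi>" using type_system_exists by blast
  have \<pi>: "bij_betw \<pi> I P" using type_systemD(2)[OF ts] by (simp add: P_def)
  \<comment> \<open>Every weight of \<open>V\<close> has size \<open>d\<close>, so the weight found
    in \<open>X\<close> puts it among the types of this degree.\<close>
  have "\<exists>S\<in>I. rep_equiv n ?A S V X" if X: "X \<in> D" for X
  proof -
    obtain N where N: "weight_dim n V X N \<noteq> 0" using subrep_has_weight[OF polyV sD[OF X]] by blast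
    have "N \<in> ?W"
    proof (rule ccontr)
      assume "N \<notin> ?W"
      then have "weight_dim n V X N = 0"
        using wtW by (intro weight_dim_eq_0[OF finV torV sD(1)[OF X]]) blast
      then show False using N by simp
    qed
    then show ?thesis using irreducible_has_type[OF ts polyV irrD[OF X] _ N] by blast
  qed
  then obtain \<sigma> where \<sigma>: "\<And>X. X \<in> D \<Longrightarrow> \<sigma> X \<in> I \<and> rep_equiv n ?A (\<sigma> X) V X" by metis
  define \<tau> where "\<tau> = (\<lambda>X. \<pi> (\<sigma> X))"
  have \<tau>P: "\<tau> X \<in> P" if "X \<in> D" for X using \<sigma>[OF that] \<pi> by (auto simp: \<tau>_def bij_betw_def)
  have finP: "finite P" unfolding P_def by (rule finite_parts_eq)
  have QP: "Q \<subseteq> P" by (auto simp: Q_def)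
  have mult: "card {X \<in> D. \<tau> X = f} = (if f \<in> Q then 1 else 0)" if f: "f \<in> P" for f
  proof -
    \<comment> \<open>The multiplicity of the shape \<open>f\<close> in \<open>V\<close> minus the
      expected one. Both families give the same weight multiplicities, so \<open>a\<close> is a
      relation between Kostka rows.\<close>
    define a where "a = (\<lambda>f. int (card {X \<in> D. \<tau> X = f}) - (if f \<in> Q then 1 else 0))"
    have "(\<Sum>f\<in>P. a f * int (kostka n f N)) = 0" if N: "N \<in> ?W" for N
    proof -
      have "(\<Sum>f\<in>P. int (card {X \<in> D. \<tau> X = f}) * int (kostka n f N)) =
        (\<Sum>f\<in>P. \<Sum>X\<in>{X \<in> D. \<tau> X = f}. int (kostka n (\<tau> X) N))"
        by (intro sum.cong refl) simp
      also have "\<dots> = (\<Sum>X\<in>D. int (kostka n (\<tau> X) N))"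
        using finD finP \<tau>P by (intro sum.group) auto
      also have "\<dots> = (\<Sum>X\<in>D. int (weight_dim n V X N))"
      proof (intro sum.cong refl)
        fix X assume X: "X \<in> D"
        show "int (kostka n (\<tau> X) N) = int (weight_dim n V X N)"
          using weight_dim_type[OF ts conjunct1[OF \<sigma>[OF X]] sD(1)[OF X] conjunct2[OF \<sigma>[OF X]] N]
          by (simp add: \<tau>_def)
      qed
      also have "\<dots> = int (\<Sum>f\<in>Q. kostka n f N)"
        using weight_dim_decomposition[OF finV q subrep_rep_space D, of N] wdV[OF N] by simp
      also have "\<dots> = (\<Sum>f\<in>P. if f \<in> Q then int (kostka n f N) else 0)"
        using finP QP by (simp add: sum.inter_restrict[symmetric] Int_absorb1)
      finally have e: "(\<Sum>f\<in>P. int (card {X \<in> D. \<tau> X = f}) * int (kostka n f N)) =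
        (\<Sum>f\<in>P. if f \<in> Q then int (kostka n f N) else 0)" .
      have "(\<Sum>f\<in>P. a f * int (kostka n f N)) = (\<Sum>f\<in>P. int (card {X \<in> D. \<tau> X = f}) * int (kostka n f N)) -
        (\<Sum>f\<in>P. if f \<in> Q then int (kostka n f N) else 0)"
        unfolding sum_subtractf[symmetric] a_def by (intro sum.cong refl) (simp add: algebra_simps)
      then show ?thesis using e by simp
    qed
    then have "a f = 0" using kostka_independent[where a = a and n = n and d = d and f = f] f by (simp add: P_def)
    then show ?thesis by (simp add: a_def split: if_splits)
  qed
  have Bd: "la \<in> partitions_of d" "length la \<le> n" "odd_columns la = k" if "la \<in> B" for la
    using that by (auto simp: B_def L_def)
  have rQ: "rows la \<in> Q" if la: "la \<in> B" for la
    using rows_parts[OF Bd(1)[OF la]] parts_mono[OF Bd(2)[OF la]] weight_rows[OF Bd(1)[OF la]]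
      alt_weight_rows[OF Bd(1)[OF la]] Bd(3)[OF la] by (auto simp: Q_def P_def)
  have "\<exists>X\<in>D. \<tau> X = rows la" if la: "la \<in> B" for la
  proof -
    have "card {X \<in> D. \<tau> X = rows la} = 1" using mult[of "rows la"] rQ[OF la] QP by auto
    then have "{X \<in> D. \<tau> X = rows la} \<noteq> {}" by (metis card.empty zero_neq_one)
    then show ?thesis by blast
  qed
  then obtain \<chi> where \<chi>: "\<And>la. la \<in> B \<Longrightarrow> \<chi> la \<in> D \<and> \<tau> (\<chi> la) = rows la" by metis
  have "bij_betw \<chi> B D" unfolding bij_betw_def
  proof
    show "inj_on \<chi> B"
    proof (rule inj_onI)
      fix la la' assume la: "la \<in> B" "la' \<in> B" "\<chi> la = \<chi> la'"
      then have "rows la = rows la'" using \<chi>[OF la(1)] \<chi>[OF la(2)] by simp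
      then show "la = la'" using rows_inj[OF Bd(1)[OF la(1)] Bd(1)[OF la(2)]] by simp
    qed
    show "\<chi> ` B = D"
    proof
      show "\<chi> ` B \<subseteq> D" using \<chi> by blast
      show "D \<subseteq> \<chi> ` B"
      proof
        fix X assume X: "X \<in> D"
        have "X \<in> {Y \<in> D. \<tau> Y = \<tau> X}" using X by simp
        then have "card {Y \<in> D. \<tau> Y = \<tau> X} \<noteq> 0" using finD by (auto simp: card_eq_0_iff)
        then have XQ: "\<tau> X \<in> Q" using mult[OF \<tau>P[OF X]] by (auto split: if_splits)
        have "\<tau> X \<in> {f \<in> parts n. weight f = d}" using \<tau>P[OF X] by (simp add: P_def)
        then obtain la where la: "la \<in> partitions_of d" "length la \<le> n" "\<tau> X = rows la"
          using bij_betw_rows[of d n] unfolding bij_betw_def by (auto simp: image_iff)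
        have "int (odd_columns la) = int k" using alt_weight_rows[OF la(1)] la(3) XQ by (simp add: Q_def)
        then have laB: "la \<in> B" using la by (simp add: B_def L_def)
        \<comment> \<open>Multiplicity one: the summand chosen for \<open>la\<close> has the same
          type as \<open>X\<close> and must be \<open>X\<close>.\<close>
        have "card {Y \<in> D. \<tau> Y = \<tau> X} = 1" using mult[OF \<tau>P[OF X]] XQ by simp
        then obtain Y where "{Y \<in> D. \<tau> Y = \<tau> X} = {Y}" by (auto simp: card_1_singleton_iff)
        then have "\<chi> la = X" using X \<chi>[OF laB] la(3) by (metis (mono_tags, lifting) mem_Collect_eq singletonD)
        then show "X \<in> \<chi> ` B" using laB by blast
      qed
    qed
  qed
  moreover have "rep_equiv n V (\<chi> la) (schur_rep n la) (rep_space (schur_rep n la))" if la: "la \<in> B" for la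
  proof -
    have X: "\<chi> la \<in> D" "\<pi> (\<sigma> (\<chi> la)) = rows la" using \<chi>[OF la] by (auto simp: \<tau>_def)
    note s = \<sigma>[OF X(1)]
    have "subrep n ?A (\<sigma> (\<chi> la))" using type_systemD(3)[OF ts] s by (simp add: irreducible_subrep_def)
    then have "rep_equiv n V (\<chi> la) ?A (\<sigma> (\<chi> la))" using rep_equiv_sym s by blast
    then show ?thesis using rep_equiv_trans schur_rep_type[OF ts Bd(1,2)[OF la] _ X(2)] s by blast
  qed
  moreover have "finite (basis (schur_rep n la))" if la: "la \<in> B" for la
    using schur_rep(1)[OF Bd(1,2)[OF la]] by (simp add: polynomial_rep_def is_rep_def)
  moreover have "basis (schur_rep n la) = {}" if "la \<in> L - B" for la
    using that by (auto simp: B_def schur_rep_def zero_rep_def)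
  moreover have "B \<subseteq> L" by (auto simp: B_def)
  ultimately have "rep_iso n V (direct_sum L (schur_rep n))"
    by (intro rep_iso_direct_sum[OF finV q D])
  then show ?thesis by (simp add: V_def L_def d_def)
qed

end
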